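(* Let $\Omega$ be the unit disk in $\mathbb{R}^2$, with boundary $\Sigma=\mathbb{S}^1$, and suppose that the data are measured on the whole circle, i.e. $\Sigma_1=\mathbb{S}^1$. Let the speed of sound $c>0$ be constant, let $\alpha$ be a cut-off function as in the context, and let the initial pressure $f\in H^1(\Omega)$ be compactly supported within $\Omega$. For $\varepsilon>0$ let $v_\varepsilon$ be the solution of the gradual time reversal problem on $[0,T]$, $T=1/\varepsilon$, defined in the context. Then $v_\varepsilon(0,\cdot)$ converges to $f$ strongly in $H^1(\Omega)$ as $\varepsilon\to0$ (equivalently, as $T\to\infty$).
   Context: Cut-off function: $\alpha:[0,1]\to\mathbb{R}$ is infinitely smooth, identically equal to $1$ in some neighborhood of $0$, and vanishes together with all its derivatives at $1$. Forward problem: $u(t,x)$ is the weak solution of $c^{-2}u_{tt}=\Delta u$ in $\Omega$, $t\ge0$, with $u(0,\cdot)=f$, $u_t(0,\cdot)=0$, $\partial u/\partial\mathbf n=0$ on $\Sigma$; that is, $u(t,x)=\sum_{n\ge1}u_n\varphi_n(x)\cos(\lambda_nt)$, where $(\varphi_n)$ is a basis of Neumann eigenfunctions, $-\Delta\varphi_n=c^{-2}\lambda_n^2\varphi_n$ in $\Omega$, $\partial\varphi_n/\partial\mathbf n=0$ on $\Sigma$, $\lambda_n\ge0$, orthonormal with respect to $\langle g,h\rangle_{c^{-2}}=\int_\Omega c^{-2}g\overline h\,dx$, and $u_n=\langle f,\varphi_n\rangle_{c^{-2}}$. The data are $U(t,z)=u(t,z)$, $z\in\Sigma$. Gradual time reversal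 problem ($T=1/\varepsilon$): $v_\varepsilon$ solves, on $[0,T]\times\Omega$, $$c^{-2}\partial_t^2v_\varepsilon=\Delta v_\varepsilon,\quad v_\varepsilon(T,\cdot)=0,\ \partial_tv_\varepsilon(T,\cdot)=0,\quad v_\varepsilon(t,z)=U(t,z)\alpha(\varepsilon t)\ (z\in\Sigma).$$ This is understood in the weak sense: $v_\varepsilon(t,x)=u(t,x)\alpha(\varepsilon t)+w_\varepsilon(t,x)$, where $w_\varepsilon$ is the weak solution of $c^{-2}\partial_t^2w_\varepsilon-\Delta w_\varepsilon=c^{-2}F_\varepsilon$, $F_\varepsilon(t,x)=-\varepsilon\big(2\alpha'(\varepsilon t)u_t(t,x)+\varepsilon\alpha''(\varepsilon t)u(t,x)\big)$, with $w_\varepsilon(T,\cdot)=\partial_tw_\varepsilon(T,\cdot)=0$ and $w_\varepsilon=0$ on $\Sigma$. Equivalently, $w_\varepsilon(t,x)=\sum_{k\ge1}w_k(t)\psi_k(x)$, where $(\psi_k)$ is a basis of Dirichlet eigenfunctions, $-\Delta\psi_k=c^{-2}\nu_k^2\psi_k$ in $\Omega$, $\psi_k=0$ on $\Sigma$, $\nu_k>0$, orthonormal with respect to $\langle\cdot,\cdot\rangle_{c^{-2}}$, and $w_k''+\nu_k^2w_k=\langle F_\varepsilon(t,\cdot),\psi_k\rangle_{c^{-2}}$, $w_k(T)=w_k'(T)=0$. *)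

theory Defs
  imports "HOL-Analysis.Analysis"
begin

section \<open>Function spaces\<close>

definition partial_within ::
  "'a::euclidean_space set \<Rightarrow> 'a \<Rightarrow> ('a \<Rightarrow> 'b::real_normed_vector) \<Rightarrow> 'a \<Rightarrow> 'b" where
  "partial_within S b f x = frechet_derivative f (at x within S) b"

text \<open>On a set such as a closed ball, \<open>Ck_on k S f\<close> means that \<open>f\<close> is of class \<open>C\<^sup>k\<close> up to the
  boundary (derivatives at boundary points are taken within \<open>S\<close>).\<close>

primrec Ck_on ::
  "nat \<Rightarrow> 'a::euclidean_space set \<Rightarrow> ('a \<Rightarrow> 'b::real_normed_vector) \<Rightarrow> bool" where
  "Ck_on 0 S f \<longleftrightarrow> continuous_on S f"
| "Ck_on (Suc k) S f \<longleftrightarrow>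
     (\<exists>f'. (\<forall>x\<in>S. (f has_derivative f' x) (at x within S)) \<and> (\<forall>b\<in>Basis. Ck_on k S (\<lambda>x. f' x b)))"

definition test_functions :: "'a::euclidean_space set \<Rightarrow> ('a \<Rightarrow> real) set" where
  "test_functions \<Omega> =
     {\<eta>. (\<forall>k. Ck_on k UNIV \<eta>) \<and> compact (closure {x. \<eta> x \<noteq> 0}) \<and> closure {x. \<eta> x \<noteq> 0} \<subseteq> \<Omega>}"

text \<open>Elements of \<open>L\<^sup>2(\<Omega>)\<close> and \<open>H\<^sup>1(\<Omega>)\<close> are represented by functions on the whole space whose
  values outside \<open>\<Omega>\<close> are irrelevant; they are not quotiented by almost-everywhere equality.\<close>

definition L2_on :: "'a::euclidean_space set \<Rightarrow> ('a \<Rightarrow> complex) set" where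
  "L2_on \<Omega> = {g \<in> borel_measurable (lebesgue_on \<Omega>).
     integrable (lebesgue_on \<Omega>) (\<lambda>x. (norm (g x))\<^sup>2)}"

definition L2_norm :: "'a::euclidean_space set \<Rightarrow> ('a \<Rightarrow> complex) \<Rightarrow> real" where
  "L2_norm \<Omega> g = sqrt (LINT x|lebesgue_on \<Omega>. (norm (g x))\<^sup>2)"

definition L2_sums ::
  "'a::euclidean_space set \<Rightarrow> (nat \<Rightarrow> 'a \<Rightarrow> complex) \<Rightarrow> ('a \<Rightarrow> complex) \<Rightarrow> bool" where
  "L2_sums \<Omega> h g \<longleftrightarrow> (\<forall>n. h n \<in> L2_on \<Omega>) \<and> g \<in> L2_on \<Omega> \<and>
     (\<lambda>N. L2_norm \<Omega> (\<lambda>x. (\<Sum>n<N. h n x) - g x)) \<longlonglongrightarrow> 0"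

definition is_weak_partial ::
  "'a::euclidean_space set \<Rightarrow> 'a \<Rightarrow> ('a \<Rightarrow> complex) \<Rightarrow> ('a \<Rightarrow> complex) \<Rightarrow> bool" where
  "is_weak_partial \<Omega> b g h \<longleftrightarrow> (\<forall>\<eta>\<in>test_functions \<Omega>.
     (LINT x|lebesgue_on \<Omega>. partial_within UNIV b \<eta> x *\<^sub>R g x) = - (LINT x|lebesgue_on \<Omega>. \<eta> x *\<^sub>R h x))"

definition H1_on :: "'a::euclidean_space set \<Rightarrow> ('a \<Rightarrow> complex) set" where
  "H1_on \<Omega> = {g \<in> L2_on \<Omega>. \<forall>b\<in>Basis. \<exists>h\<in>L2_on \<Omega>. is_weak_partial \<Omega> b g h}"

definition weak_partial ::
  "'a::euclidean_space set \<Rightarrow> 'a \<Rightarrow> ('a \<Rightarrow> complex) \<Rightarrow> 'a \<Rightarrow> complex" where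
  "weak_partial \<Omega> b g = (SOME h. h \<in> L2_on \<Omega> \<and> is_weak_partial \<Omega> b g h)"

text \<open>Only meaningful for members of \<open>H1_on \<Omega>\<close>.\<close>

definition H1_norm :: "'a::euclidean_space set \<Rightarrow> ('a \<Rightarrow> complex) \<Rightarrow> real" where
  "H1_norm \<Omega> g = sqrt ((L2_norm \<Omega> g)\<^sup>2 + (\<Sum>b\<in>Basis. (L2_norm \<Omega> (weak_partial \<Omega> b g))\<^sup>2))"


section \<open>Eigenfunction bases on the unit disk\<close>

abbreviation unit_disk :: "(real^2) set" where
  "unit_disk \<equiv> ball 0 1"

definition inner_c :: "real \<Rightarrow> (real^2 \<Rightarrow> complex) \<Rightarrow> (real^2 \<Rightarrow> complex) \<Rightarrow> complex" where
  "inner_c c g h = (LINT x|lebesgue_on unit_disk. of_real (1 / c\<^sup>2) * g x * cnj (h x))"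

definition orthonormal_basis_c :: "real \<Rightarrow> (nat \<Rightarrow> real^2 \<Rightarrow> complex) \<Rightarrow> bool" where
  "orthonormal_basis_c c e \<longleftrightarrow> (\<forall>n. e n \<in> L2_on unit_disk) \<and>
     (\<forall>m n. inner_c c (e m) (e n) = (if m = n then 1 else 0)) \<and>
     (\<forall>g\<in>L2_on unit_disk. L2_sums unit_disk (\<lambda>n x. inner_c c g (e n) * e n x) g)"

definition laplacian_on ::
  "'a::euclidean_space set \<Rightarrow> ('a \<Rightarrow> 'b::real_normed_vector) \<Rightarrow> 'a \<Rightarrow> 'b" where
  "laplacian_on \<Omega> f x = (\<Sum>b\<in>Basis. partial_within \<Omega> b (partial_within \<Omega> b f) x)"

text \<open>The outward unit normal of the unit disk at a boundary point \<open>z\<close> is \<open>z\<close> itself.\<close>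

definition neumann_eigenfunction :: "real \<Rightarrow> real \<Rightarrow> (real^2 \<Rightarrow> complex) \<Rightarrow> bool" where
  "neumann_eigenfunction c l \<phi> \<longleftrightarrow> Ck_on 2 unit_disk \<phi> \<and> Ck_on 1 (cball 0 1) \<phi> \<and>
     (\<forall>x\<in>unit_disk. - laplacian_on unit_disk \<phi> x = of_real (1 / c\<^sup>2 * l\<^sup>2) * \<phi> x) \<and>
     (\<forall>z\<in>sphere 0 1. partial_within (cball 0 1) z \<phi> z = 0)"

definition dirichlet_eigenfunction :: "real \<Rightarrow> real \<Rightarrow> (real^2 \<Rightarrow> complex) \<Rightarrow> bool" where
  "dirichlet_eigenfunction c l \<psi> \<longleftrightarrow> Ck_on 2 unit_disk \<psi> \<and> continuous_on (cball 0 1) \<psi> \<and>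
     (\<forall>x\<in>unit_disk. - laplacian_on unit_disk \<psi> x = of_real (1 / c\<^sup>2 * l\<^sup>2) * \<psi> x) \<and>
     (\<forall>z\<in>sphere 0 1. \<psi> z = 0)"

definition neumann_basis ::
  "real \<Rightarrow> (nat \<Rightarrow> real^2 \<Rightarrow> complex) \<Rightarrow> (nat \<Rightarrow> real) \<Rightarrow> bool" where
  "neumann_basis c \<phi> lam \<longleftrightarrow> orthonormal_basis_c c \<phi> \<and>
     (\<forall>n. lam n \<ge> 0 \<and> neumann_eigenfunction c (lam n) (\<phi> n))"

definition dirichlet_basis ::
  "real \<Rightarrow> (nat \<Rightarrow> real^2 \<Rightarrow> complex) \<Rightarrow> (nat \<Rightarrow> real) \<Rightarrow> bool" where
  "dirichlet_basis c \<psi> nu \<longleftrightarrow> orthonormal_basis_c c \<psi> \<and>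
     (\<forall>k. nu k > 0 \<and> dirichlet_eigenfunction c (nu k) (\<psi> k))"


section \<open>Cut-off functions\<close>

text \<open>Only the values of a cut-off function on \<open>[0,1]\<close> matter, so all its derivatives are taken
  within that interval.\<close>

definition deriv01 :: "(real \<Rightarrow> real) \<Rightarrow> real \<Rightarrow> real" where
  "deriv01 g t = vector_derivative g (at t within {0..1})"

definition cutoff :: "(real \<Rightarrow> real) \<Rightarrow> bool" where
  "cutoff \<alpha> \<longleftrightarrow>
     (\<forall>k. \<forall>t\<in>{0..1}. (deriv01 ^^ k) \<alpha> differentiable (at t within {0..1})) \<and>
     (\<exists>\<delta>>0. \<forall>t\<in>{0..1}. t < \<delta> \<longrightarrow> \<alpha> t = 1) \<and>
     (\<forall>k. (deriv01 ^^ k) \<alpha> 1 = 0)"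


section \<open>The forward problem and gradual time reversal\<close>

definition forward_solution ::
  "real \<Rightarrow> (real^2 \<Rightarrow> complex) \<Rightarrow> (real \<Rightarrow> real^2 \<Rightarrow> complex) \<Rightarrow> bool" where
  "forward_solution c f u \<longleftrightarrow> (\<exists>\<phi> lam. neumann_basis c \<phi> lam \<and>
     (\<forall>t\<ge>0. L2_sums unit_disk
        (\<lambda>n x. inner_c c f (\<phi> n) * \<phi> n x * of_real (cos (lam n * t))) (u t)))"

text \<open>\<open>ut\<close> is the time derivative of \<open>u\<close> on \<open>[0,\<infinity>)\<close> as an \<open>L\<^sup>2\<close>-valued function.\<close>

definition L2_time_derivative ::
  "(real \<Rightarrow> real^2 \<Rightarrow> complex) \<Rightarrow> (real \<Rightarrow> real^2 \<Rightarrow> complex) \<Rightarrow> bool" where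
  "L2_time_derivative u ut \<longleftrightarrow> (\<forall>t\<ge>0. ut t \<in> L2_on unit_disk \<and>
     ((\<lambda>s. L2_norm unit_disk (\<lambda>x. (u s x - u t x) / of_real (s - t) - ut t x)) \<longlongrightarrow> 0)
       (at t within {0..}))"

definition source_term ::
  "(real \<Rightarrow> real) \<Rightarrow> real \<Rightarrow> (real \<Rightarrow> real^2 \<Rightarrow> complex) \<Rightarrow> (real \<Rightarrow> real^2 \<Rightarrow> complex)
     \<Rightarrow> real \<Rightarrow> real^2 \<Rightarrow> complex" where
  "source_term \<alpha> \<epsilon> u ut t x =
     - of_real \<epsilon> * (2 * of_real (deriv01 \<alpha> (\<epsilon> * t)) * ut t x
                   + of_real \<epsilon> * of_real (deriv01 (deriv01 \<alpha>) (\<epsilon> * t)) * u t x)"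

text \<open>\<open>w\<close> is the weak solution on \<open>[0,T]\<close> of \<open>c\<^sup>-\<^sup>2 w\<^sub>t\<^sub>t - \<Delta>w = c\<^sup>-\<^sup>2 F\<close> with zero Dirichlet data
  and zero final data at time \<open>T\<close>; \<open>a k\<close> are its Dirichlet coefficients and \<open>a' k\<close> their time
  derivatives.\<close>

definition backward_dirichlet_solution ::
  "real \<Rightarrow> real \<Rightarrow> (real \<Rightarrow> real^2 \<Rightarrow> complex) \<Rightarrow> (real \<Rightarrow> real^2 \<Rightarrow> complex) \<Rightarrow> bool" where
  "backward_dirichlet_solution c T F w \<longleftrightarrow>
     (\<exists>\<psi> nu a a'. dirichlet_basis c \<psi> nu \<and>
       (\<forall>k. \<forall>t\<in>{0..T}.
          (a k has_vector_derivative a' k t) (at t within {0..T}) \<and>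
          (a' k has_vector_derivative (inner_c c (F t) (\<psi> k) - of_real ((nu k)\<^sup>2) * a k t))
            (at t within {0..T})) \<and>
       (\<forall>k. a k T = 0 \<and> a' k T = 0) \<and>
       (\<forall>t\<in>{0..T}. L2_sums unit_disk (\<lambda>k x. a k t * \<psi> k x) (w t)))"

text \<open>The prescribed boundary data \<open>U(t,z) \<alpha>(\<epsilon>t)\<close>, with \<open>U\<close> the trace of \<open>u\<close> on the whole
  unit circle, enter through the term \<open>u(t,x) \<alpha>(\<epsilon>t)\<close>, since \<open>w\<close> vanishes on the whole circle.\<close>

definition gradual_time_reversal ::
  "real \<Rightarrow> (real \<Rightarrow> real) \<Rightarrow> real \<Rightarrow> (real \<Rightarrow> real^2 \<Rightarrow> complex) \<Rightarrow> (real \<Rightarrow> real^2 \<Rightarrow> complex) \<Rightarrow> bool"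
  where
  "gradual_time_reversal c \<alpha> \<epsilon> u v \<longleftrightarrow>
     (\<exists>ut w. L2_time_derivative u ut \<and>
        backward_dirichlet_solution c (1 / \<epsilon>) (source_term \<alpha> \<epsilon> u ut) w \<and>
        (\<forall>t\<in>{0..1 / \<epsilon>}. \<forall>x\<in>unit_disk. v t x = u t x * of_real (\<alpha> (\<epsilon> * t)) + w t x))"

end

theory Submission
  imports Defs
begin

text \<open>
  The reconstruction error at time 0 is \<open>w(0)\<close>, a Dirichlet series with coefficients \<open>a\<^sub>k\<close>. Gradients
  of Dirichlet eigenfunctions are orthogonal and the frequencies satisfy \<open>\<nu>\<^sub>k \<ge> 2c\<close>, so the \<open>H\<^sup>1\<close> norm
  of the error is controlled by the energy \<open>\<Sum> \<nu>\<^sub>k\<^sup>2 |a\<^sub>k|\<^sup>2\<close> (lemma \<open>dirichlet_series_H1\<close>), and this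
  energy has to be shown to vanish as \<open>\<epsilon>\<close> tends to 0 (lemma \<open>error_energy_bound\<close>).

  By Duhamel's formula \<open>\<nu>\<^sub>k a\<^sub>k\<close> is the integral of the source coefficient against \<open>sin(\<nu>\<^sub>k t)\<close>. The
  source has size \<open>\<epsilon>\<close> and acts during the time \<open>1/\<epsilon>\<close>, which bounds the error energy by a multiple of
  the energy of the forward solution, uniformly in \<open>\<epsilon>\<close>. The latter is finite because the forward solution
  is differentiable in time at every time (lemma \<open>forward_energy_summable\<close>). Hence all but finitely many
  Neumann modes contribute arbitrarily little, and it suffices to treat a single one.

  A Neumann mode \<open>\<phi>\<close> of frequency \<open>l\<close> drives a Dirichlet mode \<open>\<psi>\<close> of frequency \<open>m\<close> through
  \<open>\<langle>\<phi>, \<psi>\<rangle>\<close> times an oscillatory integral with slowly varying amplitude, of order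
  \<open>\<epsilon> l / |l - m|\<close>. The danger is resonance. On the disk it is excluded by a Rellich-type identity,
  \<open>2 l\<^sup>2 \<langle>\<phi>, \<psi>\<rangle> = (m\<^sup>2 - l\<^sup>2) \<langle>x \<cdot> \<nabla>\<phi>, \<psi>\<rangle>\<close> (lemma \<open>neumann_dirichlet_coupling\<close>): the
  radial derivative \<open>x \<cdot> \<nabla>\<phi>\<close> vanishes on the circle together with \<open>\<psi>\<close>, and
  \<open>\<Delta>(x \<cdot> \<nabla>\<phi>) = x \<cdot> \<nabla>\<Delta>\<phi> + 2 \<Delta>\<phi>\<close>. The factor \<open>m\<^sup>2 - l\<^sup>2\<close> cancels the small
  denominator, so each Neumann mode produces an error energy of order \<open>\<epsilon>\<^sup>2\<close> with a constant that does not
  depend on the Dirichlet basis (lemma \<open>single_mode_response\<close> and Bessel's inequality). This uniformity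
  matters because the Dirichlet basis may change with \<open>\<epsilon>\<close>.

  Dirichlet eigenfunctions are only known to be continuous up to the circle. All applications of Green's
  formula therefore use radial cut-offs, and a barrier argument shows that an eigenfunction is bounded by
  a multiple of \<open>1 - |x|\<^sup>2\<close> (lemma \<open>dirichlet_bounds\<close>), which compensates the derivatives of the
  cut-off. Weak derivatives are identified by the density of test functions (lemma
  \<open>weak_partial_unique\<close>).
\<close>

section \<open>Square-integrable functions\<close>

lemma L2_on_measurable: "g \<in> L2_on \<Omega> \<Longrightarrow> g \<in> borel_measurable (lebesgue_on \<Omega>)"
  and L2_on_integrable: "g \<in> L2_on \<Omega> \<Longrightarrow> integrable (lebesgue_on \<Omega>) (\<lambda>x. (norm (g x))\<^sup>2)"
  by (auto simp: L2_on_def)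

lemma L2_on_norm_mult_integrable:
  assumes "g \<in> L2_on \<Omega>" "h \<in> L2_on \<Omega>"
  shows "integrable (lebesgue_on \<Omega>) (\<lambda>x. norm (g x) * norm (h x))"
proof (rule Bochner_Integration.integrable_bound)
  show "integrable (lebesgue_on \<Omega>) (\<lambda>x. (norm (g x))\<^sup>2 + (norm (h x))\<^sup>2)"
    using assms by (auto simp: L2_on_def)
  show "(\<lambda>x. norm (g x) * norm (h x)) \<in> borel_measurable (lebesgue_on \<Omega>)"
    using assms[THEN L2_on_measurable] by measurable
  show "AE x in lebesgue_on \<Omega>. norm (norm (g x) * norm (h x)) \<le> norm ((norm (g x))\<^sup>2 + (norm (h x))\<^sup>2)"
  proof (rule AE_I2)
    fix x
    have "2 * (norm (g x) * norm (h x)) \<le> (norm (g x))\<^sup>2 + (norm (h x))\<^sup>2"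
      using sum_squares_bound[of "norm (g x)" "norm (h x)"] by simp
    then show "norm (norm (g x) * norm (h x)) \<le> norm ((norm (g x))\<^sup>2 + (norm (h x))\<^sup>2)"
      by (simp add: abs_mult) (smt (verit) mult_nonneg_nonneg norm_ge_zero)
  qed
qed

lemma L2_on_mult_integrable:
  assumes "g \<in> L2_on \<Omega>" "h \<in> L2_on \<Omega>"
  shows "integrable (lebesgue_on \<Omega>) (\<lambda>x. g x * cnj (h x))"
  using L2_on_norm_mult_integrable[OF assms]
proof (rule Bochner_Integration.integrable_bound)
  have "(\<lambda>x. cnj (h x)) \<in> borel_measurable (lebesgue_on \<Omega>)"
    using assms(2)[THEN L2_on_measurable]
    by (intro borel_measurable_continuous_on[where f=cnj, OF _ ]) (auto intro: continuous_intros)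
  then show "(\<lambda>x. g x * cnj (h x)) \<in> borel_measurable (lebesgue_on \<Omega>)"
    using assms(1)[THEN L2_on_measurable] by measurable
qed (auto simp: norm_mult)

lemma L2_on_scale: "g \<in> L2_on \<Omega> \<Longrightarrow> (\<lambda>x. a * g x) \<in> L2_on \<Omega>"
  by (auto simp: L2_on_def norm_mult power_mult_distrib)

lemma L2_on_add:
  assumes "g \<in> L2_on \<Omega>" "h \<in> L2_on \<Omega>"
  shows "(\<lambda>x. g x + h x) \<in> L2_on \<Omega>"
proof -
  have m: "(\<lambda>x. g x + h x) \<in> borel_measurable (lebesgue_on \<Omega>)"
    using assms[THEN L2_on_measurable] by measurable
  moreover have "integrable (lebesgue_on \<Omega>) (\<lambda>x. (norm (g x + h x))\<^sup>2)"
  proof (rule Bochner_Integration.integrable_bound)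
    show "integrable (lebesgue_on \<Omega>) (\<lambda>x. 2 * (norm (g x))\<^sup>2 + 2 * (norm (h x))\<^sup>2)"
      using assms by (auto simp: L2_on_def)
    show "AE x in lebesgue_on \<Omega>. norm ((norm (g x + h x))\<^sup>2) \<le> norm (2 * (norm (g x))\<^sup>2 + 2 * (norm (h x))\<^sup>2)"
    proof (rule AE_I2)
      fix x
      have "(norm (g x + h x))\<^sup>2 \<le> (norm (g x) + norm (h x))\<^sup>2"
        by (intro power_mono norm_triangle_ineq) auto
      also have "\<dots> \<le> 2 * (norm (g x))\<^sup>2 + 2 * (norm (h x))\<^sup>2"
        using sum_squares_bound[of "norm (g x)" "norm (h x)"] by (simp add: power2_sum)
      finally show "norm ((norm (g x + h x))\<^sup>2) \<le> norm (2 * (norm (g x))\<^sup>2 + 2 * (norm (h x))\<^sup>2)"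
        by simp
    qed
  qed (use m in measurable)
  ultimately show ?thesis by (simp add: L2_on_def)
qed

lemma L2_on_diff: "g \<in> L2_on \<Omega> \<Longrightarrow> h \<in> L2_on \<Omega> \<Longrightarrow> (\<lambda>x. g x - h x) \<in> L2_on \<Omega>"
  using L2_on_add[OF _ L2_on_scale[of h \<Omega> "-1"], of g] by simp

lemma L2_on_zero: "(\<lambda>x. 0) \<in> L2_on \<Omega>"
  by (simp add: L2_on_def)

lemma L2_on_sum: "(\<And>i. i \<in> I \<Longrightarrow> g i \<in> L2_on \<Omega>) \<Longrightarrow> (\<lambda>x. \<Sum>i\<in>I. g i x) \<in> L2_on \<Omega>"
  by (induction I rule: infinite_finite_induct) (auto simp: L2_on_zero intro!: L2_on_add)

lemma L2_norm_nonneg [simp]: "0 \<le> L2_norm \<Omega> g"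
  by (simp add: L2_norm_def)

lemma L2_norm_sq: "(L2_norm \<Omega> g)\<^sup>2 = (LINT x|lebesgue_on \<Omega>. (norm (g x))\<^sup>2)"
  by (simp add: L2_norm_def)

lemma L2_on_cong_AE:
  assumes "g \<in> L2_on \<Omega>" "AE x in lebesgue_on \<Omega>. g x = h x" "h \<in> borel_measurable (lebesgue_on \<Omega>)"
  shows "h \<in> L2_on \<Omega>"
proof -
  have "integrable (lebesgue_on \<Omega>) (\<lambda>x. (norm (h x))\<^sup>2)"
    using assms by (subst integrable_cong_AE[where g="\<lambda>x. (norm (g x))\<^sup>2"])
      (auto simp: L2_on_def)
  with assms show ?thesis by (simp add: L2_on_def)
qed

lemma L2_norm_cong_AE:
  assumes "AE x in lebesgue_on \<Omega>. g x = h x"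
    "g \<in> borel_measurable (lebesgue_on \<Omega>)" "h \<in> borel_measurable (lebesgue_on \<Omega>)"
  shows "L2_norm \<Omega> g = L2_norm \<Omega> h"
  unfolding L2_norm_def
  by (rule arg_cong[where f=sqrt], rule integral_cong_AE) (use assms in \<open>auto\<close>)

lemma L2_Cauchy_Schwarz_norm:
  assumes "g \<in> L2_on \<Omega>" "h \<in> L2_on \<Omega>"
  shows "(LINT x|lebesgue_on \<Omega>. norm (g x) * norm (h x)) \<le> L2_norm \<Omega> g * L2_norm \<Omega> h"
proof -
  define A where "A = (LINT x|lebesgue_on \<Omega>. (norm (g x))\<^sup>2)"
  define B where "B = (LINT x|lebesgue_on \<Omega>. (norm (h x))\<^sup>2)"
  define I where "I = (LINT x|lebesgue_on \<Omega>. norm (g x) * norm (h x))"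
  have nn: "A \<ge> 0" "B \<ge> 0" "I \<ge> 0" by (auto simp: A_def B_def I_def)
  have q: "0 \<le> A - 2 * t * I + t\<^sup>2 * B" for t
  proof -
    have "0 \<le> (LINT x|lebesgue_on \<Omega>. (norm (g x) - t * norm (h x))\<^sup>2)" by simp
    also have "\<dots> = (LINT x|lebesgue_on \<Omega>. ((norm (g x))\<^sup>2 - 2 * t * (norm (g x) * norm (h x))) + t\<^sup>2 * (norm (h x))\<^sup>2)"
      by (rule Bochner_Integration.integral_cong) (auto simp: power2_eq_square algebra_simps)
    also have "\<dots> = A - 2 * t * I + t\<^sup>2 * B"
      unfolding A_def B_def I_def
      using assms[THEN L2_on_integrable] L2_on_norm_mult_integrable[OF assms] by simp
    finally show ?thesis .
  qed
  have "I\<^sup>2 \<le> A * B"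
  proof (cases "B = 0")
    case True
    have "I = 0"
    proof (rule ccontr)
      assume "I \<noteq> 0"
      then have "I > 0" using nn by simp
      with q[of "(A + 1) / (2 * I)"] True show False by simp
    qed
    then show ?thesis using True by simp
  next
    case False
    then have "B > 0" using nn by simp
    then show ?thesis using q[of "I / B"] by (simp add: power2_eq_square field_simps)
  qed
  then have "I \<le> sqrt (A * B)" by (simp add: real_le_rsqrt)
  then show ?thesis by (simp add: real_sqrt_mult A_def B_def I_def L2_norm_def)
qed

lemma L2_Cauchy_Schwarz:
  assumes "g \<in> L2_on \<Omega>" "h \<in> L2_on \<Omega>"
  shows "norm (LINT x|lebesgue_on \<Omega>. g x * cnj (h x)) \<le> L2_norm \<Omega> g * L2_norm \<Omega> h"
proof -
  have "norm (LINT x|lebesgue_on \<Omega>. g x * cnj (h x)) \<le> (LINT x|lebesgue_on \<Omega>. norm (g x) * norm (h x))"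
    by (rule order_trans[OF integral_norm_bound]) (simp add: norm_mult)
  then show ?thesis using L2_Cauchy_Schwarz_norm[OF assms] by linarith
qed

lemma L2_norm_triangle:
  assumes "g \<in> L2_on \<Omega>" "h \<in> L2_on \<Omega>"
  shows "L2_norm \<Omega> (\<lambda>x. g x + h x) \<le> L2_norm \<Omega> g + L2_norm \<Omega> h"
proof -
  have "(L2_norm \<Omega> (\<lambda>x. g x + h x))\<^sup>2 \<le>
      (LINT x|lebesgue_on \<Omega>. (norm (g x))\<^sup>2 + 2 * (norm (g x) * norm (h x)) + (norm (h x))\<^sup>2)"
    unfolding L2_norm_sq
  proof (rule integral_mono)
    fix x
    have "(norm (g x + h x))\<^sup>2 \<le> (norm (g x) + norm (h x))\<^sup>2"
      by (intro power_mono norm_triangle_ineq) auto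
    then show "(norm (g x + h x))\<^sup>2 \<le> (norm (g x))\<^sup>2 + 2 * (norm (g x) * norm (h x)) + (norm (h x))\<^sup>2"
      by (simp add: power2_sum)
  qed (use L2_on_integrable[OF L2_on_add[OF assms]] assms[THEN L2_on_integrable]
      L2_on_norm_mult_integrable[OF assms] in auto)
  also have "\<dots> = (L2_norm \<Omega> g)\<^sup>2 + 2 * (LINT x|lebesgue_on \<Omega>. norm (g x) * norm (h x)) + (L2_norm \<Omega> h)\<^sup>2"
    unfolding L2_norm_sq
    using assms[THEN L2_on_integrable] L2_on_norm_mult_integrable[OF assms] by simp
  also have "\<dots> \<le> (L2_norm \<Omega> g + L2_norm \<Omega> h)\<^sup>2"
    using L2_Cauchy_Schwarz_norm[OF assms] by (simp add: power2_sum)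
  finally show ?thesis by (rule power2_le_imp_le) simp
qed

lemma L2_norm_minus_commute: "L2_norm \<Omega> (\<lambda>x. g x - h x) = L2_norm \<Omega> (\<lambda>x. h x - g x)"
  by (simp add: L2_norm_def norm_minus_commute)

lemma L2_norm_diff_triangle:
  assumes "g \<in> L2_on \<Omega>" "h \<in> L2_on \<Omega>" "k \<in> L2_on \<Omega>"
  shows "L2_norm \<Omega> (\<lambda>x. g x - k x) \<le> L2_norm \<Omega> (\<lambda>x. g x - h x) + L2_norm \<Omega> (\<lambda>x. h x - k x)"
  using L2_norm_triangle[OF L2_on_diff[OF assms(1,2)] L2_on_diff[OF assms(2,3)]] by simp

lemma L2_norm_diff_zero_AE:
  assumes "g \<in> L2_on \<Omega>" "h \<in> L2_on \<Omega>" "L2_norm \<Omega> (\<lambda>x. g x - h x) = 0"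
  shows "AE x in lebesgue_on \<Omega>. g x = h x"
proof -
  have "(LINT x|lebesgue_on \<Omega>. (norm (g x - h x))\<^sup>2) = 0"
    using assms(3) by (simp add: L2_norm_def)
  then have "AE x in lebesgue_on \<Omega>. (norm (g x - h x))\<^sup>2 = 0"
    using integral_nonneg_eq_0_iff_AE[OF L2_on_integrable[OF L2_on_diff[OF assms(1,2)]]] by simp
  then show ?thesis by simp
qed

lemma L2_on_bounded:
  assumes "g \<in> borel_measurable (lebesgue_on \<Omega>)" "\<And>x. x \<in> \<Omega> \<Longrightarrow> norm (g x) \<le> B"
    "\<Omega> \<in> lmeasurable"
  shows "g \<in> L2_on \<Omega>"
proof -
  have "integrable (lebesgue_on \<Omega>) (\<lambda>x. (norm (g x))\<^sup>2)"
  proof (rule Bochner_Integration.integrable_bound[where f="\<lambda>x. B\<^sup>2"])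
    show "integrable (lebesgue_on \<Omega>) (\<lambda>x. B\<^sup>2)"
      using finite_measure.integrable_const[OF finite_measure_lebesgue_on[OF assms(3)]] .
    show "AE x in lebesgue_on \<Omega>. norm ((norm (g x))\<^sup>2) \<le> norm (B\<^sup>2)"
      using assms(2) by (intro AE_I2) (auto intro!: power_mono)
  qed (use assms(1) in measurable)
  then show ?thesis using assms(1) by (simp add: L2_on_def)
qed

lemma L2_convergent_subsequence_AE:
  assumes S: "\<And>n. S n \<in> L2_on \<Omega>"
    and d: "\<And>j. L2_norm \<Omega> (\<lambda>x. S (Suc j) x - S j x) \<le> (1/2) ^ j"
  shows "AE x in lebesgue_on \<Omega>. convergent (\<lambda>j. S j x)"
proof -
  define h where "h j x = 2 ^ j * (norm (S (Suc j) x - S j x))\<^sup>2" for j x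
  have h0: "h j x \<ge> 0" for j x by (simp add: h_def)
  have hi: "integrable (lebesgue_on \<Omega>) (h j)" for j
    unfolding h_def using L2_on_integrable[OF L2_on_diff[OF S S]] by auto
  have hb: "(LINT x|lebesgue_on \<Omega>. h j x) \<le> (1/2) ^ j" for j
  proof -
    have "(LINT x|lebesgue_on \<Omega>. h j x) = 2 ^ j * (L2_norm \<Omega> (\<lambda>x. S (Suc j) x - S j x))\<^sup>2"
      unfolding h_def L2_norm_sq by simp
    also have "\<dots> \<le> 2 ^ j * ((1/2) ^ j)\<^sup>2"
      using d by (intro mult_left_mono power_mono) auto
    also have "\<dots> = (1/2) ^ j" by (simp add: power2_eq_square power_divide)
    finally show ?thesis .
  qed
  have "(\<integral>\<^sup>+ x. (\<Sum>j. ennreal (h j x)) \<partial>lebesgue_on \<Omega>) = (\<Sum>j. \<integral>\<^sup>+ x. ennreal (h j x) \<partial>lebesgue_on \<Omega>)"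
    by (rule nn_integral_suminf) (use hi[THEN borel_measurable_integrable] in measurable)
  also have "\<dots> = (\<Sum>j. ennreal (LINT x|lebesgue_on \<Omega>. h j x))"
    by (intro suminf_cong nn_integral_eq_integral hi AE_I2 h0)
  also have "\<dots> \<le> (\<Sum>j. ennreal ((1/2) ^ j))"
    using hb by (intro suminf_le ennreal_leI) auto
  also have "\<dots> = ennreal (\<Sum>j. (1/2) ^ j)"
    by (rule suminf_ennreal2) auto
  also have "\<dots> < \<infinity>" by simp
  finally have fin: "(\<integral>\<^sup>+ x. (\<Sum>j. ennreal (h j x)) \<partial>lebesgue_on \<Omega>) \<noteq> \<infinity>"
    by (rule less_imp_neq)
  have "(\<lambda>x. ennreal (h j x)) \<in> borel_measurable (lebesgue_on \<Omega>)" for j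
    by (rule measurable_compose[OF borel_measurable_integrable[OF hi] measurable_ennreal])
  then have "(\<lambda>x. \<Sum>j. ennreal (h j x)) \<in> borel_measurable (lebesgue_on \<Omega>)"
    by (rule borel_measurable_suminf_order)
  from nn_integral_PInf_AE[OF this fin] have "AE x in lebesgue_on \<Omega>. (\<Sum>j. ennreal (h j x)) \<noteq> \<infinity>" .
  then show ?thesis
  proof eventually_elim
    case (elim x)
    then have sh: "summable (\<lambda>j. h j x)"
      using summable_suminf_not_top[of "\<lambda>j. h j x"] h0 by auto
    have "summable (\<lambda>j. S (Suc j) x - S j x)"
    proof (rule summable_comparison_test')
      show "summable (\<lambda>j. h j x + (1/2) ^ j)"
        by (intro summable_add sh summable_geometric) simp
      fix j :: nat
      let ?d = "norm (S (Suc j) x - S j x)"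
      have "0 \<le> (2 ^ j * ?d - 1)\<^sup>2" by simp
      then have "2 ^ j * (2 * ?d) \<le> 2 ^ j * (2 ^ j * ?d\<^sup>2) + 1"
        by (simp add: power2_eq_square algebra_simps)
      then have "2 ^ j * (2 * ?d) \<le> 2 ^ j * (2 ^ j * ?d\<^sup>2 + (1/2) ^ j)"
        by (simp add: distrib_left power_divide)
      then have "2 * ?d \<le> 2 ^ j * ?d\<^sup>2 + (1/2) ^ j"
        by (subst (asm) mult_le_cancel_left_pos) auto
      then show "norm (S (Suc j) x - S j x) \<le> h j x + (1/2) ^ j"
        unfolding h_def using norm_ge_zero[of "S (Suc j) x - S j x"] by linarith
    qed
    then have "convergent (\<lambda>n. (\<Sum>j<n. S (Suc j) x - S j x) + S 0 x)"
      by (intro convergent_add convergent_const) (simp add: summable_iff_convergent)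
    then show ?case by (simp add: sum_lessThan_telescope[of "\<lambda>j. S j x"])
  qed
qed

text \<open>A rapidly convergent subsequence converges almost everywhere, and Fatou's lemma turns the
  Cauchy condition into convergence to its pointwise limit.\<close>

lemma Riesz_Fischer:
  assumes S: "\<And>n. S n \<in> L2_on \<Omega>"
    and C: "\<And>e. e > 0 \<Longrightarrow> \<exists>N. \<forall>m\<ge>N. \<forall>n\<ge>N. L2_norm \<Omega> (\<lambda>x. S m x - S n x) \<le> e"
  obtains g where "g \<in> L2_on \<Omega>" "(\<lambda>n. L2_norm \<Omega> (\<lambda>x. S n x - g x)) \<longlonglongrightarrow> 0"
proof -
  obtain N where N: "\<And>j m n. m \<ge> N j \<Longrightarrow> n \<ge> N j \<Longrightarrow> L2_norm \<Omega> (\<lambda>x. S m x - S n x) \<le> (1/2) ^ j"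
    using C[of "(1/2)^j" for j] by (metis zero_less_divide_1_iff zero_less_numeral zero_less_power)
  define r where "r j = (\<Sum>i\<le>j. N i) + j" for j
  have rN: "r j \<ge> N j" for j
    unfolding r_def by (metis atMost_iff finite_atMost le_refl member_le_sum trans_le_add1 zero_le)
  have rs: "r j \<le> r (Suc j)" for j by (simp add: r_def)
  have rj: "r j \<ge> j" for j by (simp add: r_def)
  have conv: "AE x in lebesgue_on \<Omega>. convergent (\<lambda>j. S (r j) x)"
    by (rule L2_convergent_subsequence_AE) (use S N rN rs order_trans in blast)+
  define g where "g x = lim (\<lambda>j. S (r j) x)" for x
  have gm: "g \<in> borel_measurable (lebesgue_on \<Omega>)"
    unfolding g_def by (rule borel_measurable_lim_metric) (rule L2_on_measurable[OF S])
  have key: "integrable (lebesgue_on \<Omega>) (\<lambda>x. (norm (S n x - g x))\<^sup>2) \<and> L2_norm \<Omega> (\<lambda>x. S n x - g x) \<le> e"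
    if e: "e > 0" and n: "\<forall>m\<ge>M. L2_norm \<Omega> (\<lambda>x. S n x - S m x) \<le> e" for e n M
  proof -
    have "(\<integral>\<^sup>+ x. ennreal ((norm (S n x - g x))\<^sup>2) \<partial>lebesgue_on \<Omega>)
        = (\<integral>\<^sup>+ x. liminf (\<lambda>j. ennreal ((norm (S n x - S (r j) x))\<^sup>2)) \<partial>lebesgue_on \<Omega>)"
      using conv
    proof (intro nn_integral_cong_AE, eventually_elim)
      case (elim x)
      then have "(\<lambda>j. S (r j) x) \<longlonglongrightarrow> g x" by (simp add: g_def convergent_LIMSEQ_iff)
      then have "(\<lambda>j. ennreal ((norm (S n x - S (r j) x))\<^sup>2)) \<longlonglongrightarrow> ennreal ((norm (S n x - g x))\<^sup>2)"
        by (intro tendsto_ennrealI tendsto_intros)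
      from lim_imp_Liminf[OF sequentially_bot this] show ?case by (rule sym)
    qed
    also have "\<dots> \<le> liminf (\<lambda>j. \<integral>\<^sup>+ x. ennreal ((norm (S n x - S (r j) x))\<^sup>2) \<partial>lebesgue_on \<Omega>)"
      by (rule nn_integral_liminf) (use S[THEN L2_on_measurable] in measurable)
    also have "\<dots> \<le> limsup (\<lambda>j. \<integral>\<^sup>+ x. ennreal ((norm (S n x - S (r j) x))\<^sup>2) \<partial>lebesgue_on \<Omega>)"
      by (rule Liminf_le_Limsup) simp
    also have "\<dots> \<le> ennreal (e\<^sup>2)"
    proof (rule Limsup_bounded, rule eventually_sequentiallyI[of M])
      fix j assume "j \<ge> M"
      then have "L2_norm \<Omega> (\<lambda>x. S n x - S (r j) x) \<le> e" using n rj order_trans by blast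
      then have "(L2_norm \<Omega> (\<lambda>x. S n x - S (r j) x))\<^sup>2 \<le> e\<^sup>2" by (intro power_mono) auto
      then have "(LINT x|lebesgue_on \<Omega>. (norm (S n x - S (r j) x))\<^sup>2) \<le> e\<^sup>2" by (simp add: L2_norm_sq)
      then show "(\<integral>\<^sup>+ x. ennreal ((norm (S n x - S (r j) x))\<^sup>2) \<partial>lebesgue_on \<Omega>) \<le> ennreal (e\<^sup>2)"
        using L2_on_integrable[OF L2_on_diff[OF S S]]
        by (subst nn_integral_eq_integral) (auto intro: ennreal_leI)
    qed
    finally have le: "(\<integral>\<^sup>+ x. ennreal ((norm (S n x - g x))\<^sup>2) \<partial>lebesgue_on \<Omega>) \<le> ennreal (e\<^sup>2)" .
    have i: "integrable (lebesgue_on \<Omega>) (\<lambda>x. (norm (S n x - g x))\<^sup>2)"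
      by (rule integrableI_bounded)
        (use le gm S[THEN L2_on_measurable] le_less_trans[OF le ennreal_less_top] in \<open>auto\<close>)
    have "ennreal ((L2_norm \<Omega> (\<lambda>x. S n x - g x))\<^sup>2) \<le> ennreal (e\<^sup>2)"
      using le by (subst (asm) nn_integral_eq_integral[OF i]) (auto simp: L2_norm_sq)
    then have "(L2_norm \<Omega> (\<lambda>x. S n x - g x))\<^sup>2 \<le> e\<^sup>2" by (subst (asm) ennreal_le_iff) auto
    then have "L2_norm \<Omega> (\<lambda>x. S n x - g x) \<le> e" using e by (meson less_imp_le power2_le_imp_le)
    with i show ?thesis by simp
  qed
  have "(\<lambda>x. S (N 0) x - g x) \<in> L2_on \<Omega>"
    using key[of 1 "N 0" "N 0"] N[where j=0, of "N 0"] gm S[THEN L2_on_measurable] by (auto simp: L2_on_def)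
  from L2_on_diff[OF S[of "N 0"] this] have g: "g \<in> L2_on \<Omega>" by simp
  have "(\<lambda>n. L2_norm \<Omega> (\<lambda>x. S n x - g x)) \<longlonglongrightarrow> 0"
  proof (rule LIMSEQ_I)
    fix e :: real assume "e > 0"
    then obtain M where M: "\<forall>m\<ge>M. \<forall>n\<ge>M. L2_norm \<Omega> (\<lambda>x. S m x - S n x) \<le> e/2"
      using C[of "e/2"] by auto
    have "L2_norm \<Omega> (\<lambda>x. S n x - g x) \<le> e/2" if "n \<ge> M" for n
      using key[of "e/2" M n] M that \<open>e > 0\<close> by auto
    then show "\<exists>no. \<forall>n\<ge>no. norm (L2_norm \<Omega> (\<lambda>x. S n x - g x) - 0) < e"
      using \<open>e > 0\<close> by (intro exI[of _ M]) (fastforce)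
  qed
  with g show ?thesis by (rule that)
qed

lemma L2_pairing_tendsto:
  assumes S: "\<And>n. S n \<in> L2_on \<Omega>" "g \<in> L2_on \<Omega>" and l: "(\<lambda>n. L2_norm \<Omega> (\<lambda>x. S n x - g x)) \<longlonglongrightarrow> 0"
    and h: "h \<in> L2_on \<Omega>"
  shows "(\<lambda>n. LINT x|lebesgue_on \<Omega>. S n x * cnj (h x)) \<longlonglongrightarrow> (LINT x|lebesgue_on \<Omega>. g x * cnj (h x))"
proof (rule LIM_zero_cancel, rule Lim_null_comparison)
  show "\<forall>\<^sub>F n in sequentially. norm ((LINT x|lebesgue_on \<Omega>. S n x * cnj (h x)) - (LINT x|lebesgue_on \<Omega>. g x * cnj (h x)))
      \<le> L2_norm \<Omega> (\<lambda>x. S n x - g x) * L2_norm \<Omega> h"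
  proof (rule always_eventually, rule allI)
    fix n
    have "(LINT x|lebesgue_on \<Omega>. S n x * cnj (h x)) - (LINT x|lebesgue_on \<Omega>. g x * cnj (h x))
        = (LINT x|lebesgue_on \<Omega>. (S n x - g x) * cnj (h x))"
      by (subst Bochner_Integration.integral_diff[symmetric])
        (auto intro: L2_on_mult_integrable S h simp: left_diff_distrib)
    then show "norm ((LINT x|lebesgue_on \<Omega>. S n x * cnj (h x)) - (LINT x|lebesgue_on \<Omega>. g x * cnj (h x)))
      \<le> L2_norm \<Omega> (\<lambda>x. S n x - g x) * L2_norm \<Omega> h"
      using L2_Cauchy_Schwarz[OF L2_on_diff[OF S(1,2)] h] by simp
  qed
  show "(\<lambda>n. L2_norm \<Omega> (\<lambda>x. S n x - g x) * L2_norm \<Omega> h) \<longlonglongrightarrow> 0"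
    using tendsto_mult_right[OF l, of "L2_norm \<Omega> h"] by simp
qed

lemma L2_norm_tendsto:
  assumes S: "\<And>n. S n \<in> L2_on \<Omega>" "g \<in> L2_on \<Omega>" and l: "(\<lambda>n. L2_norm \<Omega> (\<lambda>x. S n x - g x)) \<longlonglongrightarrow> 0"
  shows "(\<lambda>n. L2_norm \<Omega> (S n)) \<longlonglongrightarrow> L2_norm \<Omega> g"
proof (rule LIM_zero_cancel, rule Lim_null_comparison[OF _ l], rule always_eventually, rule allI)
  fix n
  have "L2_norm \<Omega> (S n) \<le> L2_norm \<Omega> (\<lambda>x. S n x - g x) + L2_norm \<Omega> g"
    using L2_norm_triangle[OF L2_on_diff[OF S(1,2)] S(2)] by simp
  moreover have "L2_norm \<Omega> g \<le> L2_norm \<Omega> (\<lambda>x. g x - S n x) + L2_norm \<Omega> (S n)"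
    using L2_norm_triangle[OF L2_on_diff[OF S(2) S(1)[of n]] S(1)[of n]] by simp
  ultimately show "norm (L2_norm \<Omega> (S n) - L2_norm \<Omega> g) \<le> L2_norm \<Omega> (\<lambda>x. S n x - g x)"
    using L2_norm_minus_commute[of \<Omega> g "S n"] by (simp add: abs_le_iff)
qed

section \<open>Partial derivatives and integration by parts\<close>

abbreviation pd :: "'a::euclidean_space \<Rightarrow> ('a \<Rightarrow> 'b::real_normed_vector) \<Rightarrow> 'a \<Rightarrow> 'b" where
  "pd \<equiv> partial_within UNIV"

abbreviation lap :: "('a::euclidean_space \<Rightarrow> 'b::real_normed_vector) \<Rightarrow> 'a \<Rightarrow> 'b" where
  "lap \<equiv> laplacian_on UNIV"

lemma pdI: "(f has_derivative f') (at x) \<Longrightarrow> pd b f x = f' b"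
  unfolding partial_within_def by (drule frechet_derivative_at) (rule sym, erule fun_cong)

lemma has_derivative_pd:
  "f differentiable (at x) \<Longrightarrow> (f has_derivative (\<lambda>h. pd h f x)) (at x)"
  unfolding partial_within_def by (erule frechet_derivative_works[THEN iffD1])

lemma partial_within_open:
  "open S \<Longrightarrow> x \<in> S \<Longrightarrow> partial_within S b f x = pd b f x"
  by (simp add: partial_within_def at_within_open[of x S])

lemma pd_cong_open:
  assumes "open S" "x \<in> S" "\<And>y. y \<in> S \<Longrightarrow> f y = g y"
  shows "pd b f x = pd b g x"
proof -
  have "(f has_derivative f') (at x) \<longleftrightarrow> (g has_derivative f') (at x)" for f'
    using has_derivative_transform_within_open[OF _ assms(1,2), of f f' UNIV g]
      has_derivative_transform_within_open[OF _ assms(1,2), of g f' UNIV f] assms(3) by metis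
  then show ?thesis by (simp add: partial_within_def frechet_derivative_def)
qed

lemma pd_add:
  "f differentiable (at x) \<Longrightarrow> g differentiable (at x) \<Longrightarrow> pd b (\<lambda>x. f x + g x) x = pd b f x + pd b g x"
  by (rule pdI[where f'="\<lambda>h. pd h f x + pd h g x"])
    (intro has_derivative_add has_derivative_pd)

lemma pd_bounded_linear:
  assumes "bounded_linear L" "f differentiable (at x)"
  shows "pd b (\<lambda>x. L (f x)) x = L (pd b f x)"
  by (rule pdI[where f'="\<lambda>h. L (pd h f x)"])
    (intro bounded_linear.has_derivative[OF assms(1)] has_derivative_pd assms(2))

lemma (in bounded_bilinear) pd_prod:
  assumes "f differentiable (at x)" "g differentiable (at x)"
  shows "pd b (\<lambda>x. prod (f x) (g x)) x = prod (f x) (pd b g x) + prod (pd b f x) (g x)"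
  by (rule pdI[where f'="\<lambda>h. prod (f x) (pd h g x) + prod (pd h f x) (g x)"])
    (intro FDERIV has_derivative_pd assms)

lemma (in bounded_bilinear) differentiable_prod:
  assumes "f differentiable (at x)" "g differentiable (at x)"
  shows "(\<lambda>x. prod (f x) (g x)) differentiable (at x)"
  using assms unfolding differentiable_def by (blast intro: FDERIV)

lemma differentiable_bounded_linear:
  "bounded_linear L \<Longrightarrow> f differentiable (at x) \<Longrightarrow> (\<lambda>x. L (f x)) differentiable (at x)"
  unfolding differentiable_def by (blast intro: bounded_linear.has_derivative)

lemma Ck_on_cong:
  assumes "\<And>x. x \<in> S \<Longrightarrow> f x = g x"
  shows "Ck_on k S f \<longleftrightarrow> Ck_on k S g"
proof (cases k)
  case 0
  then show ?thesis using assms by (auto cong: continuous_on_cong)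
next
  case (Suc j)
  have "(f has_derivative f' x) (at x within S) \<longleftrightarrow> (g has_derivative f' x) (at x within S)"
    if "x \<in> S" for x and f' :: "'a \<Rightarrow> 'a \<Rightarrow> 'b"
    using that assms has_derivative_transform[of x S g f] has_derivative_transform[of x S f g] by auto
  then show ?thesis using Suc by auto
qed

text \<open>On an open set the derivatives in the definition of \<open>C\<^sup>k\<close> are the ordinary ones, so that
  regularity can be computed from partial derivatives.\<close>

lemma Ck_on_Suc_open:
  assumes "open S"
  shows "Ck_on (Suc k) S f \<longleftrightarrow> (\<forall>x\<in>S. f differentiable (at x)) \<and> (\<forall>b\<in>Basis. Ck_on k S (pd b f))"
proof
  assume "Ck_on (Suc k) S f"
  then obtain f' where f': "\<And>x. x \<in> S \<Longrightarrow> (f has_derivative f' x) (at x)"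
    and k: "\<And>b. b \<in> Basis \<Longrightarrow> Ck_on k S (\<lambda>x. f' x b)"
    using assms by (auto simp: at_within_open[of _ S])
  show "(\<forall>x\<in>S. f differentiable (at x)) \<and> (\<forall>b\<in>Basis. Ck_on k S (pd b f))"
    using k by (auto simp: differentiable_def f' pdI[OF f'] intro!: exI f' cong: Ck_on_cong)
next
  assume "(\<forall>x\<in>S. f differentiable (at x)) \<and> (\<forall>b\<in>Basis. Ck_on k S (pd b f))"
  then show "Ck_on (Suc k) S f"
    using assms by (auto simp: at_within_open[of _ S] intro!: exI[where x="\<lambda>x b. pd b f x"] has_derivative_pd)
qed

lemma Ck_on_SucD: "Ck_on (Suc k) S f \<Longrightarrow> Ck_on k S f"
proof (induction k arbitrary: f)
  case 0
  then show ?case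
    by (auto simp: continuous_on_eq_continuous_within intro: has_derivative_continuous)
next
  case (Suc k)
  show ?case
    using Suc.prems Suc.IH unfolding Ck_on.simps(2)[of "Suc k" S f] Ck_on.simps(2)[of k S f] by blast
qed

lemma Ck_on_le: "Ck_on k S f \<Longrightarrow> j \<le> k \<Longrightarrow> Ck_on j S f"
  by (induction k) (auto simp: le_Suc_eq simp del: Ck_on.simps dest: Ck_on_SucD)

lemma Ck_on_continuous: "Ck_on k S f \<Longrightarrow> continuous_on S f"
  using Ck_on_le[of k S f 0] by simp

lemma Ck_on_subset: "Ck_on k S f \<Longrightarrow> T \<subseteq> S \<Longrightarrow> Ck_on k T f"
proof (induction k arbitrary: f)
  case 0
  then show ?case by (auto intro: continuous_on_subset)
next
  case (Suc k)
  then obtain f' where "\<forall>x\<in>S. (f has_derivative f' x) (at x within S)" "\<forall>b\<in>Basis. Ck_on k S (\<lambda>x. f' x b)"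
    by auto
  with Suc show ?case
    by (auto intro!: exI[of _ f'] intro: has_derivative_subset)
qed

lemma Ck_on_differentiable: "Ck_on (Suc k) S f \<Longrightarrow> open S \<Longrightarrow> x \<in> S \<Longrightarrow> f differentiable (at x)"
  by (simp add: Ck_on_Suc_open del: Ck_on.simps)

lemma Ck_on_pd: "Ck_on (Suc k) S f \<Longrightarrow> open S \<Longrightarrow> b \<in> Basis \<Longrightarrow> Ck_on k S (pd b f)"
  by (simp add: Ck_on_Suc_open del: Ck_on.simps)

lemma Ck_on_Un:
  assumes "open S" "open T"
  shows "Ck_on k S f \<Longrightarrow> Ck_on k T f \<Longrightarrow> Ck_on k (S \<union> T) f"
proof (induction k arbitrary: f)
  case 0
  then show ?case using assms by (auto intro: continuous_on_open_Un)
next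
  case (Suc k)
  then show ?case using assms by (auto simp: Ck_on_Suc_open open_Un simp del: Ck_on.simps(2))
qed

lemma Ck_on_const: "Ck_on k S (\<lambda>x. c)"
proof (induction k arbitrary: c)
  case (Suc k)
  then show ?case by (auto intro!: exI[of _ "\<lambda>x h. 0"])
qed auto

lemma Ck_on_linear: "bounded_linear L \<Longrightarrow> Ck_on k S L"
  by (cases k)
    (auto intro!: exI[of _ "\<lambda>x. L"] Ck_on_const bounded_linear_imp_has_derivative
      simp: linear_continuous_on)

lemma Ck_on_add:
  assumes "open S"
  shows "Ck_on k S f \<Longrightarrow> Ck_on k S g \<Longrightarrow> Ck_on k S (\<lambda>x. f x + g x)"
proof (induction k arbitrary: f g)
  case 0
  then show ?case by (auto intro: continuous_intros)
next
  case (Suc k)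
  then have "Ck_on k S (pd b (\<lambda>x. f x + g x))" if "b \<in> Basis" for b
    using that assms
    by (subst Ck_on_cong[where g="\<lambda>x. pd b f x + pd b g x"])
      (auto simp: Ck_on_Suc_open pd_add simp del: Ck_on.simps(2))
  with Suc.prems assms show ?case by (auto simp: Ck_on_Suc_open simp del: Ck_on.simps(2))
qed

lemma Ck_on_bounded_linear:
  assumes "open S" "bounded_linear L"
  shows "Ck_on k S f \<Longrightarrow> Ck_on k S (\<lambda>x. L (f x))"
proof (induction k arbitrary: f)
  case 0
  then show ?case using assms by (auto intro: bounded_linear.continuous_on)
next
  case (Suc k)
  then have "Ck_on k S (pd b (\<lambda>x. L (f x)))" if "b \<in> Basis" for b
    using that assms
    by (subst Ck_on_cong[where g="\<lambda>x. L (pd b f x)"])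
      (auto simp: Ck_on_Suc_open pd_bounded_linear simp del: Ck_on.simps(2))
  with Suc.prems assms show ?case
    by (auto simp: Ck_on_Suc_open differentiable_bounded_linear simp del: Ck_on.simps(2))
qed

lemma (in bounded_bilinear) Ck_on_prod:
  assumes "open S"
  shows "Ck_on k S f \<Longrightarrow> Ck_on k S g \<Longrightarrow> Ck_on k S (\<lambda>x. prod (f x) (g x))"
proof (induction k arbitrary: f g)
  case 0
  then show ?case by (auto intro: continuous_on)
next
  case (Suc k)
  then have "Ck_on k S f" "Ck_on k S g" by (auto dest: Ck_on_SucD simp del: Ck_on.simps)
  with Suc have "Ck_on k S (pd b (\<lambda>x. prod (f x) (g x)))" if "b \<in> Basis" for b
    using that assms
    by (subst Ck_on_cong[where g="\<lambda>x. prod (f x) (pd b g x) + prod (pd b f x) (g x)"])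
      (auto simp: Ck_on_Suc_open pd_prod intro!: Ck_on_add simp del: Ck_on.simps(2))
  with Suc.prems assms show ?case
    by (auto simp: Ck_on_Suc_open differentiable_prod simp del: Ck_on.simps(2))
qed

lemmas Ck_on_mult = bounded_bilinear.Ck_on_prod[OF bounded_bilinear_mult]
  and Ck_on_scaleR = bounded_bilinear.Ck_on_prod[OF bounded_bilinear_scaleR]
  and pd_mult = bounded_bilinear.pd_prod[OF bounded_bilinear_mult]
  and pd_scaleR = bounded_bilinear.pd_prod[OF bounded_bilinear_scaleR]

text \<open>The open sets \<open>\<Omega>\<close> and \<open>- K\<close> cover the space, and on the second one the function is constant.\<close>

lemma Ck_on_extend_zero:
  assumes "open \<Omega>" "closed K" "K \<subseteq> \<Omega>" "Ck_on k \<Omega> g" "\<And>x. x \<notin> K \<Longrightarrow> g x = 0"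
  shows "Ck_on k UNIV g"
proof -
  have "Ck_on k (- K) g"
    using assms(5) by (subst Ck_on_cong[where g="\<lambda>x. 0"]) (auto simp: Ck_on_const)
  with assms have "Ck_on k (\<Omega> \<union> - K) g" by (intro Ck_on_Un) auto
  moreover have "\<Omega> \<union> - K = UNIV" using assms(3) by auto
  ultimately show ?thesis by simp
qed

lemma pd_zero_outside:
  assumes "closed K" "\<And>x. x \<notin> K \<Longrightarrow> g x = 0" "x \<notin> K"
  shows "pd b g x = 0"
proof -
  have "pd b g x = pd b (\<lambda>x. 0) x"
    by (rule pd_cong_open[of "- K"]) (use assms in auto)
  then show ?thesis by (simp add: pdI[OF has_derivative_const])
qed

lemma integrable_on_compact_support:
  fixes G :: "'a::euclidean_space \<Rightarrow> 'b::{banach,second_countable_topology}"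
  assumes "open \<Omega>" "compact K" "K \<subseteq> \<Omega>" "continuous_on \<Omega> G" "\<And>x. x \<in> \<Omega> \<Longrightarrow> x \<notin> K \<Longrightarrow> G x = 0"
  shows "integrable (lebesgue_on \<Omega>) G"
proof -
  have "integrable lborel (\<lambda>x. indicator K x *\<^sub>R G x)"
    using assms by (intro borel_integrable_compact) (auto intro: continuous_on_subset)
  then have "integrable lebesgue (\<lambda>x. indicator K x *\<^sub>R G x)"
    by (simp add: integrable_completion)
  moreover have "(\<lambda>x. indicator K x *\<^sub>R G x) = (\<lambda>x. indicator \<Omega> x *\<^sub>R G x)"
    using assms(3,5) by (intro ext) (force simp: indicator_def)
  ultimately show ?thesis using assms(1) by (simp add: integrable_restrict_space)
qed

lemma has_vector_derivative_sequentially: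
  fixes g :: "real \<Rightarrow> 'b::real_normed_vector"
  assumes g: "(g has_vector_derivative v) (at a)" and h: "h \<longlonglongrightarrow> 0" "\<And>n. h n \<noteq> 0"
  shows "(\<lambda>n. (g (a + h n) - g a) /\<^sub>R h n) \<longlonglongrightarrow> v"
proof -
  have "((\<lambda>t. norm (g (a + t) - g a - t *\<^sub>R v) / norm t) \<longlongrightarrow> 0) (at 0)"
    using g by (simp add: has_vector_derivative_def has_derivative_at)
  moreover have "filterlim h (at 0) sequentially"
    unfolding filterlim_at using h by simp
  ultimately have lim: "(\<lambda>n. norm (g (a + h n) - g a - h n *\<^sub>R v) / norm (h n)) \<longlonglongrightarrow> 0"
    by (rule filterlim_compose)
  have "norm (g (a + h n) - g a - h n *\<^sub>R v) / norm (h n) = norm ((g (a + h n) - g a) /\<^sub>R h n - v)" for n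
  proof -
    have "(g (a + h n) - g a) /\<^sub>R h n - v = (g (a + h n) - g a - h n *\<^sub>R v) /\<^sub>R h n"
      using h(2) by (simp add: scaleR_right_diff_distrib)
    then show ?thesis by (simp add: divide_inverse mult.commute)
  qed
  note eq = this
  have "(\<lambda>n. norm ((g (a + h n) - g a) /\<^sub>R h n - v)) \<longlonglongrightarrow> 0" using lim
    by (rule Lim_transform_eventually) (rule always_eventually, rule allI, rule eq)
  then show ?thesis by (rule LIM_zero_cancel[OF tendsto_norm_zero_cancel])
qed

text \<open>The integral of a difference quotient vanishes by translation invariance, and dominated
  convergence passes to the derivative.\<close>

lemma integral_pd_eq_0:
  fixes g :: "'a::euclidean_space \<Rightarrow> 'b::{banach,second_countable_topology}"
  assumes C1: "Ck_on 1 UNIV g" and K: "compact K" and z: "\<And>x. x \<notin> K \<Longrightarrow> g x = 0" and b: "b \<in> Basis"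
  shows "(LINT x|lebesgue. pd b g x) = 0"
proof -
  have diff: "g differentiable (at x)" for x
    using C1 Ck_on_differentiable[of 0 UNIV g] by simp
  have cp: "continuous_on UNIV (pd b g)"
    using C1 b Ck_on_pd[of 0 UNIV g] by simp
  have cg: "continuous_on UNIV g" using C1 by (rule Ck_on_continuous)
  have pz: "pd b g x = 0" if "x \<notin> K" for x
    using pd_zero_outside[OF compact_imp_closed[OF K] z that] .
  obtain B0 where "\<forall>y\<in>pd b g ` K. norm y \<le> B0"
    using compact_imp_bounded[OF compact_continuous_image[OF continuous_on_subset[OF cp] K]]
    by (auto simp: bounded_iff)
  then have B: "norm (pd b g x) \<le> max B0 0" for x by (cases "x \<in> K") (auto simp: pz)
  define B where "B = max B0 0"
  obtain R where R: "\<forall>x\<in>K. norm x \<le> R" using K compact_imp_bounded bounded_iff by metis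
  define q where "q n x = (g (x + (1 / real (Suc n)) *\<^sub>R b) - g x) /\<^sub>R (1 / real (Suc n))" for n x
  have path: "((\<lambda>s. g (x + s *\<^sub>R b)) has_vector_derivative pd b g (x + s *\<^sub>R b)) (at s within T)" for x s T
  proof -
    have l: "((\<lambda>s. x + s *\<^sub>R b) has_derivative (\<lambda>h. h *\<^sub>R b)) (at s within T)"
      by (auto intro!: derivative_eq_intros)
    have d: "(g has_derivative (\<lambda>h. pd h g (x + s *\<^sub>R b))) (at (x + s *\<^sub>R b))"
      by (rule has_derivative_pd[OF diff])
    have "pd (h *\<^sub>R b) g (x + s *\<^sub>R b) = h *\<^sub>R pd b g (x + s *\<^sub>R b)" for h
      using linear_scale[OF has_derivative_linear[OF d]] .
    then show ?thesis
      using has_derivative_compose[OF l d] by (simp add: has_vector_derivative_def)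
  qed
  have ig: "integrable lborel (\<lambda>x. g x)"
  proof -
    have "(\<lambda>x. indicator K x *\<^sub>R g x) = g" using z by (auto simp: indicator_def)
    then show ?thesis using borel_integrable_compact[OF K continuous_on_subset[OF cg]] by simp
  qed
  have igt: "integrable lborel (\<lambda>x. g (x + a))" and igt': "(LINT x|lborel. g (x + a)) = (LINT x|lborel. g x)" for a
  proof -
    have m: "g \<in> borel_measurable borel" using cg by (rule borel_measurable_continuous_onI)
    have "integrable (distr lborel borel ((+) a)) g" using ig by (simp only: lborel_distr_plus)
    then show "integrable lborel (\<lambda>x. g (x + a))"
      by (subst (asm) integrable_distr_eq) (use m in \<open>auto simp: add.commute\<close>)
    have "(LINT x|distr lborel borel ((+) a). g x) = (LINT x|lborel. g x)" by (simp only: lborel_distr_plus)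
    then show "(LINT x|lborel. g (x + a)) = (LINT x|lborel. g x)"
      by (subst (asm) integral_distr) (use m in \<open>auto simp: add.commute\<close>)
  qed
  have q0: "(LINT x|lborel. q n x) = 0" for n
    unfolding q_def using ig igt igt' by simp
  have qlim: "(\<lambda>n. q n x) \<longlonglongrightarrow> pd b g x" for x
  proof -
    have "((\<lambda>s. g (x + s *\<^sub>R b)) has_vector_derivative pd b g x) (at 0)" using path[of x 0 UNIV] by simp
    from has_vector_derivative_sequentially[OF this, of "\<lambda>n. 1 / real (Suc n)"]
    show ?thesis
      using LIMSEQ_inverse_real_of_nat by (simp add: q_def inverse_eq_divide del: of_nat_Suc)
  qed
  have qb: "norm (q n x) \<le> indicator (cball 0 (R + 1)) x *\<^sub>R B" for n x
  proof (cases "x \<in> cball 0 (R + 1)")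
    case True
    define t where "t = 1 / real (Suc n)"
    have t: "t > 0" by (simp add: t_def)
    have "norm (g (x + t *\<^sub>R b) - g (x + 0 *\<^sub>R b)) \<le> B * norm (t - 0)"
    proof (rule differentiable_bound[of "{0..t}" "\<lambda>s. g (x + s *\<^sub>R b)" "\<lambda>s h. h *\<^sub>R pd b g (x + s *\<^sub>R b)"])
      show "((\<lambda>s. g (x + s *\<^sub>R b)) has_derivative (\<lambda>h. h *\<^sub>R pd b g (x + s *\<^sub>R b))) (at s within {0..t})" for s
        using path unfolding has_vector_derivative_def .
      show "onorm (\<lambda>h. h *\<^sub>R pd b g (x + s *\<^sub>R b)) \<le> B" for s
        using B by (intro onorm_bound) (auto simp: B_def mult.commute intro: mult_left_mono)
    qed (use t in auto)
    then have "norm (q n x) \<le> B"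
      using t unfolding q_def t_def[symmetric] by (simp add: pos_divide_le_eq mult.commute[of B] flip: divide_inverse_commute)
    then show ?thesis using True by simp
  next
    case False
    then have "norm x > R + 1" by simp
    moreover have "norm ((1 / real (Suc n)) *\<^sub>R b) \<le> 1" using b by (simp add: divide_le_eq)
    moreover have "norm x \<le> norm (x + (1 / real (Suc n)) *\<^sub>R b) + norm ((1 / real (Suc n)) *\<^sub>R b)"
      using norm_triangle_ineq4[of "x + (1 / real (Suc n)) *\<^sub>R b" "(1 / real (Suc n)) *\<^sub>R b"]
      by (simp del: of_nat_Suc norm_scaleR)
    ultimately have "norm (x + (1 / real (Suc n)) *\<^sub>R b) > R" by linarith
    then have "x + (1 / real (Suc n)) *\<^sub>R b \<notin> K" "x \<notin> K"
      using R \<open>norm x > R + 1\<close> by force+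
    then have "g (x + (1 / real (Suc n)) *\<^sub>R b) = 0" "g x = 0" by (auto intro: z)
    then show ?thesis using False by (simp add: q_def)
  qed
  have "(\<lambda>n. LINT x|lborel. q n x) \<longlonglongrightarrow> (LINT x|lborel. pd b g x)"
  proof (rule integral_dominated_convergence[where w="\<lambda>x. indicator (cball 0 (R + 1)) x *\<^sub>R B"])
    show "pd b g \<in> borel_measurable lborel" using cp by (simp add: borel_measurable_continuous_onI)
    show "q n \<in> borel_measurable lborel" for n
      unfolding q_def using borel_measurable_integrable[OF ig] borel_measurable_integrable[OF igt] by auto
    show "integrable lborel (\<lambda>x. indicator (cball 0 (R + 1)) x *\<^sub>R B :: real)"
      by (rule borel_integrable_compact) auto
  qed (use qlim qb in auto)
  then have "(LINT x|lborel. pd b g x) = 0" using q0 by (simp add: LIMSEQ_const_iff)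
  then show ?thesis
    using cp by (subst integral_completion) (auto simp: borel_measurable_continuous_onI)
qed

lemma integration_by_parts:
  fixes \<zeta> :: "'a::euclidean_space \<Rightarrow> real" and F :: "'a \<Rightarrow> 'b::{banach,second_countable_topology}"
  assumes o: "open \<Omega>" and K: "compact K" "K \<subseteq> \<Omega>" and z: "\<And>x. x \<notin> K \<Longrightarrow> \<zeta> x = 0"
    and C: "Ck_on 1 \<Omega> \<zeta>" "Ck_on 1 \<Omega> F" and b: "b \<in> Basis"
  shows "integrable (lebesgue_on \<Omega>) (\<lambda>x. pd b \<zeta> x *\<^sub>R F x)"
    and "integrable (lebesgue_on \<Omega>) (\<lambda>x. \<zeta> x *\<^sub>R pd b F x)"
    and "(LINT x|lebesgue_on \<Omega>. pd b \<zeta> x *\<^sub>R F x) = - (LINT x|lebesgue_on \<Omega>. \<zeta> x *\<^sub>R pd b F x)"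
proof -
  have pz: "pd b \<zeta> x = 0" if "x \<notin> K" for x
    using pd_zero_outside[OF compact_imp_closed[OF K(1)] z that] .
  have cont: "continuous_on \<Omega> \<zeta>" "continuous_on \<Omega> F" "continuous_on \<Omega> (pd b \<zeta>)" "continuous_on \<Omega> (pd b F)"
    using C C[THEN Ck_on_continuous] Ck_on_pd[of 0 \<Omega> _ b] o b by auto
  show i1: "integrable (lebesgue_on \<Omega>) (\<lambda>x. pd b \<zeta> x *\<^sub>R F x)"
    by (rule integrable_on_compact_support[OF o K]) (auto intro!: continuous_intros cont simp: pz)
  show i2: "integrable (lebesgue_on \<Omega>) (\<lambda>x. \<zeta> x *\<^sub>R pd b F x)"
    by (rule integrable_on_compact_support[OF o K]) (auto intro!: continuous_intros cont simp: z)
  have "Ck_on 1 \<Omega> (\<lambda>x. \<zeta> x *\<^sub>R F x)" by (intro Ck_on_scaleR o C)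
  then have "Ck_on 1 UNIV (\<lambda>x. \<zeta> x *\<^sub>R F x)"
    by (intro Ck_on_extend_zero[OF o compact_imp_closed[OF K(1)] K(2)]) (auto simp: z)
  then have "(LINT x|lebesgue. pd b (\<lambda>x. \<zeta> x *\<^sub>R F x) x) = 0"
    using K(1) by (rule integral_pd_eq_0) (auto simp: z b)
  moreover have "pd b (\<lambda>x. \<zeta> x *\<^sub>R F x) x = indicator \<Omega> x *\<^sub>R (pd b \<zeta> x *\<^sub>R F x + \<zeta> x *\<^sub>R pd b F x)" for x
  proof (cases "x \<in> \<Omega>")
    case True
    then show ?thesis
      using C o Ck_on_differentiable[of 0 \<Omega> \<zeta>] Ck_on_differentiable[of 0 \<Omega> F] by (simp add: pd_scaleR add.commute del: Ck_on.simps)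
  next
    case False
    then show ?thesis
      using K(2) pd_zero_outside[OF compact_imp_closed[OF K(1)], of "\<lambda>x. \<zeta> x *\<^sub>R F x" x b] by (auto simp: z)
  qed
  ultimately have "(LINT x|lebesgue_on \<Omega>. pd b \<zeta> x *\<^sub>R F x + \<zeta> x *\<^sub>R pd b F x) = 0"
    using o by (subst integral_restrict_space) auto
  then show "(LINT x|lebesgue_on \<Omega>. pd b \<zeta> x *\<^sub>R F x) = - (LINT x|lebesgue_on \<Omega>. \<zeta> x *\<^sub>R pd b F x)"
    using i1 i2 by (simp add: add_eq_0_iff)
qed

declare Ck_on.simps(2) [simp del]

lemma laplacian_on_open:
  assumes "open S" "x \<in> S"
  shows "laplacian_on S f x = lap f x"
  unfolding laplacian_on_def
proof (rule sum.cong)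
  fix b :: 'a
  show "partial_within S b (partial_within S b f) x = pd b (pd b f) x"
    unfolding partial_within_open[OF assms, of b "partial_within S b f"]
    by (rule pd_cong_open[OF assms]) (rule partial_within_open[OF assms(1)])
qed simp

text \<open>Both integrations by parts move a derivative onto the compactly supported factor, so \<open>G\<close> needs
  no regularity at the boundary.\<close>

lemma Green_cutoff:
  fixes \<zeta> :: "'a::euclidean_space \<Rightarrow> real" and G :: "'a \<Rightarrow> 'b::{banach,second_countable_topology}"
  assumes o: "open \<Omega>" and K: "compact K" "K \<subseteq> \<Omega>" and z: "\<And>x. x \<notin> K \<Longrightarrow> \<zeta> x = 0"
    and C: "Ck_on 2 \<Omega> \<zeta>" "Ck_on 2 \<Omega> G"
  shows "(LINT x|lebesgue_on \<Omega>. \<zeta> x *\<^sub>R lap G x) = (LINT x|lebesgue_on \<Omega>. lap \<zeta> x *\<^sub>R G x)"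
proof -
  have two: "Suc 1 = 2" by simp
  have C1: "Ck_on 1 \<Omega> \<zeta>" "Ck_on 1 \<Omega> G" using C by (auto elim: Ck_on_le simp del: Ck_on.simps One_nat_def)
  have C2: "Ck_on 1 \<Omega> (pd b \<zeta>)" "Ck_on 1 \<Omega> (pd b G)" if "b \<in> Basis" for b
    using C that o Ck_on_pd[of 1 \<Omega> _ b] unfolding two by auto
  have z1: "pd b \<zeta> x = 0" if "x \<notin> K" for x b
    using pd_zero_outside[OF compact_imp_closed[OF K(1)] z that] .
  have i: "integrable (lebesgue_on \<Omega>) (\<lambda>x. \<zeta> x *\<^sub>R pd b (pd b G) x)"
     "integrable (lebesgue_on \<Omega>) (\<lambda>x. pd b (pd b \<zeta>) x *\<^sub>R G x)"
     "(LINT x|lebesgue_on \<Omega>. \<zeta> x *\<^sub>R pd b (pd b G) x) = (LINT x|lebesgue_on \<Omega>. pd b (pd b \<zeta>) x *\<^sub>R G x)"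
    if b: "b \<in> Basis" for b
    using integration_by_parts[OF o K z C1(1) C2(2) b] integration_by_parts[OF o K z1 C2(1) C1(2) b] b
    by auto
  show ?thesis
    unfolding laplacian_on_def scaleR_sum_right scaleR_sum_left
    using i by (simp add: Bochner_Integration.integral_sum cong: sum.cong)
qed

section \<open>Radial cut-offs of the unit disk\<close>

lemma Ck_2_iff: "Ck_on 2 S f = Ck_on (Suc 1) S f" by (simp add: numeral_2_eq_2)

lemma Ck_on_2D:
  assumes "open S" "Ck_on 2 S f"
  shows "Ck_on 1 S f" "\<And>x. x \<in> S \<Longrightarrow> f differentiable (at x)"
    "\<And>b. b \<in> Basis \<Longrightarrow> Ck_on 1 S (pd b f)"
    "\<And>b x. b \<in> Basis \<Longrightarrow> x \<in> S \<Longrightarrow> pd b f differentiable (at x)"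
    "\<And>b. b \<in> Basis \<Longrightarrow> continuous_on S (pd b f)"
    "\<And>b. b \<in> Basis \<Longrightarrow> continuous_on S (pd b (pd b f))"
    "continuous_on S (lap f)"
proof -
  show 1: "Ck_on 1 S f" using assms by (auto elim: Ck_on_le)
  show 2: "\<And>x. x \<in> S \<Longrightarrow> f differentiable (at x)" using assms Ck_on_differentiable unfolding Ck_2_iff by blast
  show 3: "\<And>b. b \<in> Basis \<Longrightarrow> Ck_on 1 S (pd b f)" using assms Ck_on_pd unfolding Ck_2_iff by blast
  show 4: "\<And>b x. b \<in> Basis \<Longrightarrow> x \<in> S \<Longrightarrow> pd b f differentiable (at x)"
    using 3 assms(1) Ck_on_differentiable[of 0 S] by auto
  show 5: "\<And>b. b \<in> Basis \<Longrightarrow> continuous_on S (pd b f)" using 3 Ck_on_continuous by blast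
  show 6: "\<And>b. b \<in> Basis \<Longrightarrow> continuous_on S (pd b (pd b f))"
    using 3 assms(1) Ck_on_pd[of 0 S] by auto
  show "continuous_on S (lap f)" unfolding laplacian_on_def using 6 by (intro continuous_on_sum)
qed

lemma lap_add:
  assumes S: "open S" "x \<in> S" "Ck_on 2 S f" "Ck_on 2 S g"
  shows "lap (\<lambda>x. f x + g x) x = lap f x + lap g x"
  unfolding laplacian_on_def sum.distrib[symmetric]
proof (rule sum.cong)
  fix b :: 'a assume b: "b \<in> Basis"
  have "pd b (pd b (\<lambda>x. f x + g x)) x = pd b (\<lambda>x. pd b f x + pd b g x) x"
    using S by (intro pd_cong_open[OF S(1,2)] pd_add Ck_on_2D(2))
  also have "\<dots> = pd b (pd b f) x + pd b (pd b g) x"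
    using S b by (intro pd_add Ck_on_2D(4))
  finally show "pd b (pd b (\<lambda>x. f x + g x)) x = pd b (pd b f) x + pd b (pd b g) x" .
qed simp

lemma lap_bounded_linear:
  assumes S: "open S" "x \<in> S" "Ck_on 2 S f" and L: "bounded_linear L"
  shows "lap (\<lambda>x. L (f x)) x = L (lap f x)"
  unfolding laplacian_on_def linear_sum[OF bounded_linear.linear[OF L]]
proof (rule sum.cong)
  fix b :: 'a assume b: "b \<in> Basis"
  have "pd b (pd b (\<lambda>x. L (f x))) x = pd b (\<lambda>x. L (pd b f x)) x"
    using S L by (intro pd_cong_open[OF S(1,2)] pd_bounded_linear Ck_on_2D(2))
  also have "\<dots> = L (pd b (pd b f) x)"
    using S b L by (intro pd_bounded_linear Ck_on_2D(4))
  finally show "pd b (pd b (\<lambda>x. L (f x))) x = L (pd b (pd b f) x)" .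
qed simp

lemma (in bounded_bilinear) lap_prod:
  fixes f :: "'z::euclidean_space \<Rightarrow> 'a" and g :: "'z \<Rightarrow> 'b"
  assumes S: "open S" "x \<in> S" "Ck_on 2 S f" "Ck_on 2 S g"
  shows "lap (\<lambda>x. prod (f x) (g x)) x =
    prod (f x) (lap g x) + prod (lap f x) (g x) + 2 *\<^sub>R (\<Sum>b\<in>Basis. prod (pd b f x) (pd b g x))"
proof -
  have "pd b (pd b (\<lambda>x. prod (f x) (g x))) x =
      prod (f x) (pd b (pd b g) x) + prod (pd b (pd b f) x) (g x) + 2 *\<^sub>R prod (pd b f x) (pd b g x)"
    if b: "b \<in> Basis" for b
  proof -
    have "pd b (pd b (\<lambda>x. prod (f x) (g x))) x = pd b (\<lambda>x. prod (f x) (pd b g x) + prod (pd b f x) (g x)) x"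
      using S by (intro pd_cong_open[OF S(1,2)] pd_prod Ck_on_2D(2))
    also have "\<dots> = pd b (\<lambda>x. prod (f x) (pd b g x)) x + pd b (\<lambda>x. prod (pd b f x) (g x)) x"
      using S b by (intro pd_add differentiable_prod) (rule Ck_on_2D(4) Ck_on_2D(2), assumption+)+
    also have "\<dots> = prod (f x) (pd b (pd b g) x) + prod (pd b f x) (pd b g x)
        + (prod (pd b f x) (pd b g x) + prod (pd b (pd b f) x) (g x))"
      using S b by (intro arg_cong2[where f="(+)"] pd_prod) (rule Ck_on_2D(4) Ck_on_2D(2), assumption+)+
    finally show ?thesis by (simp add: scaleR_2)
  qed
  then show ?thesis
    unfolding laplacian_on_def sum_right sum_left scaleR_sum_right
    by (simp add: sum.distrib cong: sum.cong)
qed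

lemmas lap_mult = bounded_bilinear.lap_prod[OF bounded_bilinear_mult]

lemma lap_norm_sq: "lap (\<lambda>x::'a::euclidean_space. x \<bullet> x) x = 2 * real DIM('a)"
proof -
  have "pd b (\<lambda>x. x \<bullet> x) = (\<lambda>x. 2 * (x \<bullet> b))" for b :: 'a
  proof
    fix x :: 'a
    have "((\<lambda>x. x \<bullet> x) has_derivative (\<lambda>h. x \<bullet> h + h \<bullet> x)) (at x)"
      by (intro derivative_intros)
    from pdI[OF this] show "pd b (\<lambda>x. x \<bullet> x) x = 2 * (x \<bullet> b)" by (simp add: inner_commute)
  qed
  moreover have "pd b (\<lambda>x. 2 * (x \<bullet> b)) x = 2 * (b \<bullet> b)" for b :: 'a
    by (rule pdI[where f'="\<lambda>h. 2 * (h \<bullet> b)"]) (auto intro!: derivative_eq_intros)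
  ultimately show ?thesis by (simp add: laplacian_on_def)
qed

lemma Ck_on_norm_sq: "Ck_on k UNIV (\<lambda>x::'a::euclidean_space. x \<bullet> x)"
  by (intro bounded_bilinear.Ck_on_prod[OF bounded_bilinear_inner] Ck_on_linear) auto

text \<open>Powers of the positive part are the building blocks of a piecewise polynomial step; from the
  square on they are differentiable across the origin.\<close>

lemma pos_part_power_DERIV:
  "((\<lambda>y. max 0 y ^ Suc (Suc n)) has_real_derivative real (Suc (Suc n)) * max 0 y ^ Suc n) (at y)"
proof -
  consider "y < 0" | "y = 0" | "y > 0" by linarith
  then show ?thesis
  proof cases
    case 1
    have "((\<lambda>y. 0) has_real_derivative 0) (at y)" by simp
    then show ?thesis
      using 1 by (rule_tac has_field_derivative_transform_within_open[where f="\<lambda>y. 0" and S="{..<0}"]) auto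
  next
    case 2
    have "((\<lambda>h. \<bar>h\<bar> ^ Suc n) \<longlongrightarrow> 0) (at (0::real))"
      by (rule tendsto_eq_intros | simp)+
    then have "((\<lambda>h. max 0 h ^ Suc (Suc n) / h) \<longlongrightarrow> 0) (at (0::real))"
    proof (rule Lim_null_comparison[rotated], intro always_eventually allI)
      fix h :: real
      show "norm (max 0 h ^ Suc (Suc n) / h) \<le> \<bar>h\<bar> ^ Suc n"
      proof (cases "h > 0")
        case False
        then have "norm (max 0 h ^ Suc (Suc n) / h) = 0" by (simp add: max_absorb1)
        also have "\<dots> \<le> \<bar>h\<bar> ^ Suc n" by (rule zero_le_power) simp
        finally show ?thesis .
      qed (simp add: max_absorb2)
    qed
    then show ?thesis using 2 by (simp add: DERIV_def)
  next
    case 3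
    have "((\<lambda>y. y ^ Suc (Suc n)) has_real_derivative real (Suc (Suc n)) * y ^ Suc n) (at y)"
      by (rule derivative_eq_intros | simp)+
    then show ?thesis
      using 3 by (rule_tac has_field_derivative_transform_within_open[where f="\<lambda>y. y ^ Suc (Suc n)" and S="{0<..}"])
        (auto simp: max_def)
  qed
qed

text \<open>The integral of the quadratic B-spline: a twice continuously differentiable step from 0 to 1
  on \<open>[0,3]\<close>.\<close>

definition spline_step :: "real \<Rightarrow> real" where
  "spline_step y = (max 0 y ^ 3 - 3 * max 0 (y - 1) ^ 3 + 3 * max 0 (y - 2) ^ 3 - max 0 (y - 3) ^ 3) / 6"

definition spline_step' :: "real \<Rightarrow> real" where
  "spline_step' y = (max 0 y ^ 2 - 3 * max 0 (y - 1) ^ 2 + 3 * max 0 (y - 2) ^ 2 - max 0 (y - 3) ^ 2) / 2"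

definition spline_step'' :: "real \<Rightarrow> real" where
  "spline_step'' y = max 0 y - 3 * max 0 (y - 1) + 3 * max 0 (y - 2) - max 0 (y - 3)"

lemma spline_step_DERIV:
  "(spline_step has_real_derivative spline_step' y) (at y)"
  "(spline_step' has_real_derivative spline_step'' y) (at y)"
proof -
  have sh3: "((\<lambda>y. max 0 (y - a) ^ 3) has_real_derivative 3 * max 0 (y - a) ^ 2) (at y)"
    and sh2: "((\<lambda>y. max 0 (y - a) ^ 2) has_real_derivative 2 * max 0 (y - a)) (at y)" for a
  proof -
    have id: "((\<lambda>y. y - a) has_real_derivative 1) (at y)" by (auto intro!: derivative_eq_intros)
    have "((\<lambda>z. max 0 z ^ 3) has_real_derivative 3 * max 0 (y - a) ^ 2) (at (y - a))"
      using pos_part_power_DERIV[of 1 "y - a"] by (simp add: numeral_3_eq_3 numeral_2_eq_2)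
    from DERIV_chain2[where f="\<lambda>z. max 0 z ^ 3" and g="\<lambda>y. y - a", OF this id]
    show "((\<lambda>y. max 0 (y - a) ^ 3) has_real_derivative 3 * max 0 (y - a) ^ 2) (at y)" by simp
    have "((\<lambda>z. max 0 z ^ 2) has_real_derivative 2 * max 0 (y - a)) (at (y - a))"
      using pos_part_power_DERIV[of 0 "y - a"] by (simp add: numeral_2_eq_2)
    from DERIV_chain2[where f="\<lambda>z. max 0 z ^ 2" and g="\<lambda>y. y - a", OF this id]
    show "((\<lambda>y. max 0 (y - a) ^ 2) has_real_derivative 2 * max 0 (y - a)) (at y)" by simp
  qed
  show "(spline_step has_real_derivative spline_step' y) (at y)"
    unfolding spline_step_def[abs_def]
    by (rule DERIV_cong, rule DERIV_cdivide, (rule sh3[of 0, unfolded diff_0_right] sh3 DERIV_diff DERIV_add DERIV_cmult)+)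
      (simp add: spline_step'_def field_simps)
  show "(spline_step' has_real_derivative spline_step'' y) (at y)"
    unfolding spline_step'_def[abs_def]
    by (rule DERIV_cong, rule DERIV_cdivide, (rule sh2[of 0, unfolded diff_0_right] sh2 DERIV_diff DERIV_add DERIV_cmult)+)
      (simp add: spline_step''_def field_simps)
qed

lemma spline_step_le0: "y \<le> 0 \<Longrightarrow> spline_step y = 0 \<and> spline_step' y = 0 \<and> spline_step'' y = 0"
  by (simp add: spline_step_def spline_step'_def spline_step''_def max_def)

lemma spline_step_ge3: "y \<ge> 3 \<Longrightarrow> spline_step y = 1 \<and> spline_step' y = 0 \<and> spline_step'' y = 0"
  by (simp add: spline_step_def spline_step'_def spline_step''_def max_def)
    (simp add: power2_eq_square power3_eq_cube algebra_simps)

lemma spline_step_range: "0 \<le> spline_step y" "spline_step y \<le> 1"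
proof -
  consider "y \<le> 0" | "0 \<le> y" "y \<le> 1" | "1 \<le> y" "y \<le> 2" | "2 \<le> y" "y \<le> 3" | "3 \<le> y" by linarith
  then have "0 \<le> spline_step y \<and> spline_step y \<le> 1"
  proof cases
    case 2
    then have "y ^ 3 \<le> 1" "y ^ 3 \<ge> 0" by (auto intro: power_le_one)
    with 2 show ?thesis by (simp add: spline_step_def max_def)
  next
    case 3
    define s where "s = y - 1"
    have s: "0 \<le> s" "s \<le> 1" using 3 by (auto simp: s_def)
    have "s\<^sup>2 \<le> s" "s ^ 3 \<le> s\<^sup>2" "s ^ 3 \<ge> 0" "s\<^sup>2 \<ge> 0"
      using s by (auto simp: power2_eq_square power3_eq_cube mult_left_le mult_le_one)
    moreover have "spline_step y = (1 + 3 * s + 3 * s\<^sup>2 - 2 * s ^ 3) / 6"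
    proof -
      have y: "y = s + 1" by (simp add: s_def)
      show ?thesis using 3 unfolding spline_step_def
        by (simp add: max_def) (simp add: y power2_eq_square power3_eq_cube algebra_simps)
    qed
    moreover have "s ^ 3 - 3 * s + 2 \<ge> 0"
    proof -
      have "0 \<le> (s - 1)\<^sup>2 * (s + 2)" using s by simp
      then show ?thesis by (simp add: power2_eq_square power3_eq_cube algebra_simps)
    qed
    ultimately show ?thesis using s by (intro conjI) argo+
  next
    case 4
    define s where "s = 3 - y"
    have s: "0 \<le> s" "s \<le> 1" using 4 by (auto simp: s_def)
    have "s ^ 3 \<le> 1" "s ^ 3 \<ge> 0" using s by (auto intro: power_le_one)
    moreover have "spline_step y = 1 - s ^ 3 / 6"
    proof -
      have y: "y = 3 - s" by (simp add: s_def)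
      show ?thesis using 4 unfolding spline_step_def
        by (simp add: max_def) (simp add: y power2_eq_square power3_eq_cube algebra_simps)
    qed
    ultimately show ?thesis by (intro conjI) argo+
  qed (auto simp: spline_step_le0 spline_step_ge3)
  then show "0 \<le> spline_step y" "spline_step y \<le> 1" by auto
qed

lemma spline_step_deriv_bounds: "\<bar>spline_step' y\<bar> \<le> 12" "\<bar>spline_step'' y\<bar> \<le> 12"
proof -
  have "\<bar>spline_step' y\<bar> \<le> 12 \<and> \<bar>spline_step'' y\<bar> \<le> 12"
  proof (cases "0 < y \<and> y < 3")
    case True
    have "(max 0 (y - a))\<^sup>2 \<le> (3 - a)\<^sup>2" if "a \<le> 3" for a
      using True that by (intro power_mono) auto
    from this[of 0] this[of 1] this[of 2] this[of 3]
    have "(max 0 y)\<^sup>2 \<le> 9" "(max 0 (y - 1))\<^sup>2 \<le> 4" "(max 0 (y - 2))\<^sup>2 \<le> 1" "(max 0 (y - 3))\<^sup>2 \<le> 0"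
      by (auto simp: power2_eq_square)
    moreover have "(max 0 y)\<^sup>2 \<ge> 0" "(max 0 (y - 1))\<^sup>2 \<ge> 0" "(max 0 (y - 2))\<^sup>2 \<ge> 0" "(max 0 (y - 3))\<^sup>2 \<ge> 0"
      by auto
    ultimately have "\<bar>spline_step' y\<bar> \<le> 12"
      unfolding spline_step'_def by (intro abs_leI) argo+
    moreover have "\<bar>spline_step'' y\<bar> \<le> 12"
      using True unfolding spline_step''_def by (auto simp: abs_le_iff max_def)
    ultimately show ?thesis ..
  next
    case False
    then show ?thesis using spline_step_le0[of y] spline_step_ge3[of y] by auto
  qed
  then show "\<bar>spline_step' y\<bar> \<le> 12" "\<bar>spline_step'' y\<bar> \<le> 12" by auto
qed

text \<open>As \<open>n\<close> grows, this exhausts the unit ball: the function is 1 where \<open>n (1 - |x|\<^sup>2) \<ge> 4\<close> and 0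
  where \<open>n (1 - |x|\<^sup>2) \<le> 1\<close>. Since \<open>|x|\<^sup>2\<close> is smooth, so is the composition at the origin as far as the
  spline allows.\<close>

definition radial_cut :: "nat \<Rightarrow> 'a::euclidean_space \<Rightarrow> real" where
  "radial_cut n x = spline_step (real n * (1 - x \<bullet> x) - 1)"

lemma pd_cut: "pd b (radial_cut n) x = - 2 * real n * spline_step' (real n * (1 - x \<bullet> x) - 1) * (x \<bullet> b)"
  and differentiable_cut: "radial_cut n differentiable (at x)"
proof -
  have i: "((\<lambda>x. real n * (1 - x \<bullet> x) - 1) has_derivative (\<lambda>h. - 2 * real n * (x \<bullet> h))) (at x)"
    by (auto intro!: derivative_eq_intros simp: inner_commute)
  have "(radial_cut n has_derivative (\<lambda>h. spline_step' (real n * (1 - x \<bullet> x) - 1) * (- 2 * real n * (x \<bullet> h)))) (at x)"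
    unfolding radial_cut_def[abs_def]
    using has_derivative_compose[OF i spline_step_DERIV(1)[unfolded has_field_derivative_def]] by simp
  from pdI[OF this] show "pd b (radial_cut n) x = - 2 * real n * spline_step' (real n * (1 - x \<bullet> x) - 1) * (x \<bullet> b)" by simp
  show "radial_cut n differentiable (at x)" by (rule differentiableI) fact
qed

lemma pd_pd_cut:
  assumes b: "b \<in> Basis"
  shows "pd b (pd b (radial_cut n)) x = 4 * (real n)\<^sup>2 * spline_step'' (real n * (1 - x \<bullet> x) - 1) * (x \<bullet> b)\<^sup>2
      - 2 * real n * spline_step' (real n * (1 - x \<bullet> x) - 1)"
  and "pd b (radial_cut n) differentiable (at x)"
proof -
  have i: "((\<lambda>x. real n * (1 - x \<bullet> x) - 1) has_derivative (\<lambda>h. - 2 * real n * (x \<bullet> h))) (at x)"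
    by (auto intro!: derivative_eq_intros simp: inner_commute)
  have s: "((\<lambda>x. spline_step' (real n * (1 - x \<bullet> x) - 1)) has_derivative
      (\<lambda>h. spline_step'' (real n * (1 - x \<bullet> x) - 1) * (- 2 * real n * (x \<bullet> h)))) (at x)"
    using has_derivative_compose[OF i spline_step_DERIV(2)[unfolded has_field_derivative_def]] by simp
  have "((\<lambda>x. - 2 * real n * spline_step' (real n * (1 - x \<bullet> x) - 1) * (x \<bullet> b)) has_derivative
      (\<lambda>h. - 2 * real n * spline_step' (real n * (1 - x \<bullet> x) - 1) * (h \<bullet> b) +
        - 2 * real n * (spline_step'' (real n * (1 - x \<bullet> x) - 1) * (- 2 * real n * (x \<bullet> h))) * (x \<bullet> b))) (at x)"
    by (intro has_derivative_mult has_derivative_mult_right s has_derivative_inner_left has_derivative_ident)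
  then have *: "(pd b (radial_cut n) has_derivative
      (\<lambda>h. - 2 * real n * spline_step' (real n * (1 - x \<bullet> x) - 1) * (h \<bullet> b) +
        - 2 * real n * (spline_step'' (real n * (1 - x \<bullet> x) - 1) * (- 2 * real n * (x \<bullet> h))) * (x \<bullet> b))) (at x)"
    by (simp add: pd_cut[abs_def])
  from pdI[OF *, of b] show "pd b (pd b (radial_cut n)) x = 4 * (real n)\<^sup>2 * spline_step'' (real n * (1 - x \<bullet> x) - 1) * (x \<bullet> b)\<^sup>2
      - 2 * real n * spline_step' (real n * (1 - x \<bullet> x) - 1)"
    using b by (simp add: power2_eq_square algebra_simps)
  show "pd b (radial_cut n) differentiable (at x)" by (rule differentiableI) fact
qed

lemma continuous_spline_step: "continuous_on UNIV spline_step'" "continuous_on UNIV spline_step''"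
  by (auto simp: spline_step'_def[abs_def] spline_step''_def[abs_def] intro!: continuous_intros)

lemma Ck_on_cut: "Ck_on 2 UNIV (radial_cut n)"
proof -
  have "continuous_on UNIV (pd b (pd b' (radial_cut n :: 'a \<Rightarrow> real)))" if "b \<in> Basis" "b' \<in> Basis" for b b' :: 'a
  proof -
    have *: "((\<lambda>x. spline_step' (real n * (1 - x \<bullet> x) - 1)) has_derivative
      (\<lambda>h. spline_step'' (real n * (1 - x \<bullet> x) - 1) * (- 2 * real n * (x \<bullet> h)))) (at x)" for x :: 'a
    proof -
      have i: "((\<lambda>x. real n * (1 - x \<bullet> x) - 1) has_derivative (\<lambda>h. - 2 * real n * (x \<bullet> h))) (at x)"
        by (auto intro!: derivative_eq_intros simp: inner_commute)
      show ?thesis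
        using has_derivative_compose[OF i spline_step_DERIV(2)[unfolded has_field_derivative_def]] by simp
    qed
    have "pd b (pd b' (radial_cut n)) x = - 2 * real n * spline_step' (real n * (1 - x \<bullet> x) - 1) * (b \<bullet> b') +
        - 2 * real n * (spline_step'' (real n * (1 - x \<bullet> x) - 1) * (- 2 * real n * (x \<bullet> b))) * (x \<bullet> b')" for x
      unfolding pd_cut[abs_def]
      by (rule pdI[where f' = "\<lambda>h. - 2 * real n * spline_step' (real n * (1 - x \<bullet> x) - 1) * (h \<bullet> b') +
        - 2 * real n * (spline_step'' (real n * (1 - x \<bullet> x) - 1) * (- 2 * real n * (x \<bullet> h))) * (x \<bullet> b')"])
        (intro has_derivative_mult has_derivative_mult_right * has_derivative_inner_left has_derivative_ident)
    then show ?thesis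
      by (auto intro!: continuous_intros continuous_on_compose2[OF continuous_spline_step(1)]
          continuous_on_compose2[OF continuous_spline_step(2)])
  qed
  then show ?thesis
    by (auto simp: Ck_2_iff Ck_on_Suc_open differentiable_cut pd_pd_cut(2))
qed

lemma cut_range: "0 \<le> radial_cut n x" "radial_cut n x \<le> 1"
  by (auto simp: radial_cut_def spline_step_range)

lemma lap_cut:
  "lap (radial_cut n) (x :: 'a::euclidean_space) = 4 * (real n)\<^sup>2 * spline_step'' (real n * (1 - x \<bullet> x) - 1) * (x \<bullet> x)
      - 2 * real n * real DIM('a) * spline_step' (real n * (1 - x \<bullet> x) - 1)"
  unfolding laplacian_on_def
  by (simp add: pd_pd_cut sum_subtractf flip: sum_distrib_left cong: sum.cong)
    (simp add: power2_eq_square flip: euclidean_inner)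

text \<open>The derivatives of the cut-off live on the shell \<open>1 < n (1 - |x|\<^sup>2) < 4\<close>, which has thickness of
  order \<open>1/n\<close>.\<close>

definition shell :: "nat \<Rightarrow> 'a::euclidean_space set" where
  "shell n = {x. 1 < real n * (1 - x \<bullet> x) \<and> real n * (1 - x \<bullet> x) < 4}"

lemma cut_outside: "real n * (1 - x \<bullet> x) \<le> 1 \<Longrightarrow> radial_cut n x = 0"
  by (simp add: radial_cut_def spline_step_le0)

lemma outside_shell:
  assumes "x \<notin> shell n"
  shows "pd b (radial_cut n) x = 0" "lap (radial_cut n) x = 0"
  using assms spline_step_le0[of "real n * (1 - x \<bullet> x) - 1"] spline_step_ge3[of "real n * (1 - x \<bullet> x) - 1"]
  by (auto simp: shell_def pd_cut lap_cut not_less)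

lemma eventually_inside_shell:
  assumes "x \<in> ball 0 1"
  shows "eventually (\<lambda>n. radial_cut n x = 1 \<and> (\<forall>b. pd b (radial_cut n) x = 0) \<and> lap (radial_cut n) x = 0) sequentially"
proof -
  have "x \<bullet> x < 1" using assms by (simp add: dot_square_norm power_less_one_iff)
  then have p: "1 - x \<bullet> x > 0" by simp
  obtain N where N: "real N * (1 - x \<bullet> x) \<ge> 4"
    using reals_Archimedean3[OF p] less_imp_le by blast
  show ?thesis
  proof (rule eventually_sequentiallyI[of N])
    fix n assume "n \<ge> N"
    then have "real n * (1 - x \<bullet> x) \<ge> real N * (1 - x \<bullet> x)" using p by (intro mult_right_mono) auto
    then have g: "real n * (1 - x \<bullet> x) \<ge> 4" using N by linarith
    then have "x \<notin> shell n" by (simp add: shell_def)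
    then show "radial_cut n x = 1 \<and> (\<forall>b. pd b (radial_cut n) x = 0) \<and> lap (radial_cut n) x = 0"
      using g by (auto simp: outside_shell radial_cut_def spline_step_ge3)
  qed
qed

lemma pd_cut_bound:
  assumes "x \<in> ball 0 1" "b \<in> Basis"
  shows "\<bar>pd b (radial_cut n) x\<bar> * (1 - x \<bullet> x) \<le> 96"
proof (cases "x \<in> shell n")
  case True
  then have s: "real n * (1 - x \<bullet> x) < 4" "0 \<le> 1 - x \<bullet> x"
    using assms(1) by (auto simp: shell_def dot_square_norm power_le_one_iff)
  have xb: "\<bar>x \<bullet> b\<bar> \<le> 1" using Basis_le_norm[OF assms(2), of x] assms(1) by auto
  have "\<bar>pd b (radial_cut n) x\<bar> = 2 * real n * (\<bar>spline_step' (real n * (1 - x \<bullet> x) - 1)\<bar> * \<bar>x \<bullet> b\<bar>)"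
    by (simp add: pd_cut abs_mult)
  also have "\<dots> \<le> 2 * real n * (12 * 1)"
    using xb spline_step_deriv_bounds by (intro mult_left_mono mult_mono) auto
  finally have "\<bar>pd b (radial_cut n) x\<bar> * (1 - x \<bullet> x) \<le> 24 * real n * (1 - x \<bullet> x)"
    using s(2) by (intro mult_right_mono) auto
  then show ?thesis using s(1) by (simp add: mult.assoc)
next
  case False
  then show ?thesis by (simp add: outside_shell)
qed

lemma lap_cut_bound:
  assumes "x \<in> ball 0 (1::real)" "n \<ge> 1"
  shows "\<bar>lap (radial_cut n) (x::real^2)\<bar> \<le> 96 * (real n)\<^sup>2"
proof -
  have x: "0 \<le> x \<bullet> x" "x \<bullet> x \<le> 1" using assms(1) by (auto simp: dot_square_norm power_le_one_iff)
  let ?y = "real n * (1 - x \<bullet> x) - 1"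
  have "\<bar>lap (radial_cut n) x\<bar> \<le> 4 * (real n)\<^sup>2 * (\<bar>spline_step'' ?y\<bar> * (x \<bullet> x)) + 4 * real n * \<bar>spline_step' ?y\<bar>"
    unfolding lap_cut using x
    by (intro order_trans[OF abs_triangle_ineq4]) (simp add: abs_mult)
  also have "\<dots> \<le> 4 * (real n)\<^sup>2 * (12 * 1) + 4 * (real n)\<^sup>2 * 12"
  proof (rule add_mono)
    show "4 * (real n)\<^sup>2 * (\<bar>spline_step'' ?y\<bar> * (x \<bullet> x)) \<le> 4 * (real n)\<^sup>2 * (12 * 1)"
      using x by (intro mult_left_mono mult_mono spline_step_deriv_bounds) auto
    have "real n \<le> (real n)\<^sup>2" using assms(2) by (intro self_le_power) auto
    then show "4 * real n * \<bar>spline_step' ?y\<bar> \<le> 4 * (real n)\<^sup>2 * 12"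
      using spline_step_deriv_bounds[of ?y] by (intro mult_mono) auto
  qed
  finally show ?thesis by simp
qed

lemma cut_support:
  assumes "n \<ge> 1"
  obtains K where "compact K" "K \<subseteq> ball (0::'a::euclidean_space) 1" "\<And>x. x \<notin> K \<Longrightarrow> radial_cut n x = 0"
proof -
  let ?K = "cball (0::'a) (sqrt (1 - 1 / real n))"
  have n: "real n > 0" "1 / real n \<le> 1" using assms by auto
  have "?K \<subseteq> ball 0 1"
  proof
    fix x assume "x \<in> ?K"
    moreover have "sqrt (1 - 1 / real n) < 1" using n by (subst real_sqrt_lt_1_iff) simp
    ultimately have "norm x < 1" unfolding mem_cball_0 by linarith
    then show "x \<in> ball (0::'a) 1" by simp
  qed
  moreover have "radial_cut n x = 0" if "x \<notin> ?K" for x :: 'a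
  proof (rule cut_outside)
    have "sqrt (1 - 1 / real n) < norm x" using that by simp
    then have "(sqrt (1 - 1 / real n))\<^sup>2 < (norm x)\<^sup>2"
      using n by (intro power_strict_mono) auto
    then have "1 - 1 / real n < x \<bullet> x" using n by (simp add: dot_square_norm)
    then have "1 - x \<bullet> x < 1 / real n" by simp
    then show "real n * (1 - x \<bullet> x) \<le> 1"
      using n by (simp add: less_divide_eq mult.commute)
  qed
  ultimately show ?thesis by (rule that[OF compact_cball])
qed

lemma measure_shell:
  assumes "n \<ge> 4"
  shows "(shell n :: (real^2) set) \<in> lmeasurable" "measure lebesgue (shell n :: (real^2) set) \<le> 4 * pi / real n"
    "shell n \<subseteq> ball (0::real^2) 1"
proof -
  have n: "real n > 0" "4 / real n \<le> 1" using assms by auto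
  let ?r = "sqrt (1 - 4 / real n)"
  have sub: "(shell n :: (real^2) set) \<subseteq> ball 0 1 - ball 0 ?r"
  proof
    fix x :: "real^2" assume "x \<in> shell n"
    then have a: "1 < real n * (1 - x \<bullet> x)" "real n * (1 - x \<bullet> x) < 4" by (auto simp: shell_def)
    have "0 < real n * (1 - x \<bullet> x)" using a(1) by linarith
    then have "1 - x \<bullet> x > 0" using n(1) by (rule zero_less_mult_pos)
    then have "(norm x)\<^sup>2 < 1" by (simp add: dot_square_norm)
    then have "norm x < 1" by (simp add: power_less_one_iff)
    moreover have "1 - 4 / real n < (norm x)\<^sup>2"
      using a(2) n by (simp add: dot_square_norm field_simps)
    then have "?r \<le> norm x" by (intro real_le_lsqrt) auto
    ultimately show "x \<in> ball 0 1 - ball 0 ?r" by simp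
  qed
  then show "shell n \<subseteq> ball (0::real^2) 1" by auto
  have "open (shell n :: (real^2) set)"
    unfolding shell_def by (intro open_Collect_conj open_Collect_less continuous_intros)
  then show m: "(shell n :: (real^2) set) \<in> lmeasurable"
    using sub bounded_subset[OF bounded_ball[of "0::real^2" 1]] by (intro lmeasurable_open) auto
  have "measure lebesgue (shell n :: (real^2) set) \<le> measure lebesgue (ball 0 1 - ball 0 ?r :: (real^2) set)"
    using m sub by (intro measure_mono_fmeasurable) auto
  also have "\<dots> = measure lebesgue (ball 0 1 :: (real^2) set) - measure lebesgue (ball 0 ?r :: (real^2) set)"
  proof (rule measurable_measure_Diff)
    have "?r \<le> 1" using n by simp
    then show "ball 0 ?r \<subseteq> (ball 0 1 :: (real^2) set)" by (rule subset_ball)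
  qed auto
  also have "\<dots> = pi - pi * (1 - 4 / real n)"
    using n by (simp add: content_ball unit_ball_vol_2)
  finally show "measure lebesgue (shell n :: (real^2) set) \<le> 4 * pi / real n"
    by (simp add: algebra_simps)
qed

lemma cut_measurable:
  assumes "S \<in> sets lebesgue"
  shows "radial_cut n \<in> borel_measurable (lebesgue_on S)" "lap (radial_cut n) \<in> borel_measurable (lebesgue_on S)"
    "b \<in> Basis \<Longrightarrow> pd b (radial_cut n) \<in> borel_measurable (lebesgue_on S)"
proof -
  have c: "continuous_on UNIV (radial_cut n)" "continuous_on UNIV (lap (radial_cut n))"
    "b \<in> Basis \<Longrightarrow> continuous_on UNIV (pd b (radial_cut n))"
    using Ck_on_2D[OF open_UNIV Ck_on_cut] Ck_on_continuous[OF Ck_on_cut] by auto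
  show "radial_cut n \<in> borel_measurable (lebesgue_on S)" "lap (radial_cut n) \<in> borel_measurable (lebesgue_on S)"
    "b \<in> Basis \<Longrightarrow> pd b (radial_cut n) \<in> borel_measurable (lebesgue_on S)"
    using assms c by (auto intro!: continuous_imp_measurable_on_sets_lebesgue intro: continuous_on_subset)
qed

lemma disk_sets [simp]: "ball (a::'a::euclidean_space) r \<in> sets lebesgue" by simp

lemma disk_integrable_const: "integrable (lebesgue_on (ball (a::'a::euclidean_space) r)) (\<lambda>x. k :: 'b::{banach,second_countable_topology})"
  using finite_measure.integrable_const[OF finite_measure_lebesgue_on[OF lmeasurable_ball]] .

lemma tendsto_integral_cut:
  fixes G :: "'a::euclidean_space \<Rightarrow> 'b::{banach,second_countable_topology}"
  assumes G: "integrable (lebesgue_on (ball 0 1)) G"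
  shows "(\<lambda>n. LINT x|lebesgue_on (ball 0 1). radial_cut n x *\<^sub>R G x) \<longlonglongrightarrow> (LINT x|lebesgue_on (ball 0 1). G x)"
proof (rule integral_dominated_convergence[where w="\<lambda>x. norm (G x)"])
  show mG: "G \<in> borel_measurable (lebesgue_on (ball 0 1))" by (rule borel_measurable_integrable[OF G])
  show "(\<lambda>x. radial_cut n x *\<^sub>R G x) \<in> borel_measurable (lebesgue_on (ball 0 1))" for n
    by (intro borel_measurable_scaleR cut_measurable(1) mG) simp
  show "AE x in lebesgue_on (ball 0 1). (\<lambda>n. radial_cut n x *\<^sub>R G x) \<longlonglongrightarrow> G x"
  proof (rule AE_I2)
    fix x :: 'a assume "x \<in> space (lebesgue_on (ball 0 1))"
    then have "x \<in> ball 0 1" by simp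
    from eventually_inside_shell[OF this]
    show "(\<lambda>n. radial_cut n x *\<^sub>R G x) \<longlonglongrightarrow> G x"
      by (intro tendsto_eventually) (auto elim: eventually_mono)
  qed
  show "AE x in lebesgue_on (ball 0 1). norm (radial_cut n x *\<^sub>R G x) \<le> norm (G x)" for n
  proof (rule AE_I2)
    fix x :: 'a
    have "\<bar>radial_cut n x\<bar> \<le> 1" using cut_range[of n x] by simp
    then show "norm (radial_cut n x *\<^sub>R G x) \<le> norm (G x)"
      using mult_right_mono[of "\<bar>radial_cut n x\<bar>" 1 "norm (G x)"] by simp
  qed
qed (use G in auto)

text \<open>The Laplacian of the cut-off is of order \<open>n\<^sup>2\<close> on a shell where \<open>1 - |x|\<^sup>2\<close> is of order
  \<open>1/n\<close>: second-order vanishing at the circle keeps the integrand bounded, first-order vanishing does so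
  for the gradient.\<close>

lemma tendsto_integral_lap_cut:
  fixes G :: "real^2 \<Rightarrow> 'b::{banach,second_countable_topology}"
  assumes G: "G \<in> borel_measurable (lebesgue_on unit_disk)"
    and C: "\<And>x. x \<in> unit_disk \<Longrightarrow> norm (G x) \<le> C * (1 - x \<bullet> x)\<^sup>2" "C \<ge> 0"
  shows "(\<lambda>n. LINT x|lebesgue_on unit_disk. lap (radial_cut n) x *\<^sub>R G x) \<longlonglongrightarrow> 0"
proof -
  have "(\<lambda>n. LINT x|lebesgue_on unit_disk. lap (radial_cut n) x *\<^sub>R G x) \<longlonglongrightarrow> (LINT x|lebesgue_on unit_disk. 0)"
  proof (rule integral_dominated_convergence[where w="\<lambda>x. 1536 * C"])
    show "(\<lambda>x. lap (radial_cut n) x *\<^sub>R G x) \<in> borel_measurable (lebesgue_on unit_disk)" for n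
      by (intro borel_measurable_scaleR cut_measurable(2) G) simp
    show "AE x in lebesgue_on unit_disk. (\<lambda>n. lap (radial_cut n) x *\<^sub>R G x) \<longlonglongrightarrow> 0"
    proof (rule AE_I2)
      fix x :: "real^2" assume "x \<in> space (lebesgue_on unit_disk)"
      then have "x \<in> unit_disk" by simp
      from eventually_inside_shell[OF this]
      show "(\<lambda>n. lap (radial_cut n) x *\<^sub>R G x) \<longlonglongrightarrow> 0"
        by (intro tendsto_eventually) (auto elim: eventually_mono)
    qed
    show "AE x in lebesgue_on unit_disk. norm (lap (radial_cut n) x *\<^sub>R G x) \<le> 1536 * C" for n
    proof (rule AE_I2)
      fix x :: "real^2" assume "x \<in> space (lebesgue_on unit_disk)"
      then have x: "x \<in> unit_disk" by simp
      show "norm (lap (radial_cut n) x *\<^sub>R G x) \<le> 1536 * C"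
      proof (cases "x \<in> shell n")
        case True
        then have s: "1 < real n * (1 - x \<bullet> x)" "real n * (1 - x \<bullet> x) < 4" by (auto simp: shell_def)
        then have n: "n \<ge> 1" by (cases n) auto
        have "norm (lap (radial_cut n) x *\<^sub>R G x) \<le> (96 * (real n)\<^sup>2) * (C * (1 - x \<bullet> x)\<^sup>2)"
          unfolding norm_scaleR by (intro mult_mono lap_cut_bound C x n) auto
        also have "\<dots> = 96 * C * (real n * (1 - x \<bullet> x))\<^sup>2" by (simp add: power2_eq_square)
        also have "\<dots> \<le> 96 * C * 4\<^sup>2"
          using s C(2) by (intro mult_left_mono power_mono) auto
        finally show ?thesis by simp
      qed (use C(2) in \<open>simp add: outside_shell\<close>)
    qed
  qed (use disk_integrable_const in auto)
  then show ?thesis by simp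
qed

lemma tendsto_integral_pd_cut:
  fixes G :: "real^2 \<Rightarrow> 'b::{banach,second_countable_topology}"
  assumes G: "G \<in> borel_measurable (lebesgue_on unit_disk)" and b: "b \<in> Basis"
    and C: "\<And>x. x \<in> unit_disk \<Longrightarrow> norm (G x) \<le> C * (1 - x \<bullet> x)" "C \<ge> 0"
  shows "(\<lambda>n. LINT x|lebesgue_on unit_disk. pd b (radial_cut n) x *\<^sub>R G x) \<longlonglongrightarrow> 0"
proof -
  have "(\<lambda>n. LINT x|lebesgue_on unit_disk. pd b (radial_cut n) x *\<^sub>R G x) \<longlonglongrightarrow> (LINT x|lebesgue_on unit_disk. 0)"
  proof (rule integral_dominated_convergence[where w="\<lambda>x. 96 * C"])
    show "(\<lambda>x. pd b (radial_cut n) x *\<^sub>R G x) \<in> borel_measurable (lebesgue_on unit_disk)" for n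
      by (intro borel_measurable_scaleR cut_measurable(3) G b) simp
    show "AE x in lebesgue_on unit_disk. (\<lambda>n. pd b (radial_cut n) x *\<^sub>R G x) \<longlonglongrightarrow> 0"
    proof (rule AE_I2)
      fix x :: "real^2" assume "x \<in> space (lebesgue_on unit_disk)"
      then have "x \<in> unit_disk" by simp
      from eventually_inside_shell[OF this]
      show "(\<lambda>n. pd b (radial_cut n) x *\<^sub>R G x) \<longlonglongrightarrow> 0"
        by (intro tendsto_eventually) (auto elim: eventually_mono)
    qed
    show "AE x in lebesgue_on unit_disk. norm (pd b (radial_cut n) x *\<^sub>R G x) \<le> 96 * C" for n
    proof (rule AE_I2)
      fix x :: "real^2" assume "x \<in> space (lebesgue_on unit_disk)"
      then have x: "x \<in> unit_disk" by simp
      have "norm (pd b (radial_cut n) x *\<^sub>R G x) \<le> \<bar>pd b (radial_cut n) x\<bar> * (C * (1 - x \<bullet> x))"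
        unfolding norm_scaleR by (intro mult_left_mono C x) auto
      also have "\<dots> = C * (\<bar>pd b (radial_cut n) x\<bar> * (1 - x \<bullet> x))" by simp
      also have "\<dots> \<le> C * 96" by (intro mult_left_mono pd_cut_bound x b C)
      finally show "norm (pd b (radial_cut n) x *\<^sub>R G x) \<le> 96 * C" by simp
    qed
  qed (use disk_integrable_const in auto)
  then show ?thesis by simp
qed

text \<open>When \<open>G\<close> vanishes to first order only, the integrand is of order \<open>n\<close>, but the shell has area
  of order \<open>1/n\<close>.\<close>

lemma integral_lap_cut_bound:
  fixes G :: "real^2 \<Rightarrow> 'b::{banach,second_countable_topology}"
  assumes G: "G \<in> borel_measurable (lebesgue_on unit_disk)" and n: "n \<ge> 4" and C0: "C \<ge> 0"
    and C: "\<And>x. x \<in> shell n \<Longrightarrow> norm (G x) \<le> C * (1 - x \<bullet> x)"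
  shows "norm (LINT x|lebesgue_on unit_disk. lap (radial_cut n) x *\<^sub>R G x) \<le> 1536 * pi * C"
proof -
  let ?f = "\<lambda>x. indicator (shell n) x * (384 * real n * C)"
  have p: "norm (lap (radial_cut n) x *\<^sub>R G x) \<le> ?f x" if x: "x \<in> unit_disk" for x
  proof (cases "x \<in> shell n")
    case True
    then have s: "real n * (1 - x \<bullet> x) < 4" by (auto simp: shell_def)
    have "norm (lap (radial_cut n) x *\<^sub>R G x) \<le> (96 * (real n)\<^sup>2) * (C * (1 - x \<bullet> x))"
      unfolding norm_scaleR by (intro mult_mono lap_cut_bound C x True) (use n in auto)
    also have "\<dots> = 96 * real n * C * (real n * (1 - x \<bullet> x))" by (simp add: power2_eq_square)
    also have "\<dots> \<le> 96 * real n * C * 4"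
      using s C0 by (intro mult_left_mono) auto
    finally show ?thesis using True by simp
  qed (simp add: outside_shell)
  have sm: "shell n \<in> sets (lebesgue_on unit_disk)"
    using measure_shell[OF n] by (auto simp: sets_restrict_space_iff fmeasurableD)
  have m: "measure (lebesgue_on unit_disk) (shell n) = measure lebesgue (shell n :: (real^2) set)"
    using measure_shell[OF n] by (intro measure_restrict_space) auto
  have i: "integrable (lebesgue_on unit_disk) ?f"
    using integrable_mult_indicator[OF sm disk_integrable_const, of "384 * real n * C"] by simp
  have "norm (LINT x|lebesgue_on unit_disk. lap (radial_cut n) x *\<^sub>R G x) \<le> (LINT x|lebesgue_on unit_disk. ?f x)"
  proof (rule order_trans[OF integral_norm_bound])
    show "(LINT x|lebesgue_on unit_disk. norm (lap (radial_cut n) x *\<^sub>R G x)) \<le> (LINT x|lebesgue_on unit_disk. ?f x)"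
    proof (intro integral_mono_AE' i AE_I2)
      fix x :: "real^2" assume "x \<in> space (lebesgue_on unit_disk)"
      then show "norm (lap (radial_cut n) x *\<^sub>R G x) \<le> ?f x" by (intro p) simp
      show "0 \<le> ?f x" using C0 by (simp add: indicator_def)
    qed
  qed
  also have "\<dots> = measure lebesgue (shell n :: (real^2) set) * (384 * real n * C)"
    using sm m measure_shell(3)[OF n] by simp (simp add: Int_absorb2)
  also have "\<dots> \<le> (4 * pi / real n) * (384 * real n * C)"
    using C0 by (intro mult_right_mono measure_shell n) auto
  also have "\<dots> = 1536 * pi * C" using n by simp
  finally show ?thesis .
qed

section \<open>Dirichlet eigenfunctions\<close>

lemma second_derivative_nonpos_at_max:
  fixes p p' :: "real \<Rightarrow> real"
  assumes d: "d > 0" and p: "\<And>t. \<bar>t\<bar> < d \<Longrightarrow> (p has_real_derivative p' t) (at t)"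
    and p2: "(p' has_real_derivative m) (at 0)" and mx: "\<And>t. \<bar>t\<bar> < d \<Longrightarrow> p t \<le> p 0"
  shows "m \<le> 0"
proof (rule ccontr)
  assume "\<not> m \<le> 0"
  then have "m > 0" by simp
  have p0: "p' 0 = 0"
    using DERIV_local_max[OF p[of 0] d] mx d by auto
  obtain e where e: "e > 0" "\<And>h. 0 < h \<Longrightarrow> h < e \<Longrightarrow> p' 0 < p' h"
    using DERIV_pos_inc_right[OF p2 \<open>m > 0\<close>] by auto
  define h where "h = min d e / 2"
  have h: "0 < h" "h < d" "h < e" using d e by (auto simp: h_def)
  obtain z where z: "0 < z" "z < h" "p h - p 0 = (h - 0) * p' z"
    using MVT2[of 0 h p p'] h p by (auto simp: abs_if)
  have "p' z > 0" using e(2)[of z] z h p0 by auto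
  then have "p h > p 0" using z h by (metis diff_gt_0_iff_gt diff_zero mult_pos_pos)
  then show False using mx[of h] h by auto
qed

text \<open>Maximum principle for the difference with the barrier \<open>K/4 (1 - |x|\<^sup>2)\<close>, whose Laplacian in the
  plane is \<open>- K\<close>. The strict inequality needed at an interior maximum comes from a larger \<open>K\<close>.\<close>

lemma barrier_real:
  fixes w :: "real^2 \<Rightarrow> real"
  assumes C: "Ck_on 2 unit_disk w" "continuous_on (cball 0 1) w" "\<And>z. z \<in> sphere 0 1 \<Longrightarrow> w z = 0"
    and K: "\<And>x. x \<in> unit_disk \<Longrightarrow> - K \<le> lap w x" and x: "x \<in> cball 0 1"
  shows "w x \<le> K / 4 * (1 - x \<bullet> x)"
proof -
  have strict: "w x \<le> K' / 4 * (1 - x \<bullet> x)" if K': "K' > K" for K'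
  proof -
    define g where "g y = w y + K' / 4 * (y \<bullet> y)" for y
    have "continuous_on (cball 0 1) g" unfolding g_def by (intro continuous_intros C)
    then obtain x0 where x0: "x0 \<in> cball 0 1" "\<And>y. y \<in> cball 0 1 \<Longrightarrow> g y \<le> g x0"
      using continuous_attains_sup[of "cball 0 1" g] by auto
    have "x0 \<notin> unit_disk"
    proof
      assume i: "x0 \<in> unit_disk"
      have q: "Ck_on 2 unit_disk (\<lambda>y. K' / 4 * (y \<bullet> y))"
        by (intro Ck_on_mult Ck_on_const Ck_on_subset[OF Ck_on_norm_sq]) auto
      have gC: "Ck_on 2 unit_disk g" unfolding g_def by (intro Ck_on_add C q) auto
      have "lap g x0 = lap w x0 + K' / 4 * lap (\<lambda>y. y \<bullet> y) x0"
        unfolding g_def lap_add[OF open_ball i C(1) q]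
        using lap_bounded_linear[OF open_ball i Ck_on_subset[OF Ck_on_norm_sq subset_UNIV]
            bounded_linear_mult_right, of "K' / 4"]
        by simp
      then have "lap g x0 > 0" using K[OF i] K' by (simp add: lap_norm_sq)
      then obtain b where b: "b \<in> Basis" "pd b (pd b g) x0 > 0"
        unfolding laplacian_on_def by (meson not_le sum_nonpos)
      obtain d where d: "d > 0" "ball x0 d \<subseteq> unit_disk"
        by (rule openE[OF open_ball i])
      have inb: "x0 + t *\<^sub>R b \<in> unit_disk" if "\<bar>t\<bar> < d" for t
      proof -
        have "x0 + t *\<^sub>R b \<in> ball x0 d" using that b(1) by (simp add: dist_norm)
        then show ?thesis using d(2) by blast
      qed
      have l: "((\<lambda>t. x0 + t *\<^sub>R b) has_derivative (\<lambda>h. h *\<^sub>R b)) (at t)" for t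
        by (auto intro!: derivative_eq_intros)
      have chain: "((\<lambda>t. f (x0 + t *\<^sub>R b)) has_real_derivative pd b f (x0 + t *\<^sub>R b)) (at t)"
        if f: "f differentiable (at (x0 + t *\<^sub>R b))" for f :: "real^2 \<Rightarrow> real" and t
      proof -
        note hd = has_derivative_pd[OF f]
        have "pd (h *\<^sub>R b) f (x0 + t *\<^sub>R b) = h *\<^sub>R pd b f (x0 + t *\<^sub>R b)" for h
          using linear_scale[OF has_derivative_linear[OF hd]] .
        then show ?thesis
          using has_derivative_compose[OF l hd] 
          by (simp add: has_real_derivative_iff_has_vector_derivative has_vector_derivative_def)
      qed
      have "pd b (pd b g) x0 \<le> 0"
      proof (rule second_derivative_nonpos_at_max[OF d(1)])
        fix t :: real assume t: "\<bar>t\<bar> < d"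
        show "((\<lambda>t. g (x0 + t *\<^sub>R b)) has_real_derivative pd b g (x0 + t *\<^sub>R b)) (at t)"
          by (rule chain) (rule Ck_on_2D(2)[OF open_ball gC inb[OF t]])
        show "g (x0 + t *\<^sub>R b) \<le> g (x0 + 0 *\<^sub>R b)"
          using x0(2) inb[OF t] by auto
      next
        show "((\<lambda>t. pd b g (x0 + t *\<^sub>R b)) has_real_derivative pd b (pd b g) x0) (at 0)"
          using chain[of "pd b g" 0] Ck_on_2D(4)[OF open_ball gC b(1) i] by simp
      qed
      then show False using b(2) by simp
    qed
    then have n1: "norm x0 = 1" using x0(1) by simp
    then have "g x0 = K' / 4" using C(3)[of x0] by (simp add: g_def dot_square_norm)
    then show ?thesis using x0(2)[OF x] by (simp add: g_def algebra_simps)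
  qed
  have x1: "0 \<le> 1 - x \<bullet> x" using x by (simp add: dot_square_norm power_le_one_iff)
  show ?thesis
  proof (rule field_le_epsilon)
    fix e :: real assume "e > 0"
    have "w x \<le> (K + e) / 4 * (1 - x \<bullet> x)" using strict \<open>e > 0\<close> by simp
    also have "\<dots> \<le> K / 4 * (1 - x \<bullet> x) + e * 1"
      using \<open>e > 0\<close> x1 by (simp add: field_simps)
    finally show "w x \<le> K / 4 * (1 - x \<bullet> x) + e" by simp
  qed
qed

text \<open>For complex values, rotate so that \<open>w x\<close> becomes a nonnegative real number.\<close>

lemma barrier:
  fixes w :: "real^2 \<Rightarrow> complex"
  assumes C: "Ck_on 2 unit_disk w" "continuous_on (cball 0 1) w" "\<And>z. z \<in> sphere 0 1 \<Longrightarrow> w z = 0"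
    and K: "\<And>x. x \<in> unit_disk \<Longrightarrow> norm (lap w x) \<le> K" and x: "x \<in> cball 0 1"
  shows "norm (w x) \<le> K / 4 * (1 - x \<bullet> x)"
proof -
  define a where "a = cnj (sgn (w x))"
  have a: "norm a \<le> 1" by (simp add: a_def norm_sgn)
  have L: "bounded_linear (\<lambda>z. Re (a * z))"
    by (intro bounded_linear_compose[OF bounded_linear_Re] bounded_linear_mult_right)
  have "Re (a * w x) \<le> K / 4 * (1 - x \<bullet> x)"
  proof (rule barrier_real[OF _ _ _ _ x])
    show "Ck_on 2 unit_disk (\<lambda>x. Re (a * w x))" by (rule Ck_on_bounded_linear[OF open_ball L C(1)])
    show "continuous_on (cball 0 1) (\<lambda>x. Re (a * w x))" by (intro continuous_intros C)
    show "Re (a * w z) = 0" if "z \<in> sphere 0 1" for z using C(3)[OF that] by simp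
    show "- K \<le> lap (\<lambda>x. Re (a * w x)) y" if y: "y \<in> unit_disk" for y
    proof -
      have "\<bar>Re (a * lap w y)\<bar> \<le> norm (a * lap w y)" by (rule abs_Re_le_cmod)
      also have "\<dots> \<le> 1 * K" unfolding norm_mult using K[OF y] a by (intro mult_mono) auto
      finally show ?thesis using lap_bounded_linear[OF open_ball y C(1) L] by simp
    qed
  qed
  moreover have "a * w x = of_real (norm (w x))"
    using complex_norm_square[of "w x"]
    by (cases "w x = 0") (simp_all add: a_def sgn_eq power2_eq_square field_simps)
  ultimately show ?thesis by simp
qed

lemma continuous_disk_measurable:
  "continuous_on unit_disk g \<Longrightarrow> g \<in> borel_measurable (lebesgue_on unit_disk)"
  by (intro continuous_imp_measurable_on_sets_lebesgue) auto

lemma inner_le_1: "x \<in> ball 0 1 \<Longrightarrow> 0 \<le> 1 - x \<bullet> x"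
  by (auto simp: dot_square_norm power_le_one_iff)

lemma dirichlet_Ck: "dirichlet_eigenfunction c l \<psi> \<Longrightarrow> Ck_on 2 unit_disk \<psi>"
  by (simp add: dirichlet_eigenfunction_def)

lemma eigenfunction_lap:
  assumes "- laplacian_on unit_disk g x = of_real (1 / c\<^sup>2 * l\<^sup>2) * g x" "x \<in> unit_disk"
  shows "lap g x = - of_real (l\<^sup>2 / c\<^sup>2) * g x"
proof -
  have "- lap g x = of_real (1 / c\<^sup>2 * l\<^sup>2) * g x"
    using assms(1) unfolding laplacian_on_open[OF open_ball assms(2)] .
  then have "lap g x = - (of_real (1 / c\<^sup>2 * l\<^sup>2) * g x)" by (rule equation_minus_iff[THEN iffD2, OF sym])
  then show ?thesis by simp
qed

lemma dirichlet_lap: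
  assumes "dirichlet_eigenfunction c l \<psi>" "x \<in> unit_disk"
  shows "lap \<psi> x = - of_real (l\<^sup>2 / c\<^sup>2) * \<psi> x"
  using assms by (intro eigenfunction_lap) (auto simp: dirichlet_eigenfunction_def)

text \<open>At a maximum point of \<open>|\<psi>|\<close> the barrier gives \<open>4 \<le> l\<^sup>2/c\<^sup>2\<close>; this bound on the Dirichlet
  spectrum takes the place of the Poincare inequality.\<close>

lemma dirichlet_bounds:
  assumes E: "dirichlet_eigenfunction c l \<psi>" and c: "c > 0" "l > 0"
  obtains C where "C \<ge> 0" "\<And>x. x \<in> cball 0 1 \<Longrightarrow> norm (\<psi> x) \<le> C * (1 - x \<bullet> x)"
    "2 * c \<le> l \<or> (\<forall>x\<in>cball 0 1. \<psi> x = 0)"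
proof -
  note C = E[unfolded dirichlet_eigenfunction_def]
  have "continuous_on (cball 0 1) (\<lambda>x. norm (\<psi> x))" using C by (intro continuous_intros) auto
  then obtain x0 where x0: "x0 \<in> cball 0 1" "\<And>y. y \<in> cball 0 1 \<Longrightarrow> norm (\<psi> y) \<le> norm (\<psi> x0)"
    using continuous_attains_sup[of "cball 0 1" "\<lambda>x. norm (\<psi> x)"] by auto
  define S where "S = norm (\<psi> x0)"
  have "norm (lap \<psi> x) \<le> l\<^sup>2 / c\<^sup>2 * S" if x: "x \<in> unit_disk" for x
    unfolding dirichlet_lap[OF E x] norm_mult S_def
    using x0(2)[of x] x by (intro mult_mono) (auto simp: norm_divide norm_power)
  then have b: "norm (\<psi> x) \<le> (l\<^sup>2 / c\<^sup>2 * S) / 4 * (1 - x \<bullet> x)" if "x \<in> cball 0 1" for x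
    using C that by (intro barrier) auto
  have dj: "2 * c \<le> l \<or> (\<forall>x\<in>cball 0 1. \<psi> x = 0)"
  proof (cases "S = 0")
    case False
    then have S: "S > 0" by (simp add: S_def)
    define q where "q = l\<^sup>2 / c\<^sup>2 * S"
    have "S \<le> q / 4 * (1 - x0 \<bullet> x0)" using b[OF x0(1)] unfolding q_def S_def .
    also have "\<dots> \<le> q / 4 * 1" using S by (intro mult_left_mono) (auto simp: q_def)
    finally have "4 * S \<le> q" by linarith
    then have "4 * S \<le> l\<^sup>2 / c\<^sup>2 * S" unfolding q_def .
    then have "4 \<le> l\<^sup>2 / c\<^sup>2" using S by (simp only: mult_le_cancel_right_pos)
    then have "4 * c\<^sup>2 \<le> l\<^sup>2" using c by (subst (asm) pos_le_divide_eq) auto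
    then have "(2 * c)\<^sup>2 \<le> l\<^sup>2" by (simp add: power_mult_distrib)
    then have "2 * c \<le> l" by (rule power2_le_imp_le) (use c in auto)
    then show ?thesis ..
  next
    case True
    have "\<psi> x = 0" if "x \<in> cball 0 1" for x
      using x0(2)[OF that] True unfolding S_def by simp
    then show ?thesis by blast
  qed
  have nn: "0 \<le> (l\<^sup>2 / c\<^sup>2 * S) / 4" by (simp add: S_def)
  show ?thesis by (rule that[OF nn b dj])
qed

lemma Ck_on_cnj: "open S \<Longrightarrow> Ck_on k S g \<Longrightarrow> Ck_on k S (\<lambda>x. cnj (g x))"
  by (rule Ck_on_bounded_linear[OF _ bounded_linear_cnj])

text \<open>Applying Green's formula to the product of two eigenfunctions avoids boundary terms with
  derivatives: the product vanishes to second order at the circle, which compensates the second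
  derivatives of the cut-off.\<close>

lemma dirichlet_gradient_cut:
  assumes E: "dirichlet_eigenfunction c l \<psi>" "dirichlet_eigenfunction c m \<xi>" and c: "c > 0" "l > 0" "m > 0"
  shows "integrable (lebesgue_on unit_disk) (\<lambda>x. \<psi> x * cnj (\<xi> x))"
    "(\<lambda>n. LINT x|lebesgue_on unit_disk. radial_cut n x *\<^sub>R (\<Sum>b\<in>Basis. pd b \<psi> x * cnj (pd b \<xi> x)))
      \<longlonglongrightarrow> of_real ((l\<^sup>2 / c\<^sup>2 + m\<^sup>2 / c\<^sup>2) / 2) * (LINT x|lebesgue_on unit_disk. \<psi> x * cnj (\<xi> x))"
proof -
  define G where "G x = \<psi> x * cnj (\<xi> x)" for x
  define k where "k = l\<^sup>2 / c\<^sup>2 + m\<^sup>2 / c\<^sup>2"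
  note C2 = E[THEN dirichlet_Ck]
  have GC: "Ck_on 2 unit_disk G" unfolding G_def by (intro Ck_on_mult Ck_on_cnj C2 open_ball)
  obtain C1 where C1: "C1 \<ge> 0" "\<And>x. x \<in> cball 0 1 \<Longrightarrow> norm (\<psi> x) \<le> C1 * (1 - x \<bullet> x)"
    using dirichlet_bounds[OF E(1) c(1,2)] by metis
  obtain C2 where C2': "C2 \<ge> 0" "\<And>x. x \<in> cball 0 1 \<Longrightarrow> norm (\<xi> x) \<le> C2 * (1 - x \<bullet> x)"
    using dirichlet_bounds[OF E(2) c(1,3)] by metis
  have Gb: "norm (G x) \<le> (C1 * C2) * (1 - x \<bullet> x)\<^sup>2" if x: "x \<in> unit_disk" for x
  proof -
    have "norm (G x) \<le> (C1 * (1 - x \<bullet> x)) * (C2 * (1 - x \<bullet> x))"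
      unfolding G_def norm_mult complex_mod_cnj
      using x inner_le_1[OF x] by (intro mult_mono C1 C2') (auto intro!: mult_nonneg_nonneg C1)
    then show ?thesis by (simp add: power2_eq_square algebra_simps)
  qed
  have Gm: "G \<in> borel_measurable (lebesgue_on unit_disk)"
    by (intro continuous_disk_measurable Ck_on_continuous[OF GC])
  have "integrable (lebesgue_on unit_disk) G"
  proof (rule Bochner_Integration.integrable_bound[OF disk_integrable_const[where k="C1 * C2"] Gm], rule AE_I2)
    fix x :: "real^2" assume "x \<in> space (lebesgue_on unit_disk)"
    then have x: "x \<in> unit_disk" by simp
    have "norm (G x) \<le> (C1 * C2) * (1 - x \<bullet> x)\<^sup>2" using Gb[OF x] .
    also have "\<dots> \<le> C1 * C2 * 1\<^sup>2"
      using inner_le_1[OF x] C1 C2' by (intro mult_left_mono power_mono) auto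
    finally show "norm (G x) \<le> norm (C1 * C2)" by simp
  qed
  then show Gi: "integrable (lebesgue_on unit_disk) (\<lambda>x. \<psi> x * cnj (\<xi> x))" by (simp add: G_def[abs_def])
  \<comment> \<open>The eigenvalue equations turn the Laplacian of the product into gradient and product terms.\<close>
  have id: "radial_cut n x *\<^sub>R (\<Sum>b\<in>Basis. pd b \<psi> x * cnj (pd b \<xi> x))
      = (1/2) *\<^sub>R (radial_cut n x *\<^sub>R lap G x) + (k / 2) *\<^sub>R (radial_cut n x *\<^sub>R G x)" if x: "x \<in> unit_disk" for x n
  proof -
    have "lap G x = \<psi> x * lap (\<lambda>x. cnj (\<xi> x)) x + lap \<psi> x * cnj (\<xi> x)
        + 2 *\<^sub>R (\<Sum>b\<in>Basis. pd b \<psi> x * pd b (\<lambda>x. cnj (\<xi> x)) x)"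
      unfolding G_def by (rule lap_mult[OF open_ball x C2(1) Ck_on_cnj[OF open_ball C2(2)]])
    also have "lap (\<lambda>x. cnj (\<xi> x)) x = cnj (lap \<xi> x)"
      by (rule lap_bounded_linear[OF open_ball x C2(2) bounded_linear_cnj])
    also have "(\<Sum>b\<in>Basis. pd b \<psi> x * pd b (\<lambda>x. cnj (\<xi> x)) x) = (\<Sum>b\<in>Basis. pd b \<psi> x * cnj (pd b \<xi> x))"
      by (intro sum.cong refl arg_cong2[where f="(*)"] pd_bounded_linear bounded_linear_cnj
          Ck_on_2D(2)[OF open_ball C2(2) x])
    finally have "lap G x = 2 *\<^sub>R (\<Sum>b\<in>Basis. pd b \<psi> x * cnj (pd b \<xi> x)) - k *\<^sub>R G x"
      unfolding dirichlet_lap[OF E(1) x] dirichlet_lap[OF E(2) x]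
      by (simp add: G_def[abs_def] k_def scaleR_conv_of_real algebra_simps)
    then show ?thesis by (simp add: scaleR_right_diff_distrib)
  qed
  have "(\<lambda>n. (1/2) *\<^sub>R (LINT x|lebesgue_on unit_disk. lap (radial_cut n) x *\<^sub>R G x)
      + (k / 2) *\<^sub>R (LINT x|lebesgue_on unit_disk. radial_cut n x *\<^sub>R G x))
      \<longlonglongrightarrow> (1/2) *\<^sub>R 0 + (k / 2) *\<^sub>R (LINT x|lebesgue_on unit_disk. G x)"
  proof (intro tendsto_intros)
    show "(\<lambda>n. LINT x|lebesgue_on unit_disk. lap (radial_cut n) x *\<^sub>R G x) \<longlonglongrightarrow> 0"
      by (rule tendsto_integral_lap_cut[OF Gm Gb]) (use C1(1) C2'(1) in auto)
    show "(\<lambda>n. LINT x|lebesgue_on unit_disk. radial_cut n x *\<^sub>R G x) \<longlonglongrightarrow> (LINT x|lebesgue_on unit_disk. G x)"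
      by (rule tendsto_integral_cut) (use Gi in \<open>simp add: G_def[abs_def]\<close>)
  qed
  moreover have "eventually (\<lambda>n. (1/2) *\<^sub>R (LINT x|lebesgue_on unit_disk. lap (radial_cut n) x *\<^sub>R G x)
      + (k / 2) *\<^sub>R (LINT x|lebesgue_on unit_disk. radial_cut n x *\<^sub>R G x)
      = (LINT x|lebesgue_on unit_disk. radial_cut n x *\<^sub>R (\<Sum>b\<in>Basis. pd b \<psi> x * cnj (pd b \<xi> x)))) sequentially"
  proof (rule eventually_sequentiallyI[of 1])
    fix n :: nat assume "n \<ge> 1"
    then obtain K where K: "compact K" "K \<subseteq> ball (0::real^2) 1" "\<And>x. x \<notin> K \<Longrightarrow> radial_cut n x = 0"
      using cut_support by metis
    have C: "Ck_on 2 unit_disk (radial_cut n)" by (rule Ck_on_subset[OF Ck_on_cut]) simp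
    have cc: "continuous_on unit_disk (radial_cut n)" using C by (rule Ck_on_continuous)
    have i: "integrable (lebesgue_on unit_disk) (\<lambda>x. radial_cut n x *\<^sub>R lap G x)"
      "integrable (lebesgue_on unit_disk) (\<lambda>x. radial_cut n x *\<^sub>R G x)"
      using K Ck_on_2D(7)[OF open_ball GC] Ck_on_continuous[OF GC] cc
      by (auto intro!: integrable_on_compact_support[OF open_ball K(1,2)] continuous_intros)
    have green: "(LINT x|lebesgue_on unit_disk. lap (radial_cut n) x *\<^sub>R G x) = (LINT x|lebesgue_on unit_disk. radial_cut n x *\<^sub>R lap G x)"
      by (rule sym, rule Green_cutoff[OF open_ball K C GC])
    have "(LINT x|lebesgue_on unit_disk. radial_cut n x *\<^sub>R (\<Sum>b\<in>Basis. pd b \<psi> x * cnj (pd b \<xi> x)))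
      = (LINT x|lebesgue_on unit_disk. (1/2) *\<^sub>R (radial_cut n x *\<^sub>R lap G x) + (k / 2) *\<^sub>R (radial_cut n x *\<^sub>R G x))"
      by (rule Bochner_Integration.integral_cong) (use id in auto)
    also have "\<dots> = (1/2) *\<^sub>R (LINT x|lebesgue_on unit_disk. radial_cut n x *\<^sub>R lap G x)
      + (k / 2) *\<^sub>R (LINT x|lebesgue_on unit_disk. radial_cut n x *\<^sub>R G x)"
      using i by (subst Bochner_Integration.integral_add) (auto simp del: scaleR_scaleR)
    finally show "(1/2) *\<^sub>R (LINT x|lebesgue_on unit_disk. lap (radial_cut n) x *\<^sub>R G x)
      + (k / 2) *\<^sub>R (LINT x|lebesgue_on unit_disk. radial_cut n x *\<^sub>R G x)
      = (LINT x|lebesgue_on unit_disk. radial_cut n x *\<^sub>R (\<Sum>b\<in>Basis. pd b \<psi> x * cnj (pd b \<xi> x)))"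
      unfolding green by (rule sym)
  qed
  ultimately show "(\<lambda>n. LINT x|lebesgue_on unit_disk. radial_cut n x *\<^sub>R (\<Sum>b\<in>Basis. pd b \<psi> x * cnj (pd b \<xi> x)))
      \<longlonglongrightarrow> of_real ((l\<^sup>2 / c\<^sup>2 + m\<^sup>2 / c\<^sup>2) / 2) * (LINT x|lebesgue_on unit_disk. \<psi> x * cnj (\<xi> x))"
    using Lim_transform_eventually by (force simp: G_def[abs_def] k_def scaleR_conv_of_real)
qed

text \<open>The integrals of \<open>|\<nabla>\<psi>|\<^sup>2\<close> against the cut-offs converge, so Fatou's lemma gives square
  integrability up to the circle.\<close>

lemma dirichlet_gradient_L2:
  assumes E: "dirichlet_eigenfunction c l \<psi>" and c: "c > 0" "l > 0" and b: "b \<in> Basis"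
  shows "pd b \<psi> \<in> L2_on unit_disk"
proof -
  define g where "g x = (\<Sum>b\<in>Basis. (norm (pd b \<psi> x))\<^sup>2)" for x
  note C2 = dirichlet_Ck[OF E]
  have cg: "continuous_on unit_disk g"
    unfolding g_def by (intro continuous_intros Ck_on_2D(5)[OF open_ball C2])
  have gm: "g \<in> borel_measurable (lebesgue_on unit_disk)" by (rule continuous_disk_measurable[OF cg])
  have g0: "g x \<ge> 0" for x unfolding g_def by (intro sum_nonneg) simp
  have gc: "(\<Sum>b\<in>Basis. pd b \<psi> x * cnj (pd b \<psi> x)) = of_real (g x)" for x
    unfolding g_def of_real_sum complex_norm_square ..
  define L where "L = Re (of_real ((l\<^sup>2 / c\<^sup>2 + l\<^sup>2 / c\<^sup>2) / 2) * (LINT x|lebesgue_on unit_disk. \<psi> x * cnj (\<psi> x)))"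
  have "(\<lambda>n. LINT x|lebesgue_on unit_disk. of_real (radial_cut n x * g x))
      \<longlonglongrightarrow> of_real ((l\<^sup>2 / c\<^sup>2 + l\<^sup>2 / c\<^sup>2) / 2) * (LINT x|lebesgue_on unit_disk. \<psi> x * cnj (\<psi> x))"
    using dirichlet_gradient_cut(2)[OF E E c c(2)] unfolding gc by (simp add: scaleR_conv_of_real)
  from tendsto_Re[OF this] have lim: "(\<lambda>n. LINT x|lebesgue_on unit_disk. radial_cut n x * g x) \<longlonglongrightarrow> L"
    unfolding L_def integral_complex_of_real Re_complex_of_real .
  have ev: "eventually (\<lambda>n. (\<integral>\<^sup>+x. ennreal (radial_cut n x * g x) \<partial>lebesgue_on unit_disk)
      = ennreal (LINT x|lebesgue_on unit_disk. radial_cut n x * g x)) sequentially"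
  proof (rule eventually_sequentiallyI[of 1])
    fix n :: nat assume "n \<ge> 1"
    then obtain K where K: "compact K" "K \<subseteq> ball (0::real^2) 1" "\<And>x. x \<notin> K \<Longrightarrow> radial_cut n x = 0"
      using cut_support by metis
    have cc: "continuous_on unit_disk (radial_cut n)"
      using Ck_on_continuous[OF Ck_on_cut] continuous_on_subset by blast
    have "integrable (lebesgue_on unit_disk) (\<lambda>x. radial_cut n x * g x)"
      by (rule integrable_on_compact_support[OF open_ball K(1,2)]) (auto intro!: continuous_intros cc cg simp: K(3))
    then show "(\<integral>\<^sup>+x. ennreal (radial_cut n x * g x) \<partial>lebesgue_on unit_disk)
      = ennreal (LINT x|lebesgue_on unit_disk. radial_cut n x * g x)"
      by (rule nn_integral_eq_integral) (auto intro!: mult_nonneg_nonneg cut_range g0)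
  qed
  have "(\<integral>\<^sup>+x. ennreal (g x) \<partial>lebesgue_on unit_disk)
      = (\<integral>\<^sup>+x. liminf (\<lambda>n. ennreal (radial_cut n x * g x)) \<partial>lebesgue_on unit_disk)"
  proof (rule nn_integral_cong)
    fix x :: "real^2" assume "x \<in> space (lebesgue_on unit_disk)"
    then have "x \<in> unit_disk" by simp
    from eventually_inside_shell[OF this]
    have "(\<lambda>n. ennreal (radial_cut n x * g x)) \<longlonglongrightarrow> ennreal (g x)"
      by (intro tendsto_eventually) (auto elim: eventually_mono)
    from lim_imp_Liminf[OF sequentially_bot this]
    show "ennreal (g x) = liminf (\<lambda>n. ennreal (radial_cut n x * g x))" by (rule sym)
  qed
  also have "\<dots> \<le> liminf (\<lambda>n. \<integral>\<^sup>+x. ennreal (radial_cut n x * g x) \<partial>lebesgue_on unit_disk)"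
  proof (rule nn_integral_liminf)
    fix n
    show "(\<lambda>x. ennreal (radial_cut n x * g x)) \<in> borel_measurable (lebesgue_on unit_disk)"
      using measurable_compose[OF borel_measurable_times[OF cut_measurable(1)[OF disk_sets] gm] measurable_ennreal] .
  qed
  also have "\<dots> = ennreal L"
  proof (rule lim_imp_Liminf[OF sequentially_bot])
    show "(\<lambda>n. \<integral>\<^sup>+x. ennreal (radial_cut n x * g x) \<partial>lebesgue_on unit_disk) \<longlonglongrightarrow> ennreal L"
      by (rule Lim_transform_eventually[OF tendsto_ennrealI[OF lim]]) (use ev in \<open>auto elim: eventually_mono\<close>)
  qed
  finally have "(\<integral>\<^sup>+x. ennreal (norm (g x)) \<partial>lebesgue_on unit_disk) < \<infinity>"
    using g0 le_less_trans[OF _ ennreal_less_top] by (simp add: infinity_ennreal_def)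
  then have "integrable (lebesgue_on unit_disk) g" by (rule integrableI_bounded[OF gm])
  moreover have pm: "pd b \<psi> \<in> borel_measurable (lebesgue_on unit_disk)"
    by (rule continuous_disk_measurable[OF Ck_on_2D(5)[OF open_ball C2 b]])
  have "integrable (lebesgue_on unit_disk) (\<lambda>x. (norm (pd b \<psi> x))\<^sup>2)"
  proof (rule Bochner_Integration.integrable_bound[OF calculation])
    show "(\<lambda>x. (norm (pd b \<psi> x))\<^sup>2) \<in> borel_measurable (lebesgue_on unit_disk)" using pm by measurable
    show "AE x in lebesgue_on unit_disk. norm ((norm (pd b \<psi> x))\<^sup>2) \<le> norm (g x)"
    proof (rule AE_I2)
      fix x
      have "(norm (pd b \<psi> x))\<^sup>2 \<le> g x" unfolding g_def using b by (intro member_le_sum) auto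
      then show "norm ((norm (pd b \<psi> x))\<^sup>2) \<le> norm (g x)" using g0[of x] by simp
    qed
  qed
  with pm show ?thesis by (simp add: L2_on_def)
qed

lemma dirichlet_gradient_inner:
  assumes E: "dirichlet_eigenfunction c l \<psi>" "dirichlet_eigenfunction c m \<xi>" and c: "c > 0" "l > 0" "m > 0"
  shows "(\<Sum>b\<in>Basis. LINT x|lebesgue_on unit_disk. pd b \<psi> x * cnj (pd b \<xi> x)) =
     of_real ((l\<^sup>2 / c\<^sup>2 + m\<^sup>2 / c\<^sup>2) / 2) * (LINT x|lebesgue_on unit_disk. \<psi> x * cnj (\<xi> x))"
proof -
  have i: "integrable (lebesgue_on unit_disk) (\<lambda>x. pd b \<psi> x * cnj (pd b \<xi> x))" if "b \<in> Basis" for b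
    using that c E by (intro L2_on_mult_integrable dirichlet_gradient_L2)
  then have "integrable (lebesgue_on unit_disk) (\<lambda>x. \<Sum>b\<in>Basis. pd b \<psi> x * cnj (pd b \<xi> x))"
    by (rule Bochner_Integration.integrable_sum)
  from LIMSEQ_unique[OF tendsto_integral_cut[OF this] dirichlet_gradient_cut(2)[OF E c]]
  show ?thesis by (subst (asm) Bochner_Integration.integral_sum[OF i])
qed

section \<open>Weak derivatives of Dirichlet series\<close>

lemma test_function_Ck: "\<eta> \<in> test_functions \<Omega> \<Longrightarrow> Ck_on k S \<eta>"
  unfolding test_functions_def using Ck_on_subset[of k UNIV \<eta> S] by auto

lemma test_function_support:
  assumes "\<eta> \<in> test_functions \<Omega>"
  obtains K where "compact K" "K \<subseteq> \<Omega>" "\<And>x. x \<notin> K \<Longrightarrow> \<eta> x = 0"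
proof (rule that)
  show "compact (closure {x. \<eta> x \<noteq> 0})" "closure {x. \<eta> x \<noteq> 0} \<subseteq> \<Omega>"
    using assms by (auto simp: test_functions_def)
  show "\<eta> x = 0" if "x \<notin> closure {x. \<eta> x \<noteq> 0}" for x
    using that closure_subset[of "{x. \<eta> x \<noteq> 0}"] by auto
qed

lemma compact_support_L2:
  fixes \<zeta> :: "'a::euclidean_space \<Rightarrow> real"
  assumes "open \<Omega>" "continuous_on \<Omega> \<zeta>" "compact K" "K \<subseteq> \<Omega>" "\<And>x. x \<notin> K \<Longrightarrow> \<zeta> x = 0"
  shows "(\<lambda>x. complex_of_real (\<zeta> x)) \<in> L2_on \<Omega>"
proof -
  have "integrable (lebesgue_on \<Omega>) (\<lambda>x. (\<zeta> x)\<^sup>2)"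
    using assms by (intro integrable_on_compact_support[OF assms(1,3,4)]) (auto intro!: continuous_intros)
  moreover have "\<zeta> \<in> borel_measurable (lebesgue_on \<Omega>)"
    using assms(1,2) by (intro continuous_imp_measurable_on_sets_lebesgue) auto
  ultimately show ?thesis by (simp add: L2_on_def)
qed

lemma test_function_L2:
  assumes "\<eta> \<in> test_functions \<Omega>" "open \<Omega>"
  shows "(\<lambda>x. complex_of_real (\<eta> x)) \<in> L2_on \<Omega>"
    and "b \<in> Basis \<Longrightarrow> (\<lambda>x. complex_of_real (pd b \<eta> x)) \<in> L2_on \<Omega>"
proof -
  obtain K where K: "compact K" "K \<subseteq> \<Omega>" "\<And>x. x \<notin> K \<Longrightarrow> \<eta> x = 0" by (rule test_function_support[OF assms(1)]) blast
  have C: "Ck_on (Suc 0) \<Omega> \<eta>" by (rule test_function_Ck[OF assms(1)])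
  show "(\<lambda>x. complex_of_real (\<eta> x)) \<in> L2_on \<Omega>"
    using K by (intro compact_support_L2[OF assms(2) Ck_on_continuous[OF C]])
  show "(\<lambda>x. complex_of_real (pd b \<eta> x)) \<in> L2_on \<Omega>" if b: "b \<in> Basis"
    using K(1,2) Ck_on_pd[OF C assms(2) b] pd_zero_outside[OF compact_imp_closed[OF K(1)] K(3)]
    by (intro compact_support_L2[OF assms(2)]) auto
qed

lemma weak_partial_C1:
  assumes "open \<Omega>" "Ck_on 1 \<Omega> g" "b \<in> Basis"
  shows "is_weak_partial \<Omega> b g (pd b g)"
  unfolding is_weak_partial_def
proof
  fix \<eta> assume t: "\<eta> \<in> test_functions \<Omega>"
  obtain K where K: "compact K" "K \<subseteq> \<Omega>" "\<And>x. x \<notin> K \<Longrightarrow> \<eta> x = 0" by (rule test_function_support[OF t]) blast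
  show "(LINT x|lebesgue_on \<Omega>. pd b \<eta> x *\<^sub>R g x) = - (LINT x|lebesgue_on \<Omega>. \<eta> x *\<^sub>R pd b g x)"
    by (rule integration_by_parts(3)[OF assms(1) K test_function_Ck[OF t] assms(2,3)])
qed

text \<open>Both sides of the identity that defines a weak derivative are \<open>L\<^sup>2\<close> pairings with a fixed
  function, so they pass to the limit.\<close>

lemma weak_partial_limit:
  assumes o: "open \<Omega>" and b: "b \<in> Basis"
    and S: "\<And>n. S n \<in> L2_on \<Omega>" "g \<in> L2_on \<Omega>" "(\<lambda>n. L2_norm \<Omega> (\<lambda>x. S n x - g x)) \<longlonglongrightarrow> 0"
    and D: "\<And>n. D n \<in> L2_on \<Omega>" "h \<in> L2_on \<Omega>" "(\<lambda>n. L2_norm \<Omega> (\<lambda>x. D n x - h x)) \<longlonglongrightarrow> 0"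
    and w: "\<And>n. is_weak_partial \<Omega> b (S n) (D n)"
  shows "is_weak_partial \<Omega> b g h"
  unfolding is_weak_partial_def
proof
  fix \<eta> assume t: "\<eta> \<in> test_functions \<Omega>"
  have 1: "(\<lambda>n. LINT x|lebesgue_on \<Omega>. S n x * cnj (complex_of_real (pd b \<eta> x))) \<longlonglongrightarrow>
      (LINT x|lebesgue_on \<Omega>. g x * cnj (complex_of_real (pd b \<eta> x)))"
    by (rule L2_pairing_tendsto[OF S test_function_L2(2)[OF t o b]])
  have 2: "(\<lambda>n. LINT x|lebesgue_on \<Omega>. D n x * cnj (complex_of_real (\<eta> x))) \<longlonglongrightarrow>
      (LINT x|lebesgue_on \<Omega>. h x * cnj (complex_of_real (\<eta> x)))"
    by (rule L2_pairing_tendsto[OF D test_function_L2(1)[OF t o]])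
  have 3: "(LINT x|lebesgue_on \<Omega>. S n x * cnj (complex_of_real (pd b \<eta> x)))
      = - (LINT x|lebesgue_on \<Omega>. D n x * cnj (complex_of_real (\<eta> x)))" for n
    using w[of n, unfolded is_weak_partial_def, rule_format, OF t]
    by (simp add: scaleR_conv_of_real mult.commute)
  have "(LINT x|lebesgue_on \<Omega>. g x * cnj (complex_of_real (pd b \<eta> x)))
      = - (LINT x|lebesgue_on \<Omega>. h x * cnj (complex_of_real (\<eta> x)))"
    by (rule LIMSEQ_unique[OF 1[unfolded 3] tendsto_minus[OF 2]])
  then show "(LINT x|lebesgue_on \<Omega>. pd b \<eta> x *\<^sub>R g x) = - (LINT x|lebesgue_on \<Omega>. \<eta> x *\<^sub>R h x)"
    by (simp add: scaleR_conv_of_real mult.commute)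
qed

lemma inner_c_eq: "inner_c c g h = of_real (1 / c\<^sup>2) * (LINT x|lebesgue_on unit_disk. g x * cnj (h x))"
  unfolding inner_c_def by (simp add: mult.assoc)

lemma dirichlet_basisD:
  assumes "dirichlet_basis c \<psi> nu"
  shows "dirichlet_eigenfunction c (nu k) (\<psi> k)" "nu k > 0" "orthonormal_basis_c c \<psi>" "\<psi> k \<in> L2_on unit_disk"
  using assms by (auto simp: dirichlet_basis_def orthonormal_basis_c_def)

lemma dirichlet_basis_nu_ge:
  assumes B: "dirichlet_basis c \<psi> nu" and c: "c > 0"
  shows "2 * c \<le> nu k"
proof -
  obtain C where "2 * c \<le> nu k \<or> (\<forall>x\<in>cball 0 1. \<psi> k x = 0)"
    using dirichlet_bounds[OF dirichlet_basisD(1)[OF B] c dirichlet_basisD(2)[OF B]] by metis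
  moreover have False if z: "\<forall>x\<in>cball 0 1. \<psi> k x = 0"
  proof -
    have "(LINT x|lebesgue_on unit_disk. \<psi> k x * cnj (\<psi> k x)) = (LINT x|lebesgue_on unit_disk. 0)"
      using z by (intro Bochner_Integration.integral_cong) auto
    then have "inner_c c (\<psi> k) (\<psi> k) = 0" by (simp add: inner_c_eq)
    moreover have "inner_c c (\<psi> k) (\<psi> k) = 1"
      using dirichlet_basisD(3)[OF B] by (simp add: orthonormal_basis_c_def)
    ultimately show False by simp
  qed
  ultimately show ?thesis by blast
qed

lemma sum_expand_norm_sq:
  assumes g: "\<And>k. k \<in> I \<Longrightarrow> g k \<in> L2_on \<Omega>" and "finite I"
  shows "of_real ((L2_norm \<Omega> (\<lambda>x. \<Sum>k\<in>I. a k * g k x))\<^sup>2) =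
    (\<Sum>j\<in>I. \<Sum>k\<in>I. a j * cnj (a k) * (LINT x|lebesgue_on \<Omega>. g j x * cnj (g k x)))"
proof -
  have i: "integrable (lebesgue_on \<Omega>) (\<lambda>x. a j * cnj (a k) * (g j x * cnj (g k x)))" if "j \<in> I" "k \<in> I" for j k
    using L2_on_mult_integrable[OF g g] that by auto
  have "of_real ((L2_norm \<Omega> (\<lambda>x. \<Sum>k\<in>I. a k * g k x))\<^sup>2) =
      (LINT x|lebesgue_on \<Omega>. complex_of_real ((norm (\<Sum>k\<in>I. a k * g k x))\<^sup>2))"
    unfolding L2_norm_sq by (rule integral_complex_of_real[symmetric])
  also have "\<dots> = (LINT x|lebesgue_on \<Omega>. (\<Sum>j\<in>I. \<Sum>k\<in>I. a j * cnj (a k) * (g j x * cnj (g k x))))"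
    unfolding complex_norm_square
    by (intro Bochner_Integration.integral_cong refl) (simp add: sum_product algebra_simps)
  also have "\<dots> = (\<Sum>j\<in>I. \<Sum>k\<in>I. a j * cnj (a k) * (LINT x|lebesgue_on \<Omega>. g j x * cnj (g k x)))"
    using i by (simp add: Bochner_Integration.integral_sum Bochner_Integration.integrable_sum cong: sum.cong)
  finally show ?thesis .
qed

lemma orthonormal_sum_norm:
  assumes B: "orthonormal_basis_c c e" and c: "c > 0" and I: "finite I"
  shows "(L2_norm unit_disk (\<lambda>x. \<Sum>k\<in>I. a k * e k x))\<^sup>2 = c\<^sup>2 * (\<Sum>k\<in>I. (norm (a k))\<^sup>2)"
proof -
  have ip: "(LINT x|lebesgue_on unit_disk. e j x * cnj (e k x)) = (if j = k then of_real (c\<^sup>2) else 0)" for j k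
    using B c unfolding orthonormal_basis_c_def inner_c_eq by (auto simp: field_simps split: if_splits)
  have "complex_of_real ((L2_norm unit_disk (\<lambda>x. \<Sum>k\<in>I. a k * e k x))\<^sup>2) =
      (\<Sum>j\<in>I. \<Sum>k\<in>I. a j * cnj (a k) * (if j = k then of_real (c\<^sup>2) else 0))"
    unfolding ip[symmetric] using B by (intro sum_expand_norm_sq I) (auto simp: orthonormal_basis_c_def)
  also have "\<dots> = (\<Sum>j\<in>I. a j * cnj (a j) * of_real (c\<^sup>2))"
    using I by (simp add: if_distrib[of "\<lambda>z. _ * z"] cong: if_cong)
  also have "\<dots> = complex_of_real (c\<^sup>2 * (\<Sum>k\<in>I. (norm (a k))\<^sup>2))"
    by (simp add: complex_norm_square sum_distrib_left mult.commute del: of_real_power)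
  finally show ?thesis by (simp only: of_real_eq_iff)
qed

text \<open>The factor \<open>nu\<^sup>2/c\<^sup>2\<close> of Green's formula cancels the weight \<open>c\<^sup>-\<^sup>2\<close> in the normalization of the
  basis.\<close>

lemma dirichlet_gradient_sum_norm:
  assumes B: "dirichlet_basis c \<psi> nu" and c: "c > 0" and I: "finite I"
  shows "(\<Sum>b\<in>Basis. (L2_norm unit_disk (\<lambda>x. \<Sum>k\<in>I. a k * pd b (\<psi> k) x))\<^sup>2) = (\<Sum>k\<in>I. (nu k)\<^sup>2 * (norm (a k))\<^sup>2)"
proof -
  have ip: "(\<Sum>b\<in>Basis. LINT x|lebesgue_on unit_disk. pd b (\<psi> j) x * cnj (pd b (\<psi> k) x)) =
      (if j = k then of_real ((nu k)\<^sup>2) else 0)" for j k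
  proof -
    have "(LINT x|lebesgue_on unit_disk. \<psi> j x * cnj (\<psi> k x)) = (if j = k then of_real (c\<^sup>2) else 0)"
      using dirichlet_basisD(3)[OF B] c unfolding orthonormal_basis_c_def inner_c_eq
      by (auto simp: field_simps split: if_splits)
    then show ?thesis
      using c by (simp add: dirichlet_gradient_inner[OF dirichlet_basisD(1)[OF B] dirichlet_basisD(1)[OF B]
          c dirichlet_basisD(2)[OF B] dirichlet_basisD(2)[OF B]])
  qed
  have "complex_of_real (\<Sum>b\<in>Basis. (L2_norm unit_disk (\<lambda>x. \<Sum>k\<in>I. a k * pd b (\<psi> k) x))\<^sup>2) =
      (\<Sum>b\<in>Basis. \<Sum>j\<in>I. \<Sum>k\<in>I. a j * cnj (a k) * (LINT x|lebesgue_on unit_disk. pd b (\<psi> j) x * cnj (pd b (\<psi> k) x)))"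
    unfolding of_real_sum
    by (intro sum.cong refl sum_expand_norm_sq I dirichlet_gradient_L2[OF dirichlet_basisD(1)[OF B] c dirichlet_basisD(2)[OF B]])
  also have "\<dots> = (\<Sum>j\<in>I. \<Sum>k\<in>I. \<Sum>b\<in>Basis. a j * cnj (a k) * (LINT x|lebesgue_on unit_disk. pd b (\<psi> j) x * cnj (pd b (\<psi> k) x)))"
    by (subst sum.swap, intro sum.cong refl, subst sum.swap) simp
  also have "\<dots> = (\<Sum>j\<in>I. \<Sum>k\<in>I. a j * cnj (a k) * (if j = k then of_real ((nu k)\<^sup>2) else 0))"
    unfolding sum_distrib_left[symmetric] ip ..
  also have "\<dots> = (\<Sum>j\<in>I. a j * cnj (a j) * of_real ((nu j)\<^sup>2))"
    using I by (simp add: if_distrib[of "\<lambda>z. _ * z"] cong: if_cong)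
  also have "\<dots> = complex_of_real (\<Sum>k\<in>I. (nu k)\<^sup>2 * (norm (a k))\<^sup>2)"
    by (simp add: complex_norm_square mult.commute del: of_real_power)
  finally show ?thesis by (simp only: of_real_eq_iff)
qed

text \<open>Bounded energy makes the differentiated partial sums a Cauchy sequence in \<open>L\<^sup>2\<close>, whose limit is
  the weak derivative of the sum.\<close>

lemma dirichlet_series_H1:
  assumes B: "dirichlet_basis c \<psi> nu" and c: "c > 0"
    and w: "L2_sums unit_disk (\<lambda>k x. a k * \<psi> k x) w"
    and E: "\<And>K. (\<Sum>k<K. (nu k)\<^sup>2 * (norm (a k))\<^sup>2) \<le> E"
  obtains W where "\<And>b. b \<in> Basis \<Longrightarrow> W b \<in> L2_on unit_disk"
    "\<And>b. b \<in> Basis \<Longrightarrow> is_weak_partial unit_disk b w (W b)"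
    "(L2_norm unit_disk w)\<^sup>2 + (\<Sum>b\<in>Basis. (L2_norm unit_disk (W b))\<^sup>2) \<le> 2 * E"
proof -
  have wL: "w \<in> L2_on unit_disk" using w by (simp add: L2_sums_def)
  have E0: "0 \<le> E" using E[of 0] by simp
  have d: "pd b (\<psi> k) \<in> L2_on unit_disk" if "b \<in> Basis" for b k
    using dirichlet_gradient_L2[OF dirichlet_basisD(1)[OF B] c dirichlet_basisD(2)[OF B] that] .
  define S where "S b N x = (\<Sum>k<N. a k * pd b (\<psi> k) x)" for b N x
  have SL: "S b N \<in> L2_on unit_disk" if "b \<in> Basis" for b N
    unfolding S_def using d[OF that] by (intro L2_on_sum L2_on_scale)
  have "summable (\<lambda>k. (nu k)\<^sup>2 * (norm (a k))\<^sup>2)"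
    using E by (intro summableI_nonneg_bounded[of _ E]) auto
  then have Cau: "\<exists>N. \<forall>m\<ge>N. \<forall>n. (\<Sum>k\<in>{m..<n}. (nu k)\<^sup>2 * (norm (a k))\<^sup>2) < e" if e0: "e > 0" for e
  proof -
    obtain N where "\<forall>m\<ge>N. \<forall>n. norm (\<Sum>k\<in>{m..<n}. (nu k)\<^sup>2 * (norm (a k))\<^sup>2) < e"
      using \<open>summable _\<close>[unfolded summable_Cauchy, rule_format, OF e0] by blast
    moreover have "norm (\<Sum>k\<in>{m..<n}. (nu k)\<^sup>2 * (norm (a k))\<^sup>2) = (\<Sum>k\<in>{m..<n}. (nu k)\<^sup>2 * (norm (a k))\<^sup>2)" for m n
      by (simp add: sum_nonneg)
    ultimately show ?thesis by auto
  qed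
  have diffb: "L2_norm unit_disk (\<lambda>x. S b n x - S b m x) \<le> sqrt (\<Sum>k\<in>{m..<n}. (nu k)\<^sup>2 * (norm (a k))\<^sup>2)"
    if b: "b \<in> Basis" and "m \<le> n" for b m n
  proof -
    have "S b n x - S b m x = (\<Sum>k\<in>{m..<n}. a k * pd b (\<psi> k) x)" for x
      using sum_diff_nat_ivl[of 0 m n "\<lambda>k. a k * pd b (\<psi> k) x"] \<open>m \<le> n\<close>
      by (simp add: S_def atLeast0LessThan)
    then have "(L2_norm unit_disk (\<lambda>x. S b n x - S b m x))\<^sup>2 =
        (L2_norm unit_disk (\<lambda>x. \<Sum>k\<in>{m..<n}. a k * pd b (\<psi> k) x))\<^sup>2" by simp
    also have "\<dots> \<le> (\<Sum>b\<in>Basis. (L2_norm unit_disk (\<lambda>x. \<Sum>k\<in>{m..<n}. a k * pd b (\<psi> k) x))\<^sup>2)"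
      using b by (intro member_le_sum) auto
    also have "\<dots> = (\<Sum>k\<in>{m..<n}. (nu k)\<^sup>2 * (norm (a k))\<^sup>2)"
      by (rule dirichlet_gradient_sum_norm[OF B c]) simp
    finally show ?thesis by (rule real_le_rsqrt)
  qed
  have "\<exists>W. W \<in> L2_on unit_disk \<and> (\<lambda>n. L2_norm unit_disk (\<lambda>x. S b n x - W x)) \<longlonglongrightarrow> 0" if b: "b \<in> Basis" for b
  proof -
    have "\<exists>N. \<forall>m\<ge>N. \<forall>n\<ge>N. L2_norm unit_disk (\<lambda>x. S b m x - S b n x) \<le> e" if e0: "e > 0" for e
    proof -
      obtain N where N: "\<forall>m\<ge>N. \<forall>n. (\<Sum>k\<in>{m..<n}. (nu k)\<^sup>2 * (norm (a k))\<^sup>2) < e\<^sup>2"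
        using Cau[of "e\<^sup>2"] zero_less_power[OF e0] by blast
      have *: "L2_norm unit_disk (\<lambda>x. S b n x - S b m x) \<le> e" if mn: "N \<le> m" "m \<le> n" for m n
      proof -
        have "sqrt (\<Sum>k\<in>{m..<n}. (nu k)\<^sup>2 * (norm (a k))\<^sup>2) \<le> e"
          using N mn e0 by (intro real_le_lsqrt) (auto intro: less_imp_le)
        then show ?thesis using diffb[OF b mn(2)] by linarith
      qed
      have "L2_norm unit_disk (\<lambda>x. S b m x - S b n x) \<le> e" if "N \<le> m" "N \<le> n" for m n
      proof (cases "m \<le> n")
        case True
        show ?thesis unfolding L2_norm_minus_commute[of unit_disk "S b m" "S b n"] by (rule *[OF that(1) True])
      next
        case False
        then show ?thesis by (intro *[OF that(2)]) simp
      qed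
      then show ?thesis by blast
    qed
    from Riesz_Fischer[OF SL[OF b] this] obtain W where
      "W \<in> L2_on unit_disk" "(\<lambda>n. L2_norm unit_disk (\<lambda>x. S b n x - W x)) \<longlonglongrightarrow> 0" .
    then show ?thesis by blast
  qed
  then have "\<forall>b\<in>Basis. \<exists>W. W \<in> L2_on unit_disk \<and> (\<lambda>n. L2_norm unit_disk (\<lambda>x. S b n x - W x)) \<longlonglongrightarrow> 0"
    by blast
  from bchoice[OF this] obtain W where W: "\<And>b. b \<in> Basis \<Longrightarrow> W b \<in> L2_on unit_disk"
     "\<And>b. b \<in> Basis \<Longrightarrow> (\<lambda>n. L2_norm unit_disk (\<lambda>x. S b n x - W b x)) \<longlonglongrightarrow> 0"
    by blast
  define P where "P N x = (\<Sum>k<N. a k * \<psi> k x)" for N x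
  have PL: "P N \<in> L2_on unit_disk" for N
    unfolding P_def by (intro L2_on_sum L2_on_scale dirichlet_basisD(4)[OF B])
  have Pw: "(\<lambda>N. L2_norm unit_disk (\<lambda>x. P N x - w x)) \<longlonglongrightarrow> 0" using w by (simp add: L2_sums_def P_def)
  have C1: "Ck_on 1 unit_disk (\<psi> k)" for k
    by (rule Ck_on_2D(1)[OF open_ball dirichlet_Ck[OF dirichlet_basisD(1)[OF B]]])
  have PC: "Ck_on 1 unit_disk (P N) \<and> (\<forall>x\<in>unit_disk. pd b (P N) x = S b N x)" if b: "b \<in> Basis" for b N
  proof (induction N)
    case 0
    then show ?case by (simp add: P_def[abs_def] S_def Ck_on_const pdI[OF has_derivative_const])
  next
    case (Suc N)
    have e: "P (Suc N) = (\<lambda>x. P N x + a N * \<psi> N x)" by (auto simp: P_def)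
    have t: "Ck_on 1 unit_disk (\<lambda>x. a N * \<psi> N x)" by (intro Ck_on_mult Ck_on_const C1 open_ball)
    have "pd b (P (Suc N)) x = S b (Suc N) x" if x: "x \<in> unit_disk" for x
    proof -
      have "pd b (P (Suc N)) x = pd b (P N) x + pd b (\<lambda>x. a N * \<psi> N x) x"
        unfolding e using Suc t x
        by (intro pd_add Ck_on_differentiable[of 0 unit_disk]) simp_all
      also have "pd b (\<lambda>x. a N * \<psi> N x) x = a N * pd b (\<psi> N) x"
        by (rule pd_bounded_linear[OF bounded_linear_mult_right
            Ck_on_2D(2)[OF open_ball dirichlet_Ck[OF dirichlet_basisD(1)[OF B]] x]])
      finally show ?thesis using Suc x by (simp add: S_def)
    qed
    then show ?case using Suc t by (auto simp: e intro!: Ck_on_add)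
  qed
  have Pwp: "is_weak_partial unit_disk b (P N) (S b N)" if b: "b \<in> Basis" for b N
  proof -
    have "(LINT x|lebesgue_on unit_disk. \<eta> x *\<^sub>R pd b (P N) x) = (LINT x|lebesgue_on unit_disk. \<eta> x *\<^sub>R S b N x)" for \<eta> :: "real^2 \<Rightarrow> real"
      using PC[OF b, of N] by (intro Bochner_Integration.integral_cong) auto
    then show ?thesis
      using weak_partial_C1[OF open_ball conjunct1[OF PC[OF b, of N]] b] by (simp add: is_weak_partial_def)
  qed
  have "is_weak_partial unit_disk b w (W b)" if b: "b \<in> Basis" for b
    by (rule weak_partial_limit[OF open_ball b PL wL Pw SL[OF b] W(1)[OF b] W(2)[OF b] Pwp[OF b]])
  moreover have "(\<Sum>b\<in>Basis. (L2_norm unit_disk (W b))\<^sup>2) \<le> E"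
  proof (rule LIMSEQ_le_const2)
    show "(\<lambda>n. \<Sum>b\<in>Basis. (L2_norm unit_disk (S b n))\<^sup>2) \<longlonglongrightarrow> (\<Sum>b\<in>Basis. (L2_norm unit_disk (W b))\<^sup>2)"
      by (intro tendsto_sum tendsto_power L2_norm_tendsto SL W)
    show "\<exists>N. \<forall>n\<ge>N. (\<Sum>b\<in>Basis. (L2_norm unit_disk (S b n))\<^sup>2) \<le> E"
      using E dirichlet_gradient_sum_norm[OF B c finite_lessThan] by (simp add: S_def[abs_def])
  qed
  moreover have "(L2_norm unit_disk w)\<^sup>2 \<le> E"
  proof (rule LIMSEQ_le_const2)
    show "(\<lambda>n. (L2_norm unit_disk (P n))\<^sup>2) \<longlonglongrightarrow> (L2_norm unit_disk w)\<^sup>2"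
      by (intro tendsto_power L2_norm_tendsto PL wL Pw)
    show "\<exists>N. \<forall>n\<ge>N. (L2_norm unit_disk (P n))\<^sup>2 \<le> E"
    proof (intro exI allI impI)
      fix n
      have "(L2_norm unit_disk (P n))\<^sup>2 = c\<^sup>2 * (\<Sum>k<n. (norm (a k))\<^sup>2)"
        unfolding P_def by (rule orthonormal_sum_norm[OF dirichlet_basisD(3)[OF B] c]) simp
      also have "\<dots> = (\<Sum>k<n. c\<^sup>2 * (norm (a k))\<^sup>2)" by (rule sum_distrib_left)
      also have "\<dots> \<le> (\<Sum>k<n. (nu k)\<^sup>2 * (norm (a k))\<^sup>2)"
      proof (intro sum_mono mult_right_mono power_mono)
        show "c \<le> nu k" for k using dirichlet_basis_nu_ge[OF B c, of k] c by linarith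
      qed (use c in auto)
      also have "\<dots> \<le> E" by (rule E)
      finally show "(L2_norm unit_disk (P n))\<^sup>2 \<le> E" .
    qed
  qed
  ultimately show ?thesis by (intro that[of W] W(1)) (assumption, assumption, linarith)
qed

section \<open>Neumann against Dirichlet eigenfunctions\<close>

lemma neumann_Ck: "neumann_eigenfunction c l \<phi> \<Longrightarrow> Ck_on 2 unit_disk \<phi>"
  by (simp add: neumann_eigenfunction_def)

lemma neumann_lap:
  assumes "neumann_eigenfunction c l \<phi>" "x \<in> unit_disk"
  shows "lap \<phi> x = - of_real (l\<^sup>2 / c\<^sup>2) * \<phi> x"
  using assms by (intro eigenfunction_lap) (auto simp: neumann_eigenfunction_def)

text \<open>The Neumann condition refers to some derivative within the closed disk; in the radial direction
  it agrees with the continuous one, since the radius approaches the boundary point from inside.\<close>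

lemma neumann_radial:
  assumes E: "neumann_eigenfunction c l \<phi>"
  obtains R B where "continuous_on (cball 0 1) R" "\<And>z. z \<in> sphere 0 1 \<Longrightarrow> R z = 0"
    "\<And>x. x \<in> unit_disk \<Longrightarrow> pd x \<phi> x = R x"
    "\<And>b x. b \<in> Basis \<Longrightarrow> x \<in> unit_disk \<Longrightarrow> norm (pd b \<phi> x) \<le> B" "\<And>x. x \<in> unit_disk \<Longrightarrow> norm (\<phi> x) \<le> B"
proof -
  have "Ck_on (Suc 0) (cball 0 1) \<phi>" using E by (simp add: neumann_eigenfunction_def)
  then obtain f' where f': "\<And>x. x \<in> cball 0 1 \<Longrightarrow> (\<phi> has_derivative f' x) (at x within cball 0 1)"
    and cf: "\<And>b. b \<in> Basis \<Longrightarrow> continuous_on (cball 0 1) (\<lambda>x. f' x b)"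
    unfolding Ck_on.simps by blast
  have cphi: "continuous_on (cball 0 1) \<phi>"
    unfolding continuous_on_eq_continuous_within using f' has_derivative_continuous by blast
  have int: "(\<phi> has_derivative f' x) (at x)" if "x \<in> unit_disk" for x
  proof -
    have "(\<phi> has_derivative f' x) (at x within unit_disk)"
      using f'[of x] that by (auto intro: has_derivative_subset)
    then show ?thesis using that by (simp add: at_within_open[OF that open_ball])
  qed
  define R where "R x = (\<Sum>b\<in>Basis. (x \<bullet> b) *\<^sub>R f' x b)" for x
  have R: "f' x x = R x" if "x \<in> cball 0 1" for x
  proof -
    interpret f': bounded_linear "f' x" using f'[OF that] by (rule has_derivative_bounded_linear)
    have "f' x x = f' x (\<Sum>b\<in>Basis. (x \<bullet> b) *\<^sub>R b)" by (simp add: euclidean_representation)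
    then show ?thesis by (simp add: R_def f'.sum f'.scaleR)
  qed
  have "continuous_on (cball 0 1) R" unfolding R_def by (intro continuous_intros cf)
  moreover have "R z = 0" if z: "z \<in> sphere 0 1" for z
  proof -
    have z': "z \<in> cball 0 1" using z by simp
    define F where "F = frechet_derivative \<phi> (at z within cball 0 1)"
    have F: "(\<phi> has_derivative F) (at z within cball 0 1)"
      unfolding F_def using f'[OF z'] frechet_derivative_works differentiableI by blast
    have F0: "F z = 0"
      using E z by (auto simp: neumann_eigenfunction_def partial_within_def F_def)
    have path: "((\<lambda>t. \<phi> (t *\<^sub>R z)) has_vector_derivative D z) (at 1 within {0..1})"
      if D: "(\<phi> has_derivative D) (at z within cball 0 1)" for D
    proof -
      have l: "((\<lambda>t. t *\<^sub>R z) has_derivative (\<lambda>h. h *\<^sub>R z)) (at 1 within {0..1})"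
        by (auto intro!: derivative_eq_intros)
      have "(\<phi> has_derivative D) (at (1 *\<^sub>R z) within (\<lambda>t. t *\<^sub>R z) ` {0..1})"
        using D z by (auto intro!: has_derivative_subset[OF D] mult_le_one)
      from has_derivative_in_compose[OF l this]
      have "((\<lambda>t. \<phi> (t *\<^sub>R z)) has_derivative (\<lambda>h. D (h *\<^sub>R z))) (at 1 within {0..1})" .
      moreover have "D (h *\<^sub>R z) = h *\<^sub>R D z" for h
        using linear_scale[OF has_derivative_linear[OF D]] .
      ultimately show ?thesis by (simp add: has_vector_derivative_def)
    qed
    have "f' z z = F z"
      using path[OF f'[OF z']] path[OF F]
      by (intro vector_derivative_unique_within[where x=1 and S="{0..1}"])
        (auto simp: trivial_limit_within islimpt_Icc)
    then show ?thesis using R[OF z'] F0 by simp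
  qed
  moreover have "pd x \<phi> x = R x" if "x \<in> unit_disk" for x
    using pdI[OF int[OF that], of x] R[of x] that by simp
  moreover obtain B where "\<And>b x. b \<in> Basis \<Longrightarrow> x \<in> unit_disk \<Longrightarrow> norm (pd b \<phi> x) \<le> B" "\<And>x. x \<in> unit_disk \<Longrightarrow> norm (\<phi> x) \<le> B"
  proof -
    define g where "g x = norm (\<phi> x) + (\<Sum>b\<in>Basis. norm (f' x b))" for x
    have "continuous_on (cball 0 1) g" unfolding g_def by (intro continuous_intros cf cphi)
    then have "bounded (g ` cball 0 1)" by (intro compact_imp_bounded compact_continuous_image compact_cball)
    then obtain B where B: "\<And>x. x \<in> cball 0 1 \<Longrightarrow> norm (g x) \<le> B"
      unfolding bounded_iff by blast
    show ?thesis
    proof (rule that)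
      fix x :: "real^2" assume x: "x \<in> unit_disk"
      then have "x \<in> cball 0 1" by simp
      from B[OF this] have gB: "g x \<le> B" by simp
      have "0 \<le> (\<Sum>b\<in>Basis. norm (f' x b))" by (intro sum_nonneg) simp
      then show "norm (\<phi> x) \<le> B" using gB unfolding g_def by linarith
      fix b :: "real^2" assume b: "b \<in> Basis"
      have "norm (f' x b) \<le> (\<Sum>b\<in>Basis. norm (f' x b))" using b by (intro member_le_sum) auto
      then show "norm (pd b \<phi> x) \<le> B"
        using gB norm_ge_zero[of "\<phi> x"] unfolding g_def pdI[OF int[OF x], of b] by linarith
    qed
  qed
  ultimately show ?thesis using that by blast
qed

lemma pd_dilation:
  assumes "f differentiable (at (s *\<^sub>R x))"
  shows "pd b (\<lambda>x. f (s *\<^sub>R x)) x = s *\<^sub>R pd b f (s *\<^sub>R x)" and "(\<lambda>x. f (s *\<^sub>R x)) differentiable (at x)"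
proof -
  note d = has_derivative_pd[OF assms]
  have l: "((\<lambda>x. s *\<^sub>R x) has_derivative (\<lambda>h. s *\<^sub>R h)) (at x)" by (auto intro!: derivative_eq_intros)
  have *: "((\<lambda>x. f (s *\<^sub>R x)) has_derivative (\<lambda>h. pd (s *\<^sub>R h) f (s *\<^sub>R x))) (at x)"
    by (rule has_derivative_compose[OF l d])
  show "(\<lambda>x. f (s *\<^sub>R x)) differentiable (at x)" using * by (rule differentiableI)
  show "pd b (\<lambda>x. f (s *\<^sub>R x)) x = s *\<^sub>R pd b f (s *\<^sub>R x)"
    using pdI[OF *, of b] linear_scale[OF has_derivative_linear[OF d]] by simp
qed

lemma dilation_in_disk:
  fixes x :: "'a::euclidean_space"
  shows "0 \<le> s \<Longrightarrow> s \<le> 1 \<Longrightarrow> x \<in> ball 0 1 \<Longrightarrow> s *\<^sub>R x \<in> ball 0 1"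
  using mult_left_le_one_le[of "norm x" s] by simp

lemma Ck_on_dilation:
  assumes s: "0 \<le> s" "s \<le> 1"
  shows "Ck_on k (ball 0 1) f \<Longrightarrow> Ck_on k (ball 0 1) (\<lambda>x. f (s *\<^sub>R x))"
proof (induction k arbitrary: f)
  case 0
  have "continuous_on (ball 0 1) (\<lambda>x::'a. s *\<^sub>R x)" by (intro continuous_intros)
  moreover have "(\<lambda>x::'a. s *\<^sub>R x) ` ball 0 1 \<subseteq> ball 0 1"
    by (rule image_subsetI) (rule dilation_in_disk[OF s])
  ultimately show ?case
    using 0 continuous_on_compose2[of "ball 0 1" f "ball 0 1" "\<lambda>x. s *\<^sub>R x"] by simp
next
  case (Suc k)
  have d: "f differentiable (at (s *\<^sub>R x))" if "x \<in> ball 0 1" for x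
    using Ck_on_differentiable[OF Suc.prems open_ball dilation_in_disk[OF s that]] .
  have "Ck_on k (ball 0 1) (pd b (\<lambda>x. f (s *\<^sub>R x)))" if b: "b \<in> Basis" for b
  proof -
    have "Ck_on k (ball 0 1) (\<lambda>x. s *\<^sub>R pd b f (s *\<^sub>R x))"
      by (intro Ck_on_scaleR Ck_on_const open_ball Suc.IH Ck_on_pd[OF Suc.prems open_ball b])
    then show ?thesis
      by (subst Ck_on_cong[where g="\<lambda>x. s *\<^sub>R pd b f (s *\<^sub>R x)"]) (auto intro!: pd_dilation d)
  qed
  then show ?case by (auto simp: Ck_on_Suc_open intro!: pd_dilation(2) d)
qed

lemma lap_dilation:
  assumes s: "0 \<le> s" "s \<le> 1" and f: "Ck_on 2 (ball 0 1) f" and x: "x \<in> ball 0 1"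
  shows "lap (\<lambda>x. f (s *\<^sub>R x)) x = s\<^sup>2 *\<^sub>R lap f (s *\<^sub>R x)"
  unfolding laplacian_on_def scaleR_sum_right
proof (rule sum.cong)
  fix b :: 'a assume b: "b \<in> Basis"
  have "pd b (pd b (\<lambda>x. f (s *\<^sub>R x))) x = pd b (\<lambda>x. s *\<^sub>R pd b f (s *\<^sub>R x)) x"
    by (rule pd_cong_open[OF open_ball x]) (rule pd_dilation Ck_on_2D(2)[OF open_ball f] dilation_in_disk[OF s] | assumption)+
  also have "\<dots> = s *\<^sub>R pd b (\<lambda>x. pd b f (s *\<^sub>R x)) x"
    by (rule pd_bounded_linear[OF bounded_linear_scaleR_right])
      (rule pd_dilation(2), rule Ck_on_2D(4)[OF open_ball f b dilation_in_disk[OF s x]])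
  also have "\<dots> = s\<^sup>2 *\<^sub>R pd b (pd b f) (s *\<^sub>R x)"
    by (subst pd_dilation(1), rule Ck_on_2D(4)[OF open_ball f b dilation_in_disk[OF s x]])
      (simp add: power2_eq_square)
  finally show "pd b (pd b (\<lambda>x. f (s *\<^sub>R x))) x = s\<^sup>2 *\<^sub>R pd b (pd b f) (s *\<^sub>R x)" .
qed simp

text \<open>Green's second formula for \<open>\<psi>\<close> vanishing on the circle: the boundary term is bounded by the
  boundary values of \<open>h\<close>, since \<open>|\<psi>| \<le> C (1 - |x|\<^sup>2)\<close>.\<close>

lemma Green_second_bound:
  fixes \<psi> h :: "real^2 \<Rightarrow> complex"
  assumes C2: "Ck_on 2 unit_disk \<psi>" "Ck_on 2 unit_disk h"
    and psi: "\<And>x. x \<in> unit_disk \<Longrightarrow> norm (\<psi> x) \<le> C * (1 - x \<bullet> x)" "C \<ge> 0"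
    and grad: "\<And>b x. b \<in> Basis \<Longrightarrow> x \<in> unit_disk \<Longrightarrow> norm (pd b h x) \<le> B"
    and i: "integrable (lebesgue_on unit_disk) (\<lambda>x. \<psi> x * lap h x - lap \<psi> x * h x)"
    and e: "\<epsilon> \<ge> 0" and r: "r < 1" and h: "\<And>x. x \<in> unit_disk \<Longrightarrow> r < norm x \<Longrightarrow> norm (h x) \<le> \<epsilon>"
  shows "norm (LINT x|lebesgue_on unit_disk. \<psi> x * lap h x - lap \<psi> x * h x) \<le> 1536 * pi * (C * \<epsilon>)"
proof -
  define P where "P b x = \<psi> x * pd b h x" for b x
  define G where "G x = \<psi> x * h x" for x
  have GC: "Ck_on 2 unit_disk G" unfolding G_def by (intro Ck_on_mult C2 open_ball)
  have PC: "Ck_on 1 unit_disk (P b)" if "b \<in> Basis" for b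
    unfolding P_def using that by (intro Ck_on_mult Ck_on_2D[OF open_ball] C2 open_ball)
  \<comment> \<open>Both terms on the right are divergences, and integrating them by parts leaves no derivative of \<open>\<psi>\<close>.\<close>
  have id: "\<psi> x * lap h x - lap \<psi> x * h x = 2 * (\<Sum>b\<in>Basis. pd b (P b) x) - lap G x" if x: "x \<in> unit_disk" for x
  proof -
    have "pd b (P b) x = \<psi> x * pd b (pd b h) x + pd b \<psi> x * pd b h x" if b: "b \<in> Basis" for b
      unfolding P_def by (intro pd_mult Ck_on_2D(2)[OF open_ball C2(1) x] Ck_on_2D(4)[OF open_ball C2(2) b x])
    then have "(\<Sum>b\<in>Basis. pd b (P b) x) = \<psi> x * lap h x + (\<Sum>b\<in>Basis. pd b \<psi> x * pd b h x)"
      by (simp add: sum.distrib laplacian_on_def sum_distrib_left)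
    moreover have "lap G x = \<psi> x * lap h x + lap \<psi> x * h x + 2 *\<^sub>R (\<Sum>b\<in>Basis. pd b \<psi> x * pd b h x)"
      unfolding G_def by (rule lap_mult[OF open_ball x C2])
    ultimately show ?thesis by (simp add: scaleR_conv_of_real algebra_simps)
  qed
  have Pm: "P b \<in> borel_measurable (lebesgue_on unit_disk)" if "b \<in> Basis" for b
    by (rule continuous_disk_measurable[OF Ck_on_continuous[OF PC[OF that]]])
  have Gm: "G \<in> borel_measurable (lebesgue_on unit_disk)"
    by (rule continuous_disk_measurable[OF Ck_on_continuous[OF GC]])
  have B0: "B \<ge> 0"
  proof -
    obtain b :: "real^2" where b: "b \<in> Basis" using nonempty_Basis by blast
    have "norm (pd b h 0) \<le> B" by (rule grad[OF b]) simp
    then show ?thesis by (rule order_trans[OF norm_ge_zero])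
  qed
  have Pb: "norm (P b x) \<le> (C * B) * (1 - x \<bullet> x)" if b: "b \<in> Basis" and x: "x \<in> unit_disk" for b x
  proof -
    have "norm (P b x) \<le> (C * (1 - x \<bullet> x)) * B"
      unfolding P_def norm_mult using inner_le_1[OF x] psi(2)
      by (intro mult_mono psi(1) grad x b) auto
    then show ?thesis by (simp add: mult_ac)
  qed
  have lim1: "(\<lambda>n. (\<Sum>b\<in>Basis. LINT x|lebesgue_on unit_disk. pd b (radial_cut n) x *\<^sub>R P b x)) \<longlonglongrightarrow> (\<Sum>b\<in>(Basis::(real^2) set). 0)"
    using psi(2) B0 by (intro tendsto_sum tendsto_integral_pd_cut[where C="C * B"] Pm Pb) auto
  have lim0: "(\<lambda>n. LINT x|lebesgue_on unit_disk. radial_cut n x *\<^sub>R (\<psi> x * lap h x - lap \<psi> x * h x))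
      \<longlonglongrightarrow> (LINT x|lebesgue_on unit_disk. \<psi> x * lap h x - lap \<psi> x * h x)"
    by (rule tendsto_integral_cut[OF i])
  have lim2: "(\<lambda>n. 2 * norm (\<Sum>b\<in>Basis. LINT x|lebesgue_on unit_disk. pd b (radial_cut n) x *\<^sub>R P b x) + 1536 * pi * (C * \<epsilon>))
      \<longlonglongrightarrow> 2 * norm (\<Sum>b\<in>(Basis::(real^2) set). 0 :: complex) + 1536 * pi * (C * \<epsilon>)"
    by (intro tendsto_intros lim1)
  have ev: "eventually (\<lambda>n. norm (LINT x|lebesgue_on unit_disk. radial_cut n x *\<^sub>R (\<psi> x * lap h x - lap \<psi> x * h x))
      \<le> 2 * norm (\<Sum>b\<in>Basis. LINT x|lebesgue_on unit_disk. pd b (radial_cut n) x *\<^sub>R P b x) + 1536 * pi * (C * \<epsilon>)) sequentially"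
  proof -
    define q where "q = max r 0"
    have q: "0 \<le> q" "q < 1" using r by (auto simp: q_def)
    then have q2: "1 - q\<^sup>2 > 0" by (simp add: power_less_one_iff)
    obtain N where N: "real N * (1 - q\<^sup>2) > 4" using reals_Archimedean3[OF q2] by blast
    show ?thesis
    proof (rule eventually_sequentiallyI[of "max 4 N"])
      fix n assume n: "n \<ge> max 4 N"
      then have n4: "n \<ge> 4" by simp
      have "real N * (1 - q\<^sup>2) \<le> real n * (1 - q\<^sup>2)" using n q2 by (intro mult_right_mono) auto
      then have nN: "real n * (1 - q\<^sup>2) > 4" using N by linarith
      have far: "r < norm x" if x: "x \<in> shell n" for x :: "real^2"
      proof (rule ccontr)
        assume "\<not> r < norm x"
        then have "(norm x)\<^sup>2 \<le> q\<^sup>2" by (intro power_mono) (auto simp: q_def)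
        then have "real n * (1 - q\<^sup>2) \<le> real n * (1 - x \<bullet> x)"
          by (intro mult_left_mono) (auto simp: dot_square_norm)
        with nN x show False by (auto simp: shell_def)
      qed
      have hb: "norm (G x) \<le> (C * \<epsilon>) * (1 - x \<bullet> x)" if x: "x \<in> shell n" for x
      proof -
        have xd: "x \<in> unit_disk" using measure_shell(3)[OF n4] x by blast
        have "norm (G x) \<le> (C * (1 - x \<bullet> x)) * \<epsilon>"
          unfolding G_def norm_mult using inner_le_1[OF xd] psi(2)
          by (intro mult_mono psi(1) h xd far x) auto
        then show ?thesis by (simp add: mult_ac)
      qed
      obtain K where K: "compact K" "K \<subseteq> ball (0::real^2) 1" "\<And>x. x \<notin> K \<Longrightarrow> radial_cut n x = 0"
        using cut_support[of n] n4 by auto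
      have C: "Ck_on 2 unit_disk (radial_cut n)" by (rule Ck_on_subset[OF Ck_on_cut]) simp
      have C1: "Ck_on 1 unit_disk (radial_cut n)" by (rule Ck_on_2D(1)[OF open_ball C])
      have cc: "continuous_on unit_disk (radial_cut n)" using C by (rule Ck_on_continuous)
      have iG: "integrable (lebesgue_on unit_disk) (\<lambda>x. radial_cut n x *\<^sub>R lap G x)"
        using K Ck_on_2D(7)[OF open_ball GC] cc
        by (auto intro!: integrable_on_compact_support[OF open_ball K(1,2)] continuous_intros)
      have iP: "integrable (lebesgue_on unit_disk) (\<lambda>x. radial_cut n x *\<^sub>R pd b (P b) x)"
        and eP: "(LINT x|lebesgue_on unit_disk. radial_cut n x *\<^sub>R pd b (P b) x) = - (LINT x|lebesgue_on unit_disk. pd b (radial_cut n) x *\<^sub>R P b x)"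
        if b: "b \<in> Basis" for b
        using integration_by_parts(2,3)[OF open_ball K C1 PC[OF b] b] by simp_all
      have "(LINT x|lebesgue_on unit_disk. radial_cut n x *\<^sub>R (\<psi> x * lap h x - lap \<psi> x * h x))
          = (LINT x|lebesgue_on unit_disk. 2 *\<^sub>R (\<Sum>b\<in>Basis. radial_cut n x *\<^sub>R pd b (P b) x) - radial_cut n x *\<^sub>R lap G x)"
      proof (rule Bochner_Integration.integral_cong[OF refl])
        fix x :: "real^2" assume "x \<in> space (lebesgue_on unit_disk)"
        then have x: "x \<in> unit_disk" by simp
        show "radial_cut n x *\<^sub>R (\<psi> x * lap h x - lap \<psi> x * h x) =
            2 *\<^sub>R (\<Sum>b\<in>Basis. radial_cut n x *\<^sub>R pd b (P b) x) - radial_cut n x *\<^sub>R lap G x"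
          unfolding id[OF x] by (simp add: scaleR_conv_of_real sum_distrib_left algebra_simps)
      qed
      also have "\<dots> = 2 *\<^sub>R (\<Sum>b\<in>Basis. LINT x|lebesgue_on unit_disk. radial_cut n x *\<^sub>R pd b (P b) x)
          - (LINT x|lebesgue_on unit_disk. radial_cut n x *\<^sub>R lap G x)"
        using iG iP by (simp add: Bochner_Integration.integral_sum)
      also have "\<dots> = - (2 *\<^sub>R (\<Sum>b\<in>Basis. LINT x|lebesgue_on unit_disk. pd b (radial_cut n) x *\<^sub>R P b x))
          - (LINT x|lebesgue_on unit_disk. lap (radial_cut n) x *\<^sub>R G x)"
        using Green_cutoff[OF open_ball K C GC] by (simp add: eP sum_negf)
      finally have eq: "(LINT x|lebesgue_on unit_disk. radial_cut n x *\<^sub>R (\<psi> x * lap h x - lap \<psi> x * h x)) =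
          - (2 *\<^sub>R (\<Sum>b\<in>Basis. LINT x|lebesgue_on unit_disk. pd b (radial_cut n) x *\<^sub>R P b x))
          - (LINT x|lebesgue_on unit_disk. lap (radial_cut n) x *\<^sub>R G x)" .
      have bd: "norm (LINT x|lebesgue_on unit_disk. lap (radial_cut n) x *\<^sub>R G x) \<le> 1536 * pi * (C * \<epsilon>)"
        by (rule integral_lap_cut_bound[OF Gm n4 _ hb]) (use psi(2) e in auto)
      show "norm (LINT x|lebesgue_on unit_disk. radial_cut n x *\<^sub>R (\<psi> x * lap h x - lap \<psi> x * h x))
          \<le> 2 * norm (\<Sum>b\<in>Basis. LINT x|lebesgue_on unit_disk. pd b (radial_cut n) x *\<^sub>R P b x) + 1536 * pi * (C * \<epsilon>)"
        unfolding eq by (rule order_trans[OF norm_triangle_ineq4]) (use bd in simp)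
    qed
  qed
  from tendsto_le[OF sequentially_bot lim2 tendsto_norm[OF lim0] ev]
  show ?thesis by simp
qed

text \<open>A Rellich-type identity. Since \<open>(\<Delta> + l\<^sup>2/c\<^sup>2)(x \<cdot> \<nabla>\<phi>) = -2 l\<^sup>2/c\<^sup>2 \<phi>\<close> and both
  \<open>x \<cdot> \<nabla>\<phi>\<close> and \<open>\<psi>\<close> vanish on the circle, Green's formula for this pair has no boundary term. The
  derivative \<open>x \<cdot> \<nabla>\<phi>\<close> is approximated by difference quotients of dilations, so that no third
  derivatives of \<open>\<phi>\<close> occur.\<close>

lemma neumann_dirichlet_coupling:
  assumes N: "neumann_eigenfunction c l \<phi>" and c: "c > 0" "l \<ge> 0"
  obtains R where "R \<in> L2_on unit_disk"
    "\<And>\<psi> m. dirichlet_eigenfunction c m \<psi> \<Longrightarrow> m > 0 \<Longrightarrow>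
      of_real (2 * l\<^sup>2) * inner_c c \<phi> \<psi> = of_real (m\<^sup>2 - l\<^sup>2) * inner_c c R \<psi>"
proof -
  obtain R B where R: "continuous_on (cball 0 1) R" "\<And>z. z \<in> sphere 0 1 \<Longrightarrow> R z = 0"
    "\<And>x. x \<in> unit_disk \<Longrightarrow> pd x \<phi> x = R x"
    and B: "\<And>b x. b \<in> Basis \<Longrightarrow> x \<in> unit_disk \<Longrightarrow> norm (pd b \<phi> x) \<le> B" "\<And>x. x \<in> unit_disk \<Longrightarrow> norm (\<phi> x) \<le> B"
    by (rule neumann_radial[OF N]) blast
  have "bounded (R ` cball 0 1)" by (intro compact_imp_bounded compact_continuous_image R compact_cball)
  then obtain M where M: "\<And>x. x \<in> cball 0 1 \<Longrightarrow> norm (R x) \<le> M" unfolding bounded_iff by blast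
  have Rm: "R \<in> borel_measurable (lebesgue_on unit_disk)"
    by (rule continuous_disk_measurable[OF continuous_on_subset[OF R(1)]]) auto
  have RL: "R \<in> L2_on unit_disk" by (rule L2_on_bounded[OF Rm M]) auto
  note C2 = neumann_Ck[OF N]
  have pm: "\<phi> \<in> borel_measurable (lebesgue_on unit_disk)"
    by (rule continuous_disk_measurable[OF Ck_on_continuous[OF C2]])
  \<comment> \<open>The offset keeps the dilation factors at least 1/2, so that dividing by them costs at most a factor 2.\<close>
  define s where "s k = 1 - 1 / real (Suc (Suc k))" for k
  have s: "1/2 \<le> s k" "0 \<le> s k" "s k < 1" "s k \<le> 1" for k
    by (auto simp: s_def field_simps)
  have s1: "s \<longlonglongrightarrow> 1"
  proof -
    have "(\<lambda>k. 1 - inverse (real (Suc (Suc k)))) \<longlonglongrightarrow> 1 - 0"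
      by (intro tendsto_intros LIMSEQ_Suc[OF LIMSEQ_inverse_real_of_nat])
    then show ?thesis by (simp add: s_def[abs_def] inverse_eq_divide)
  qed
  have path: "((\<lambda>t. \<phi> (t *\<^sub>R x)) has_vector_derivative R (t *\<^sub>R x) /\<^sub>R t) (at t)"
    if x: "x \<in> unit_disk" and t: "0 < t" "t \<le> 1" for x t
  proof -
    have tx: "t *\<^sub>R x \<in> unit_disk" using t by (intro dilation_in_disk x) auto
    have l: "((\<lambda>t. t *\<^sub>R x) has_derivative (\<lambda>h. h *\<^sub>R x)) (at t)" by (auto intro!: derivative_eq_intros)
    note d = has_derivative_pd[OF Ck_on_2D(2)[OF open_ball C2 tx]]
    have "pd (h *\<^sub>R x) \<phi> (t *\<^sub>R x) = h *\<^sub>R (R (t *\<^sub>R x) /\<^sub>R t)" for h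
    proof -
      note lin = linear_scale[OF has_derivative_linear[OF d]]
      have "R (t *\<^sub>R x) = t *\<^sub>R pd x \<phi> (t *\<^sub>R x)" using R(3)[OF tx] lin[of t x] by simp
      then show ?thesis using lin[of h x] t by simp
    qed
    then show ?thesis using has_derivative_compose[OF l d] by (simp add: has_vector_derivative_def)
  qed
  define W where "W k x = (\<phi> x - \<phi> (s k *\<^sub>R x)) /\<^sub>R (1 - s k)" for k x
  have Wlim: "(\<lambda>k. W k x) \<longlonglongrightarrow> R x" if x: "x \<in> unit_disk" for x
  proof -
    have "((\<lambda>t. \<phi> (t *\<^sub>R x)) has_vector_derivative R x) (at 1)" using path[OF x, of 1] by simp
    moreover have "(\<lambda>k. s k - 1) \<longlonglongrightarrow> 0" using LIM_zero[OF s1] .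
    ultimately have "(\<lambda>k. (\<phi> ((1 + (s k - 1)) *\<^sub>R x) - \<phi> (1 *\<^sub>R x)) /\<^sub>R (s k - 1)) \<longlonglongrightarrow> R x"
      by (rule has_vector_derivative_sequentially) (use s in \<open>auto simp: less_imp_neq\<close>)
    moreover have "(\<phi> ((1 + (s k - 1)) *\<^sub>R x) - \<phi> (1 *\<^sub>R x)) /\<^sub>R (s k - 1) = W k x" for k
    proof -
      have "inverse (s k - 1) = - inverse (1 - s k)" using inverse_minus_eq[of "1 - s k"] by simp
      then show ?thesis by (simp add: W_def algebra_simps)
    qed
    ultimately show ?thesis by simp
  qed
  have Wb: "norm (W k x) \<le> 2 * K" if x: "x \<in> unit_disk"
    and K: "\<And>t. s k \<le> t \<Longrightarrow> t \<le> 1 \<Longrightarrow> norm (R (t *\<^sub>R x)) \<le> K" for k x K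
  proof -
    have K0: "0 \<le> K" using order_trans[OF norm_ge_zero K[of 1]] s(4)[of k] by simp
    have "norm (\<phi> (1 *\<^sub>R x) - \<phi> (s k *\<^sub>R x)) \<le> (2 * K) * norm (1 - s k)"
    proof (rule differentiable_bound[of "{s k..1}" "\<lambda>t. \<phi> (t *\<^sub>R x)" "\<lambda>t h. h *\<^sub>R (R (t *\<^sub>R x) /\<^sub>R t)"])
      fix t assume t: "t \<in> {s k..1}"
      then have t0: "1/2 \<le> t" "t \<le> 1" "0 < t" using s(1)[of k] by auto
      show "((\<lambda>t. \<phi> (t *\<^sub>R x)) has_derivative (\<lambda>h. h *\<^sub>R (R (t *\<^sub>R x) /\<^sub>R t))) (at t within {s k..1})"
        using has_vector_derivative_at_within[OF path[OF x t0(3,2)]] unfolding has_vector_derivative_def .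
      have "norm (R (t *\<^sub>R x) /\<^sub>R t) \<le> 2 * K"
      proof -
        have "inverse t \<le> 2" using t0 le_imp_inverse_le[of "1/2" t] by simp
        then have "inverse t * norm (R (t *\<^sub>R x)) \<le> 2 * K" using K[of t] t t0 by (intro mult_mono) auto
        then show ?thesis using t0 by simp
      qed
      then show "onorm (\<lambda>h. h *\<^sub>R (R (t *\<^sub>R x) /\<^sub>R t)) \<le> 2 * K"
        using K0 mult_left_mono by (intro onorm_bound) (force simp: mult.commute[of "2 * K"] simp del: scaleR_scaleR)+
    qed (use s in auto)
    then have "inverse (1 - s k) * norm (\<phi> x - \<phi> (s k *\<^sub>R x)) \<le> inverse (1 - s k) * ((2 * K) * (1 - s k))"
      using s(3)[of k] by (intro mult_left_mono) auto
    also have "\<dots> = 2 * K" using s(3)[of k] by simp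
    finally show ?thesis using s(3)[of k] by (simp add: W_def)
  qed
  have WM: "norm (W k x) \<le> 2 * M" if x: "x \<in> unit_disk" for k x
  proof (rule Wb[OF x])
    fix t assume "s k \<le> t" "t \<le> 1"
    then have "t *\<^sub>R x \<in> unit_disk" using s(2)[of k] by (intro dilation_in_disk x) auto
    then show "norm (R (t *\<^sub>R x)) \<le> M" by (intro M) auto
  qed
  have near: "\<exists>r<1. \<forall>\<^sub>F k in sequentially. \<forall>x\<in>unit_disk. r < norm x \<longrightarrow> norm (W k x) \<le> 2 * \<eta>" if eta: "\<eta> > 0" for \<eta>
  proof -
    have "uniformly_continuous_on (cball 0 1) R" by (rule compact_uniformly_continuous[OF R(1) compact_cball])
    then obtain d where d: "d > 0" "\<And>x y. x \<in> cball 0 1 \<Longrightarrow> y \<in> cball 0 1 \<Longrightarrow> dist y x < d \<Longrightarrow> dist (R y) (R x) < \<eta>"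
      using eta unfolding uniformly_continuous_on_def by blast
    define \<rho> where "\<rho> = max (1/2) (1 - d / 2)"
    have rho: "1/2 \<le> \<rho>" "\<rho> < 1" using d(1) by (auto simp: \<rho>_def)
    have Rrho: "norm (R z) \<le> \<eta>" if z: "\<rho> \<le> norm z" "norm z \<le> 1" for z
    proof -
      have nz: "norm z > 0" "z \<noteq> 0" using z rho by auto
      define y where "y = z /\<^sub>R norm z"
      have y: "norm y = 1" "norm z *\<^sub>R y = z" using nz by (auto simp: y_def)
      have "dist z y = norm ((norm z - 1) *\<^sub>R y)" by (simp only: dist_norm scaleR_left_diff_distrib scaleR_one y(2))
      also have "\<dots> = 1 - norm z" using y(1) z(2) by simp
      also have "\<dots> < d" using z(1) d(1) by (auto simp: \<rho>_def)
      finally have "dist (R z) (R y) < \<eta>" using z y(1) by (intro d(2)) auto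
      then show ?thesis using R(2)[of y] y(1) by simp
    qed
    define r where "r = (1 + \<rho>) / 2"
    have r: "r < 1" "\<rho> / r < 1" "r > 0" using rho by (auto simp: r_def)
    have "\<forall>\<^sub>F k in sequentially. \<rho> / r < s k" using order_tendstoD(1)[OF s1 r(2)] .
    then have "\<forall>\<^sub>F k in sequentially. \<forall>x\<in>unit_disk. r < norm x \<longrightarrow> norm (W k x) \<le> 2 * \<eta>"
    proof (rule eventually_mono, intro ballI impI)
      fix k and x :: "real^2" assume k: "\<rho> / r < s k" and x: "x \<in> unit_disk" "r < norm x"
      show "norm (W k x) \<le> 2 * \<eta>"
      proof (rule Wb[OF x(1)], rule Rrho)
        fix t assume t: "s k \<le> t" "t \<le> 1"
        have t0: "0 \<le> t" using t s(2)[of k] by linarith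
        have "\<rho> = \<rho> / r * r" using r by simp
        also have "\<dots> \<le> t * norm x" using k t t0 x r by (intro mult_mono) auto
        finally show "\<rho> \<le> norm (t *\<^sub>R x)" using t0 by simp
        have "t *\<^sub>R x \<in> unit_disk" using t t0 by (intro dilation_in_disk x(1)) auto
        then show "norm (t *\<^sub>R x) \<le> 1" by simp
      qed
    qed
    with r(1) show ?thesis by blast
  qed
  have "of_real (2 * l\<^sup>2) * inner_c c \<phi> \<psi> = of_real (m\<^sup>2 - l\<^sup>2) * inner_c c R \<psi>"
    if D: "dirichlet_eigenfunction c m \<psi>" and m: "m > 0" for \<psi> m
  proof -
    define p where "p x = cnj (\<psi> x)" for x
    define \<kappa> where "\<kappa> = m\<^sup>2 / c\<^sup>2 - l\<^sup>2 / c\<^sup>2"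
    define \<mu> where "\<mu> = l\<^sup>2 / c\<^sup>2"
    obtain C where C: "C \<ge> 0" "\<And>x. x \<in> cball 0 1 \<Longrightarrow> norm (\<psi> x) \<le> C * (1 - x \<bullet> x)"
      by (rule dirichlet_bounds[OF D c(1) m]) blast
    have pC: "Ck_on 2 unit_disk p" unfolding p_def by (rule Ck_on_cnj[OF open_ball dirichlet_Ck[OF D]])
    have pb: "norm (p x) \<le> C * (1 - x \<bullet> x)" if "x \<in> unit_disk" for x
      using C(2)[of x] that by (simp add: p_def)
    have pb1: "norm (p x) \<le> C" if x: "x \<in> unit_disk" for x
    proof -
      have "C * (1 - x \<bullet> x) \<le> C * 1" using C(1) by (intro mult_left_mono) auto
      then show ?thesis using pb[OF x] by simp
    qed
    have lp: "lap p x = - of_real (m\<^sup>2 / c\<^sup>2) * p x" if x: "x \<in> unit_disk" for x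
      unfolding p_def using lap_bounded_linear[OF open_ball x dirichlet_Ck[OF D] bounded_linear_cnj]
      by (simp add: dirichlet_lap[OF D x])
    define Q where "Q k x = p x * (of_real \<kappa> * W k x - of_real (\<mu> * (1 + s k)) * \<phi> (s k *\<^sub>R x))" for k x
    have phis: "Ck_on 2 unit_disk (\<lambda>x. \<phi> (s k *\<^sub>R x))" for k by (rule Ck_on_dilation[OF s(2,4) C2])
    define h where "h k x = \<phi> x + (-1) *\<^sub>R \<phi> (s k *\<^sub>R x)" for k x
    have hC: "Ck_on 2 unit_disk (h k)" for k
      unfolding h_def by (intro Ck_on_add Ck_on_scaleR Ck_on_const phis C2 open_ball)
    have hW: "h k x = of_real (1 - s k) * W k x" for k x
      using s(3)[of k] by (simp add: h_def W_def scaleR_conv_of_real)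
    have idQ: "p x * lap (h k) x - lap p x * h k x = of_real (1 - s k) * Q k x" if x: "x \<in> unit_disk" for k x
    proof -
      have "lap (h k) x = lap \<phi> x + (-1) *\<^sub>R (s k)\<^sup>2 *\<^sub>R lap \<phi> (s k *\<^sub>R x)"
        unfolding h_def lap_add[OF open_ball x C2 Ck_on_scaleR[OF open_ball Ck_on_const phis]]
          lap_bounded_linear[OF open_ball x phis bounded_linear_scaleR_right] lap_dilation[OF s(2,4) C2 x] ..
      also have "\<dots> = - of_real \<mu> * \<phi> x + of_real ((s k)\<^sup>2) * (of_real \<mu> * \<phi> (s k *\<^sub>R x))"
        unfolding neumann_lap[OF N x] neumann_lap[OF N dilation_in_disk[OF s(2,4) x]] \<mu>_def
        by (simp add: scaleR_conv_of_real)
      also have "\<dots> = - of_real \<mu> * h k x - of_real ((1 - s k) * (\<mu> * (1 + s k))) * \<phi> (s k *\<^sub>R x)"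
        by (simp add: h_def algebra_simps power2_eq_square)
      finally have lh: "lap (h k) x = - of_real \<mu> * h k x - of_real ((1 - s k) * (\<mu> * (1 + s k))) * \<phi> (s k *\<^sub>R x)" .
      have k: "complex_of_real (m\<^sup>2 / c\<^sup>2) = of_real \<kappa> + of_real \<mu>" by (simp add: \<kappa>_def \<mu>_def)
      show ?thesis unfolding lh lp[OF x] k Q_def hW of_real_mult by algebra
    qed
    have Qm: "Q k \<in> borel_measurable (lebesgue_on unit_disk)" for k
    proof (rule continuous_disk_measurable)
      show "continuous_on unit_disk (Q k)"
        unfolding Q_def W_def
        by (intro continuous_intros Ck_on_continuous[OF pC] Ck_on_continuous[OF C2] Ck_on_continuous[OF phis])
    qed
    define Qb where "Qb = C * (\<bar>\<kappa>\<bar> * (2 * M) + \<bar>\<mu>\<bar> * 2 * B)"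
    have Qbound: "norm (Q k x) \<le> Qb" if x: "x \<in> unit_disk" for k x
    proof -
      have "norm (of_real \<kappa> * W k x - of_real (\<mu> * (1 + s k)) * \<phi> (s k *\<^sub>R x))
          \<le> \<bar>\<kappa>\<bar> * norm (W k x) + \<bar>\<mu> * (1 + s k)\<bar> * norm (\<phi> (s k *\<^sub>R x))"
        by (rule order_trans[OF norm_triangle_ineq4]) (simp add: norm_mult del: of_real_mult of_real_add)
      also have "\<dots> \<le> \<bar>\<kappa>\<bar> * (2 * M) + (\<bar>\<mu>\<bar> * 2) * B"
      proof (intro add_mono mult_mono WM x B(2) dilation_in_disk s)
        show "\<bar>\<mu> * (1 + s k)\<bar> \<le> \<bar>\<mu>\<bar> * 2"
          unfolding abs_mult using s[of k] by (intro mult_left_mono) auto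
      qed auto
      finally show ?thesis
        unfolding Q_def Qb_def norm_mult using pb1[OF x] C(1) by (intro mult_mono) auto
    qed
    have Qi: "integrable (lebesgue_on unit_disk) (Q k)" for k
    proof (rule Bochner_Integration.integrable_bound[OF disk_integrable_const[where k=Qb] Qm], rule AE_I2)
      fix x :: "real^2" assume "x \<in> space (lebesgue_on unit_disk)"
      then have "x \<in> unit_disk" by simp
      from Qbound[OF this, of k] show "norm (Q k x) \<le> norm Qb" by simp
    qed
    define Q0 where "Q0 x = p x * (of_real \<kappa> * R x - of_real (\<mu> * (1 + 1)) * \<phi> x)" for x
    have Qlim: "(\<lambda>k. Q k x) \<longlonglongrightarrow> Q0 x" if x: "x \<in> unit_disk" for x
    proof -
      have "(\<lambda>k. s k *\<^sub>R x) \<longlonglongrightarrow> 1 *\<^sub>R x" by (intro tendsto_intros s1)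
      moreover have "isCont \<phi> (1 *\<^sub>R x)"
        using Ck_on_continuous[OF C2] x by (simp add: continuous_on_eq_continuous_at)
      ultimately have "(\<lambda>k. \<phi> (s k *\<^sub>R x)) \<longlonglongrightarrow> \<phi> (1 *\<^sub>R x)" by (rule isCont_tendsto_compose[rotated])
      then have "(\<lambda>k. \<phi> (s k *\<^sub>R x)) \<longlonglongrightarrow> \<phi> x" by simp
      then show ?thesis unfolding Q_def Q0_def by (intro tendsto_intros Wlim x s1)
    qed
    have Q0m: "Q0 \<in> borel_measurable (lebesgue_on unit_disk)"
    proof (rule continuous_disk_measurable)
      show "continuous_on unit_disk Q0"
        unfolding Q0_def
        by (intro continuous_intros Ck_on_continuous[OF pC] Ck_on_continuous[OF C2] continuous_on_subset[OF R(1)]) auto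
    qed
    have lim: "(\<lambda>k. LINT x|lebesgue_on unit_disk. Q k x) \<longlonglongrightarrow> (LINT x|lebesgue_on unit_disk. Q0 x)"
      by (rule integral_dominated_convergence[where w="\<lambda>x. Qb"])
        (use Qlim Qbound Q0m Qm disk_integrable_const in auto)
    have "norm (LINT x|lebesgue_on unit_disk. Q0 x) \<le> e" if e: "e > 0" for e
    proof -
      define \<eta> where "\<eta> = e / (1536 * pi * (C + 1) * 2)"
      have eta: "\<eta> > 0" using e C(1) by (simp add: \<eta>_def)
      obtain r where r: "r < 1" "\<forall>\<^sub>F k in sequentially. \<forall>x\<in>unit_disk. r < norm x \<longrightarrow> norm (W k x) \<le> 2 * \<eta>"
        using near[OF eta] by blast
      have "\<forall>\<^sub>F k in sequentially. norm (LINT x|lebesgue_on unit_disk. Q k x) \<le> e"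
        using r(2)
      proof (rule eventually_mono)
        fix k assume k: "\<forall>x\<in>unit_disk. r < norm x \<longrightarrow> norm (W k x) \<le> 2 * \<eta>"
        have s0: "1 - s k > 0" using s(3)[of k] by simp
        have int: "(LINT x|lebesgue_on unit_disk. p x * lap (h k) x - lap p x * h k x) =
            of_real (1 - s k) * (LINT x|lebesgue_on unit_disk. Q k x)"
          using idQ by (subst integral_mult_right_zero[symmetric], intro Bochner_Integration.integral_cong) auto
        have "norm (LINT x|lebesgue_on unit_disk. p x * lap (h k) x - lap p x * h k x)
            \<le> 1536 * pi * (C * ((1 - s k) * (2 * \<eta>)))"
        proof (rule Green_second_bound[OF pC hC pb C(1), where B="2 * B" and r=r])
          show "norm (pd b (h k) x) \<le> 2 * B" if b: "b \<in> Basis" and x: "x \<in> unit_disk" for b x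
          proof -
            note dl = dilation_in_disk[OF s(2,4) x]
            note df = Ck_on_2D(2)[OF open_ball C2]
            have "pd b (h k) x = pd b \<phi> x + pd b (\<lambda>x. (-1) *\<^sub>R \<phi> (s k *\<^sub>R x)) x"
              unfolding h_def
              by (intro pd_add df x Ck_on_2D(2)[OF open_ball Ck_on_scaleR[OF open_ball Ck_on_const phis]])
            also have "pd b (\<lambda>x. (-1) *\<^sub>R \<phi> (s k *\<^sub>R x)) x = (-1) *\<^sub>R s k *\<^sub>R pd b \<phi> (s k *\<^sub>R x)"
              unfolding pd_bounded_linear[OF bounded_linear_scaleR_right pd_dilation(2)[OF df[OF dl]]]
                pd_dilation(1)[OF df[OF dl]] ..
            finally have "norm (pd b (h k) x) \<le> norm (pd b \<phi> x) + s k * norm (pd b \<phi> (s k *\<^sub>R x))"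
              using norm_triangle_ineq4[of "pd b \<phi> x" "s k *\<^sub>R pd b \<phi> (s k *\<^sub>R x)"] s(2)[of k] by simp
            moreover have "s k * norm (pd b \<phi> (s k *\<^sub>R x)) \<le> 1 * B"
              using s by (intro mult_mono B(1) b dl) auto
            ultimately show ?thesis using B(1)[OF b x] by simp
          qed
          show "integrable (lebesgue_on unit_disk) (\<lambda>x. p x * lap (h k) x - lap p x * h k x)"
          proof (rule Bochner_Integration.integrable_cong[THEN iffD2, OF refl])
            show "integrable (lebesgue_on unit_disk) (\<lambda>x. of_real (1 - s k) * Q k x)"
              by (rule integrable_mult_right) (rule Qi)
          qed (use idQ in simp)
          show "norm (h k x) \<le> (1 - s k) * (2 * \<eta>)" if x: "x \<in> unit_disk" "r < norm x" for x
          proof -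
            have "norm (W k x) \<le> 2 * \<eta>" using k x by blast
            then have "(1 - s k) * norm (W k x) \<le> (1 - s k) * (2 * \<eta>)" using s0 by (intro mult_left_mono) auto
            then show ?thesis unfolding hW norm_mult norm_of_real using s0 by simp
          qed
        qed (use s0 eta r(1) in auto)
        then have "(1 - s k) * norm (LINT x|lebesgue_on unit_disk. Q k x) \<le> (1 - s k) * (1536 * pi * C * 2 * \<eta>)"
          unfolding int norm_mult norm_of_real using s0 by (simp add: mult_ac)
        then have "norm (LINT x|lebesgue_on unit_disk. Q k x) \<le> 1536 * pi * C * 2 * \<eta>"
          using s0 by (rule mult_left_le_imp_le)
        also have "\<dots> \<le> 1536 * pi * (C + 1) * 2 * \<eta>" using eta by (intro mult_right_mono mult_left_mono) auto
        also have "\<dots> = e" using C(1) by (simp add: \<eta>_def)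
        finally show "norm (LINT x|lebesgue_on unit_disk. Q k x) \<le> e" .
      qed
      from tendsto_upperbound[OF tendsto_norm[OF lim] this] show ?thesis by simp
    qed
    then have "(LINT x|lebesgue_on unit_disk. Q0 x) = 0"
      by (metis field_le_epsilon add.left_neutral norm_le_zero_iff)
    moreover have "(LINT x|lebesgue_on unit_disk. Q0 x) =
        of_real \<kappa> * (LINT x|lebesgue_on unit_disk. R x * cnj (\<psi> x)) - of_real (2 * \<mu>) * (LINT x|lebesgue_on unit_disk. \<phi> x * cnj (\<psi> x))"
    proof -
      have psiL: "\<psi> \<in> L2_on unit_disk"
      proof (rule L2_on_bounded)
        show "\<psi> \<in> borel_measurable (lebesgue_on unit_disk)"
          by (rule continuous_disk_measurable[OF Ck_on_continuous[OF dirichlet_Ck[OF D]]])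
        show "norm (\<psi> x) \<le> C" if "x \<in> unit_disk" for x using pb1[OF that] by (simp add: p_def)
      qed simp
      have phiL: "\<phi> \<in> L2_on unit_disk" by (rule L2_on_bounded[OF pm B(2)]) auto
      have "(LINT x|lebesgue_on unit_disk. Q0 x) =
        (LINT x|lebesgue_on unit_disk. of_real \<kappa> * (R x * cnj (\<psi> x)) - of_real (2 * \<mu>) * (\<phi> x * cnj (\<psi> x)))"
        by (intro Bochner_Integration.integral_cong refl) (simp add: Q0_def p_def algebra_simps)
      then show ?thesis
        using L2_on_mult_integrable[OF RL psiL] L2_on_mult_integrable[OF phiL psiL] by simp
    qed
    ultimately have "of_real (2 * \<mu>) * (LINT x|lebesgue_on unit_disk. \<phi> x * cnj (\<psi> x)) =
        of_real \<kappa> * (LINT x|lebesgue_on unit_disk. R x * cnj (\<psi> x))" by simp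
    moreover have "of_real (2 * l\<^sup>2) = of_real (c\<^sup>2) * complex_of_real (2 * \<mu>)"
      "of_real (m\<^sup>2 - l\<^sup>2) = of_real (c\<^sup>2) * complex_of_real \<kappa>"
      unfolding of_real_mult[symmetric] \<mu>_def \<kappa>_def using c by (auto simp: right_diff_distrib simp del: of_real_mult)
    ultimately show ?thesis
      unfolding inner_c_eq by (simp add: mult_ac)
  qed
  with RL show ?thesis by (rule that)
qed

section \<open>Uniqueness of weak derivatives\<close>

definition bump_profile :: "nat \<Rightarrow> real \<Rightarrow> real" where
  "bump_profile k s = (if s > 0 then (1 / s) ^ k * exp (- (1 / s)) else 0)"

lemma bump_profile_tendsto_0: "(bump_profile k \<longlongrightarrow> 0) (at 0)"
proof -
  have "((\<lambda>y::real. y ^ k / exp y) \<longlongrightarrow> 0) at_top" by (rule tendsto_power_div_exp_0)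
  then have "((\<lambda>s::real. (inverse s) ^ k / exp (inverse s)) \<longlongrightarrow> 0) (at_right 0)"
    by (rule filterlim_compose) (rule filterlim_inverse_at_top_right)
  moreover have "\<forall>\<^sub>F s::real in at_right 0. (inverse s) ^ k / exp (inverse s) = bump_profile k s"
    by (auto simp: eventually_at_right_field bump_profile_def exp_minus divide_inverse intro!: exI[of _ 1])
  ultimately have R: "(bump_profile k \<longlongrightarrow> 0) (at_right 0)"
    by (rule Lim_transform_eventually)
  have "\<forall>\<^sub>F s::real in at_left 0. bump_profile k s = 0"
    by (auto simp: eventually_at_left_field bump_profile_def intro!: exI[of _ "-1"])
  then have L: "(bump_profile k \<longlongrightarrow> 0) (at_left 0)" by (rule tendsto_eventually)
  from L R show ?thesis by (simp add: filterlim_split_at)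
qed

lemma bump_profile_DERIV:
  "(bump_profile k has_real_derivative (bump_profile (k + 2) s - real k * bump_profile (k + 1) s)) (at s)"
proof -
  consider "s < 0" | "s = 0" | "s > 0" by linarith
  then show ?thesis
  proof cases
    case 1
    have "((\<lambda>s. 0) has_real_derivative 0) (at s)" by simp
    then have "(bump_profile k has_real_derivative 0) (at s)"
      by (rule has_field_derivative_transform_within_open[where S="{..<0}"]) (use 1 in \<open>auto simp: bump_profile_def\<close>)
    then show ?thesis using 1 by (simp add: bump_profile_def)
  next
    case 2
    have "((\<lambda>h. bump_profile k h / h) \<longlongrightarrow> 0) (at 0)"
      by (rule Lim_transform_eventually[OF bump_profile_tendsto_0[of "Suc k"]])
        (auto simp: bump_profile_def eventually_at_filter)
    then show ?thesis using 2 by (simp add: DERIV_def bump_profile_def)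
  next
    case 3
    have d: "((\<lambda>s. 1 / s) has_real_derivative - ((1 / s)\<^sup>2)) (at s)"
      using 3 by (auto intro!: derivative_eq_intros simp: power2_eq_square)
    have "((\<lambda>s. (1 / s) ^ k * exp (- (1 / s))) has_real_derivative
        (real k * (- ((1 / s)\<^sup>2) * (1 / s) ^ (k - Suc 0))) * exp (- (1 / s))
        + (exp (- (1 / s)) * (- (- ((1 / s)\<^sup>2)))) * (1 / s) ^ k) (at s)"
      by (intro DERIV_mult DERIV_power[OF d] DERIV_fun_exp DERIV_minus d)
    then have "((\<lambda>s. (1 / s) ^ k * exp (- (1 / s))) has_real_derivative
        (bump_profile (k + 2) s - real k * bump_profile (k + 1) s)) (at s)"
      by (rule DERIV_cong) (use 3 in \<open>cases k; simp add: bump_profile_def power2_eq_square algebra_simps\<close>)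
    then show ?thesis
      by (rule has_field_derivative_transform_within_open[where S="{0<..}"]) (use 3 in \<open>auto simp: bump_profile_def\<close>)
  qed
qed

lemma Ck_on_bump: "Ck_on n UNIV (\<lambda>x::'a::euclidean_space. bump_profile k (r - x \<bullet> x))"
proof (induction n arbitrary: k)
  case 0
  have "continuous_on UNIV (bump_profile k)"
    by (rule DERIV_continuous_on[OF has_field_derivative_at_within[OF bump_profile_DERIV]])
  then show ?case
    by (auto intro!: continuous_on_compose2[of UNIV "bump_profile k"] continuous_intros)
next
  case (Suc n)
  let ?D = "\<lambda>x. bump_profile (k + 2) (r - x \<bullet> x) - real k * bump_profile (k + 1) (r - x \<bullet> x)"
  have d: "((\<lambda>x::'a. bump_profile k (r - x \<bullet> x)) has_derivative (\<lambda>h. ?D x * (- 2 * (x \<bullet> h)))) (at x)" for x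
  proof -
    have i: "((\<lambda>x. r - x \<bullet> x) has_derivative (\<lambda>h. - 2 * (x \<bullet> h))) (at x)"
      by (auto intro!: derivative_eq_intros simp: inner_commute)
    show ?thesis
      by (rule has_derivative_compose[OF i bump_profile_DERIV[unfolded has_field_derivative_def]])
  qed
  have "Ck_on n UNIV (pd b (\<lambda>x::'a. bump_profile k (r - x \<bullet> x)))" for b
  proof -
    have "pd b (\<lambda>x::'a. bump_profile k (r - x \<bullet> x)) = (\<lambda>x. (bump_profile (k + 2) (r - x \<bullet> x)
        + (- real k) * bump_profile (k + 1) (r - x \<bullet> x)) * (- 2 * (x \<bullet> b)))"
      using pdI[OF d, of b] by auto
    then show ?thesis
      by (simp only:) (intro Ck_on_mult Ck_on_add Ck_on_const Ck_on_linear[OF bounded_linear_inner_left] Suc open_UNIV)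
  qed
  then show ?case by (auto simp: Ck_on_Suc_open intro!: differentiableI[OF d])
qed

lemma Ck_on_polynomial:
  "real_polynomial_function q \<Longrightarrow> Ck_on n UNIV (q :: 'a::euclidean_space \<Rightarrow> real)"
  by (induction rule: real_polynomial_function.induct)
    (auto intro: Ck_on_linear Ck_on_const Ck_on_add Ck_on_mult)

lemma bump_polynomial_test_function:
  assumes q: "real_polynomial_function (q :: 'a::euclidean_space \<Rightarrow> real)" and r: "0 < r" "r < 1"
  shows "(\<lambda>x. bump_profile 0 (r\<^sup>2 - x \<bullet> x) * q x) \<in> test_functions (ball 0 1)"
proof -
  let ?S = "{x. bump_profile 0 (r\<^sup>2 - x \<bullet> x) * q x \<noteq> 0}"
  have "?S \<subseteq> cball 0 r"
  proof
    fix x assume "x \<in> ?S"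
    then have "(norm x)\<^sup>2 < r\<^sup>2" by (auto simp: bump_profile_def dot_square_norm split: if_splits)
    then have "norm x < r" by (rule power_less_imp_less_base) (use r in simp)
    then show "x \<in> cball 0 r" by simp
  qed
  then have s: "closure ?S \<subseteq> cball 0 r" by (rule closure_minimal) simp
  then have "compact (closure ?S)" using compact_eq_bounded_closed bounded_subset[OF bounded_cball] by blast
  moreover have "cball 0 r \<subseteq> ball (0::'a) 1" using r by auto
  ultimately show ?thesis
    using s by (auto simp: test_functions_def intro!: Ck_on_mult Ck_on_bump Ck_on_polynomial[OF q])
qed

text \<open>Polynomial multiples of a bump are test functions; Weierstrass approximation replaces the
  polynomial by any continuous function, and these approximate the sign of \<open>h\<close> almost everywhere.\<close>

lemma test_functions_separate:
  fixes h :: "'a::euclidean_space \<Rightarrow> real"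
  assumes h: "integrable (lebesgue_on (ball 0 1)) h"
    and t: "\<And>\<eta>. \<eta> \<in> test_functions (ball 0 1) \<Longrightarrow> (LINT x|lebesgue_on (ball 0 1). \<eta> x * h x) = 0"
  shows "AE x in lebesgue_on (ball 0 1). h x = 0"
proof -
  let ?M = "lebesgue_on (ball (0::'a) 1)"
  have hm: "h \<in> borel_measurable ?M" using h by (rule borel_measurable_integrable)
  have aer: "AE x in ?M. norm x < r \<longrightarrow> h x = 0" if r: "0 < r" "r < 1" for r
  proof -
    define z where "z x = bump_profile 0 (r\<^sup>2 - x \<bullet> x)" for x :: 'a
    have z01: "0 \<le> z x" "z x \<le> 1" for x by (auto simp: z_def bump_profile_def)
    have zc: "continuous_on UNIV z" unfolding z_def by (rule Ck_on_continuous[OF Ck_on_bump])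
    have meas: "k \<in> borel_measurable ?M" if "continuous_on UNIV k" for k :: "'a \<Rightarrow> real"
      using that by (intro continuous_imp_measurable_on_sets_lebesgue) (auto intro: continuous_on_subset)
    have zh: "integrable ?M (\<lambda>x. z x * k x * h x)" if k: "continuous_on UNIV k" "\<And>x. x \<in> ball 0 1 \<Longrightarrow> \<bar>k x\<bar> \<le> C" for k C
    proof (rule Bochner_Integration.integrable_bound[OF integrable_mult_right[OF h, where c=C]])
      show "(\<lambda>x. z x * k x * h x) \<in> borel_measurable ?M"
        by (intro borel_measurable_times meas zc k hm)
      show "AE x in ?M. norm (z x * k x * h x) \<le> norm (C * h x)"
      proof (rule AE_I2)
        fix x assume "x \<in> space ?M"
        then have kx: "\<bar>k x\<bar> \<le> C" using k(2) by simp
        have "\<bar>z x\<bar> * \<bar>k x\<bar> * \<bar>h x\<bar> \<le> 1 * C * \<bar>h x\<bar>"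
          using z01[of x] kx by (intro mult_right_mono mult_mono) auto
        also have "\<dots> \<le> \<bar>C\<bar> * \<bar>h x\<bar>" by (intro mult_right_mono) auto
        finally show "norm (z x * k x * h x) \<le> norm (C * h x)" by (simp add: abs_mult)
      qed
    qed
    have bdd: "\<exists>C. \<forall>x\<in>ball 0 1. \<bar>k x\<bar> \<le> C" if "continuous_on UNIV k" for k :: "'a \<Rightarrow> real"
    proof -
      have "bounded (k ` cball 0 1)"
        by (intro compact_imp_bounded compact_continuous_image compact_cball continuous_on_subset[OF that]) auto
      then obtain C where "\<forall>x\<in>cball 0 1. norm (k x) \<le> C" unfolding bounded_iff by blast
      then show ?thesis by (intro exI[of _ C]) auto
    qed
    have cont0: "(LINT x|?M. z x * k x * h x) = 0" if k: "continuous_on UNIV k" for k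
    proof -
      define H where "H = (LINT x|?M. \<bar>h x\<bar>)"
      have "\<bar>LINT x|?M. z x * k x * h x\<bar> \<le> e * H" if e: "e > 0" for e
      proof -
        obtain q where q: "polynomial_function q" "\<And>x. x \<in> cball 0 1 \<Longrightarrow> norm (k x - q x) < e"
          using Stone_Weierstrass_polynomial_function[OF compact_cball continuous_on_subset[OF k subset_UNIV] e, of 0 1]
          by blast
        have rq: "real_polynomial_function q" using q(1) by (simp add: real_polynomial_function_eq)
        have qc: "continuous_on UNIV q" by (rule Ck_on_continuous[OF Ck_on_polynomial[OF rq, of 0]])
        have q0: "(LINT x|?M. z x * q x * h x) = 0"
          using t[OF bump_polynomial_test_function[OF rq r]] by (simp add: z_def)
        obtain C C' where C: "\<forall>x\<in>ball 0 1. \<bar>k x\<bar> \<le> C" "\<forall>x\<in>ball 0 1. \<bar>q x\<bar> \<le> C'"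
          using bdd[OF k] bdd[OF qc] by blast
        have i: "integrable ?M (\<lambda>x. z x * k x * h x)" "integrable ?M (\<lambda>x. z x * q x * h x)"
          using zh[OF k, of C] zh[OF qc, of C'] C by auto
        have "(LINT x|?M. z x * k x * h x) = (LINT x|?M. z x * k x * h x - z x * q x * h x)"
          using q0 i by simp
        also have "\<bar>\<dots>\<bar> \<le> (LINT x|?M. e * \<bar>h x\<bar>)"
        proof (rule order_trans[OF integral_abs_bound], rule integral_mono)
          show "integrable ?M (\<lambda>x. \<bar>z x * k x * h x - z x * q x * h x\<bar>)" using i by auto
          show "integrable ?M (\<lambda>x. e * \<bar>h x\<bar>)" using h by auto
          fix x assume "x \<in> space ?M"
          then have "x \<in> cball 0 1" by simp
          from q(2)[OF this] have "\<bar>z x\<bar> * \<bar>k x - q x\<bar> * \<bar>h x\<bar> \<le> 1 * e * \<bar>h x\<bar>"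
            using z01[of x] by (intro mult_right_mono mult_mono) auto
          then show "\<bar>z x * k x * h x - z x * q x * h x\<bar> \<le> e * \<bar>h x\<bar>"
            by (simp add: abs_mult[symmetric] algebra_simps)
        qed
        finally show ?thesis by (simp add: H_def)
      qed
      note est = this
      have H0: "H \<ge> 0" by (simp add: H_def)
      have "\<bar>LINT x|?M. z x * k x * h x\<bar> \<le> 0 + e" if "e > 0" for e
      proof -
        have "\<bar>LINT x|?M. z x * k x * h x\<bar> \<le> e / (H + 1) * H" using that H0 by (intro est) simp
        also have "\<dots> \<le> e" using that H0 by (simp add: divide_le_eq)
        finally show ?thesis by simp
      qed
      then have "\<bar>LINT x|?M. z x * k x * h x\<bar> \<le> 0" by (rule field_le_epsilon)
      then show ?thesis by simp
    qed
    have "(\<lambda>x. sgn (h x)) \<in> borel_measurable ?M"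
      unfolding sgn_if using hm by measurable
    then have "(\<lambda>x. sgn (h x)) measurable_on (ball 0 1)"
      by (simp add: measurable_on_iff_borel_measurable)
    then obtain Z g where Z: "negligible Z" and g: "\<And>n. continuous_on UNIV (g n)"
      and gl: "\<And>x. x \<notin> Z \<Longrightarrow> (\<lambda>n. g n x) \<longlonglongrightarrow> (if x \<in> ball 0 1 then sgn (h x) else 0)"
      unfolding measurable_on_def by blast
    \<comment> \<open>Truncation makes the approximants of the sign uniformly bounded.\<close>
    define k where "k n x = max (-1) (min 1 (g n x))" for n x
    have kc: "continuous_on UNIV (k n)" for n unfolding k_def by (intro continuous_intros g)
    have k1: "\<bar>k n x\<bar> \<le> 1" for n x by (auto simp: k_def)
    have "Z \<in> null_sets lebesgue" using Z by (simp add: negligible_iff_null_sets)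
    then have aeZ: "AE x in ?M. x \<notin> Z"
      by (subst AE_restrict_space_iff) (auto simp: eventually_ae_filter)
    have "(\<lambda>n. LINT x|?M. z x * k n x * h x) \<longlonglongrightarrow> (LINT x|?M. z x * \<bar>h x\<bar>)"
    proof (rule integral_dominated_convergence[where w="\<lambda>x. \<bar>h x\<bar>"])
      show "(\<lambda>x. z x * \<bar>h x\<bar>) \<in> borel_measurable ?M"
        by (intro borel_measurable_times meas zc borel_measurable_abs hm)
      show "(\<lambda>x. z x * k n x * h x) \<in> borel_measurable ?M" for n
        by (intro borel_measurable_times meas zc kc hm)
      show "integrable ?M (\<lambda>x. \<bar>h x\<bar>)" using h by auto
      have "AE x in ?M. x \<in> ball 0 1" by (rule AE_I2) simp
      with aeZ show "AE x in ?M. (\<lambda>n. z x * k n x * h x) \<longlonglongrightarrow> z x * \<bar>h x\<bar>"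
      proof eventually_elim
        case (elim x)
        then have "(\<lambda>n. g n x) \<longlonglongrightarrow> sgn (h x)" using gl[of x] by simp
        then have "(\<lambda>n. z x * k n x * h x) \<longlonglongrightarrow> z x * max (-1) (min 1 (sgn (h x))) * h x"
          unfolding k_def by (intro tendsto_intros)
        moreover have "max (-1) (min 1 (sgn (h x))) * h x = \<bar>h x\<bar>" by (simp add: sgn_if)
        ultimately show ?case by (simp add: mult.assoc)
      qed
      show "AE x in ?M. norm (z x * k n x * h x) \<le> \<bar>h x\<bar>" for n
      proof (rule AE_I2)
        fix x
        have "\<bar>z x\<bar> * \<bar>k n x\<bar> * \<bar>h x\<bar> \<le> 1 * 1 * \<bar>h x\<bar>"
          using z01[of x] k1[of n x] by (intro mult_right_mono mult_mono) auto
        then show "norm (z x * k n x * h x) \<le> \<bar>h x\<bar>" by (simp add: abs_mult)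
      qed
    qed
    then have "(LINT x|?M. z x * \<bar>h x\<bar>) = 0"
      unfolding cont0[OF kc] by (simp add: LIMSEQ_const_iff)
    moreover have "integrable ?M (\<lambda>x. z x * 1 * h x)" using zh[of "\<lambda>x. 1" 1] by auto
    then have "integrable ?M (\<lambda>x. z x * \<bar>h x\<bar>)"
      using integrable_abs[of ?M "\<lambda>x. z x * 1 * h x"] z01 by (simp add: abs_mult)
    ultimately have "AE x in ?M. z x * \<bar>h x\<bar> = 0"
      using integral_nonneg_eq_0_iff_AE[of ?M "\<lambda>x. z x * \<bar>h x\<bar>"] z01 by auto
    then show ?thesis
    proof eventually_elim
      case (elim x)
      show ?case
      proof
        assume "norm x < r"
        then have "(norm x)\<^sup>2 < r\<^sup>2" by (intro power_strict_mono) auto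
        then have "z x \<noteq> 0" by (simp add: z_def bump_profile_def dot_square_norm)
        then show "h x = 0" using elim by simp
      qed
    qed
  qed
  have "AE x in ?M. \<forall>n. norm x < 1 - 1 / real (n + 2) \<longrightarrow> h x = 0"
    unfolding AE_all_countable by (intro allI aer) auto
  moreover have "AE x in ?M. norm x < 1" by (rule AE_I2) simp
  ultimately show ?thesis
  proof eventually_elim
    case (elim x)
    obtain n where n: "inverse (real (Suc n)) < 1 - norm x" using reals_Archimedean[of "1 - norm x"] elim by auto
    have "1 / real (n + 2) \<le> inverse (real (Suc n))" by (simp add: field_simps)
    then have "norm x < 1 - 1 / real (n + 2)" using n by linarith
    then show ?case using elim by blast
  qed
qed

lemma weak_partial_unique:
  fixes g :: "'a::euclidean_space \<Rightarrow> complex"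
  assumes h: "h1 \<in> L2_on (ball 0 1)" "h2 \<in> L2_on (ball 0 1)"
    and w: "is_weak_partial (ball 0 1) b g h1" "is_weak_partial (ball 0 1) b g h2"
  shows "AE x in lebesgue_on (ball 0 1). h1 x = h2 x"
proof -
  let ?M = "lebesgue_on (ball (0::'a) 1)"
  define h where "h x = h1 x - h2 x" for x
  have hL: "h \<in> L2_on (ball 0 1)" unfolding h_def by (rule L2_on_diff[OF h])
  have one: "(\<lambda>x. 1) \<in> L2_on (ball (0::'a) 1)" by (rule L2_on_bounded[where B=1]) auto
  have hi: "integrable ?M h" using L2_on_mult_integrable[OF hL one] by simp
  have t: "(LINT x|?M. \<eta> x *\<^sub>R h x) = 0" and ti: "integrable ?M (\<lambda>x. \<eta> x *\<^sub>R h x)"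
    if "\<eta> \<in> test_functions (ball 0 1)" for \<eta>
  proof -
    have e: "(LINT x|?M. \<eta> x *\<^sub>R h1 x) = (LINT x|?M. \<eta> x *\<^sub>R h2 x)"
      using w that unfolding is_weak_partial_def by (metis neg_equal_iff_equal)
    have i: "integrable ?M (\<lambda>x. \<eta> x *\<^sub>R h1 x)" "integrable ?M (\<lambda>x. \<eta> x *\<^sub>R h2 x)"
      using L2_on_mult_integrable[OF h(1) test_function_L2(1)[OF that open_ball]]
        L2_on_mult_integrable[OF h(2) test_function_L2(1)[OF that open_ball]]
      by (simp_all add: scaleR_conv_of_real mult.commute)
    then show "integrable ?M (\<lambda>x. \<eta> x *\<^sub>R h x)" by (simp add: h_def scaleR_right_diff_distrib)
    show "(LINT x|?M. \<eta> x *\<^sub>R h x) = 0" using i e by (simp add: h_def scaleR_right_diff_distrib)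
  qed
  have "AE x in ?M. Re (h x) = 0"
  proof (rule test_functions_separate)
    show "integrable ?M (\<lambda>x. Re (h x))" by (rule integrable_Re[OF hi])
    show "(LINT x|?M. \<eta> x * Re (h x)) = 0" if "\<eta> \<in> test_functions (ball 0 1)" for \<eta>
      using integral_Re[OF ti[OF that]] t[OF that] by simp
  qed
  moreover have "AE x in ?M. Im (h x) = 0"
  proof (rule test_functions_separate)
    show "integrable ?M (\<lambda>x. Im (h x))" by (rule integrable_Im[OF hi])
    show "(LINT x|?M. \<eta> x * Im (h x)) = 0" if "\<eta> \<in> test_functions (ball 0 1)" for \<eta>
      using integral_Im[OF ti[OF that]] t[OF that] by simp
  qed
  ultimately show ?thesis by eventually_elim (simp add: h_def complex_eq_iff)
qed

text \<open>The choice made in the definition of the weak partial derivative does not affect the norm.\<close>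

lemma H1_norm_eq:
  fixes g :: "'a::euclidean_space \<Rightarrow> complex"
  assumes W: "\<And>b. b \<in> Basis \<Longrightarrow> W b \<in> L2_on (ball 0 1)"
    "\<And>b. b \<in> Basis \<Longrightarrow> is_weak_partial (ball 0 1) b g (W b)"
  shows "H1_norm (ball 0 1) g = sqrt ((L2_norm (ball 0 1) g)\<^sup>2 + (\<Sum>b\<in>Basis. (L2_norm (ball 0 1) (W b))\<^sup>2))"
proof -
  have "L2_norm (ball 0 1) (weak_partial (ball 0 1) b g) = L2_norm (ball 0 1) (W b)" if b: "b \<in> Basis" for b
  proof -
    have "weak_partial (ball 0 1) b g \<in> L2_on (ball 0 1) \<and> is_weak_partial (ball 0 1) b g (weak_partial (ball 0 1) b g)"
      unfolding weak_partial_def by (rule someI[of _ "W b"]) (use W b in blast)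
    then show ?thesis
      using weak_partial_unique[OF _ W(1)[OF b] _ W(2)[OF b]] W(1)[OF b]
      by (intro L2_norm_cong_AE) (auto dest: L2_on_measurable)
  qed
  then show ?thesis by (simp add: H1_norm_def)
qed

section \<open>Coefficients with respect to an eigenfunction basis\<close>

lemma inner_c_add_left:
  assumes "g \<in> L2_on unit_disk" "g' \<in> L2_on unit_disk" "h \<in> L2_on unit_disk"
  shows "inner_c c (\<lambda>x. g x + g' x) h = inner_c c g h + inner_c c g' h"
  using L2_on_mult_integrable[OF assms(1,3)] L2_on_mult_integrable[OF assms(2,3)]
  by (simp add: inner_c_eq distrib_right distrib_left)

lemma inner_c_scale_left: "inner_c c (\<lambda>x. a * g x) h = a * inner_c c g h"
  by (simp add: inner_c_eq mult.assoc)

lemma inner_c_diff_left: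
  assumes "g \<in> L2_on unit_disk" "g' \<in> L2_on unit_disk" "h \<in> L2_on unit_disk"
  shows "inner_c c (\<lambda>x. g x - g' x) h = inner_c c g h - inner_c c g' h"
  using L2_on_mult_integrable[OF assms(1,3)] L2_on_mult_integrable[OF assms(2,3)]
  by (simp add: inner_c_eq left_diff_distrib right_diff_distrib)

lemma inner_c_sum_left:
  assumes "\<And>n. n \<in> I \<Longrightarrow> g n \<in> L2_on unit_disk" "h \<in> L2_on unit_disk"
  shows "inner_c c (\<lambda>x. \<Sum>n\<in>I. a n * g n x) h = (\<Sum>n\<in>I. a n * inner_c c (g n) h)"
  using assms(1)
proof (induction I rule: infinite_finite_induct)
  case (insert n I)
  have "inner_c c (\<lambda>x. a n * g n x + (\<Sum>n\<in>I. a n * g n x)) h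
      = inner_c c (\<lambda>x. a n * g n x) h + inner_c c (\<lambda>x. \<Sum>n\<in>I. a n * g n x) h"
    using insert.prems by (intro inner_c_add_left L2_on_scale L2_on_sum assms(2)) auto
  then show ?case using insert by (simp add: inner_c_scale_left)
qed (auto simp: inner_c_eq)

lemma inner_c_Cauchy_Schwarz:
  assumes "g \<in> L2_on unit_disk" "h \<in> L2_on unit_disk"
  shows "norm (inner_c c g h) \<le> L2_norm unit_disk g * L2_norm unit_disk h / c\<^sup>2"
proof -
  have "norm (inner_c c g h) = norm (LINT x|lebesgue_on unit_disk. g x * cnj (h x)) / c\<^sup>2"
    by (simp add: inner_c_eq norm_mult norm_divide norm_power)
  then show ?thesis using L2_Cauchy_Schwarz[OF assms] by (simp add: divide_right_mono)
qed

lemma inner_c_tendsto: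
  assumes S: "\<And>n. S n \<in> L2_on unit_disk" "g \<in> L2_on unit_disk" and l: "((\<lambda>n. L2_norm unit_disk (\<lambda>x. S n x - g x)) \<longlongrightarrow> 0) F"
    and h: "h \<in> L2_on unit_disk"
  shows "((\<lambda>n. inner_c c (S n) h) \<longlongrightarrow> inner_c c g h) F"
proof (rule LIM_zero_cancel, rule Lim_null_comparison)
  show "\<forall>\<^sub>F n in F. norm (inner_c c (S n) h - inner_c c g h)
      \<le> L2_norm unit_disk (\<lambda>x. S n x - g x) * (L2_norm unit_disk h / c\<^sup>2)"
  proof (rule always_eventually, rule allI)
    fix n
    show "norm (inner_c c (S n) h - inner_c c g h) \<le> L2_norm unit_disk (\<lambda>x. S n x - g x) * (L2_norm unit_disk h / c\<^sup>2)"
      using inner_c_Cauchy_Schwarz[OF L2_on_diff[OF S(1)[of n] S(2)] h, of c]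
      by (simp add: inner_c_diff_left[OF S(1)[of n] S(2) h])
  qed
  show "((\<lambda>n. L2_norm unit_disk (\<lambda>x. S n x - g x) * (L2_norm unit_disk h / c\<^sup>2)) \<longlongrightarrow> 0) F"
    using tendsto_mult_right[OF l, of "L2_norm unit_disk h / c\<^sup>2"] by simp
qed

lemma orthonormal_basisD:
  assumes "orthonormal_basis_c c e"
  shows "e n \<in> L2_on unit_disk" "inner_c c (e m) (e n) = (if m = n then 1 else 0)"
    "g \<in> L2_on unit_disk \<Longrightarrow> L2_sums unit_disk (\<lambda>n x. inner_c c g (e n) * e n x) g"
  using assms by (auto simp: orthonormal_basis_c_def)

lemma L2_sums_coefficient:
  assumes B: "orthonormal_basis_c c e" and s: "L2_sums unit_disk (\<lambda>n x. a n * e n x) g"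
  shows "inner_c c g (e m) = a m"
proof -
  note eL = orthonormal_basisD(1)[OF B]
  have S: "(\<lambda>x. \<Sum>n<N. a n * e n x) \<in> L2_on unit_disk" for N by (intro L2_on_sum L2_on_scale eL)
  have "(\<lambda>N. inner_c c (\<lambda>x. \<Sum>n<N. a n * e n x) (e m)) \<longlonglongrightarrow> inner_c c g (e m)"
    by (rule inner_c_tendsto[OF S _ _ eL]) (use s in \<open>auto simp: L2_sums_def\<close>)
  moreover have "\<forall>\<^sub>F N in sequentially. inner_c c (\<lambda>x. \<Sum>n<N. a n * e n x) (e m) = a m"
  proof (rule eventually_sequentiallyI[of "Suc m"])
    fix N assume "N \<ge> Suc m"
    then show "inner_c c (\<lambda>x. \<Sum>n<N. a n * e n x) (e m) = a m"
      by (simp add: inner_c_sum_left[OF eL eL] orthonormal_basisD(2)[OF B] if_distrib[of "\<lambda>z. _ * z"] cong: if_cong)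
  qed
  then have "(\<lambda>N. inner_c c (\<lambda>x. \<Sum>n<N. a n * e n x) (e m)) \<longlonglongrightarrow> a m" by (rule tendsto_eventually)
  ultimately show ?thesis by (rule LIMSEQ_unique)
qed

lemma Parseval:
  assumes B: "orthonormal_basis_c c e" and c: "c > 0" and g: "g \<in> L2_on unit_disk"
  shows "(\<lambda>N. \<Sum>n<N. (norm (inner_c c g (e n)))\<^sup>2) \<longlonglongrightarrow> (L2_norm unit_disk g)\<^sup>2 / c\<^sup>2"
proof -
  let ?S = "\<lambda>N x. \<Sum>n<N. inner_c c g (e n) * e n x"
  have "(\<lambda>N. (L2_norm unit_disk (?S N))\<^sup>2) \<longlonglongrightarrow> (L2_norm unit_disk g)\<^sup>2"
    by (intro tendsto_power L2_norm_tendsto L2_on_sum L2_on_scale orthonormal_basisD(1)[OF B] g)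
      (use orthonormal_basisD(3)[OF B g] in \<open>simp add: L2_sums_def\<close>)
  then have "(\<lambda>N. c\<^sup>2 * (\<Sum>n<N. (norm (inner_c c g (e n)))\<^sup>2)) \<longlonglongrightarrow> (L2_norm unit_disk g)\<^sup>2"
    by (simp add: orthonormal_sum_norm[OF B c])
  from tendsto_divide[OF this tendsto_const[of "c\<^sup>2"]] show ?thesis using c by simp
qed

lemma Bessel:
  assumes B: "orthonormal_basis_c c e" and c: "c > 0" and g: "g \<in> L2_on unit_disk"
  shows "(\<Sum>n<N. (norm (inner_c c g (e n)))\<^sup>2) \<le> (L2_norm unit_disk g)\<^sup>2 / c\<^sup>2"
proof (rule incseq_le[OF _ Parseval[OF assms]])
  show "incseq (\<lambda>N. \<Sum>n<N. (norm (inner_c c g (e n)))\<^sup>2)"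
    by (intro incseq_SucI) simp
qed

lemma norm_le_of_coefficients:
  assumes B: "orthonormal_basis_c c e" and c: "c > 0" and g: "g \<in> L2_on unit_disk"
    and b: "\<And>N. (\<Sum>n<N. (norm (inner_c c g (e n)))\<^sup>2) \<le> d\<^sup>2" and d: "d \<ge> 0"
  shows "L2_norm unit_disk g \<le> c * d"
proof -
  have "(L2_norm unit_disk g)\<^sup>2 / c\<^sup>2 \<le> d\<^sup>2"
    by (rule LIMSEQ_le_const2[OF Parseval[OF B c g]]) (use b in auto)
  then have "(L2_norm unit_disk g)\<^sup>2 \<le> (c * d)\<^sup>2" using c by (simp add: divide_le_eq power_mult_distrib mult.commute)
  then show ?thesis by (rule power2_le_imp_le) (use c d in auto)
qed

section \<open>Energy of the forward solution\<close>

lemma integral_sin_sq_lower: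
  fixes l :: real
  assumes "l \<ge> 1"
  shows "1/4 \<le> (LINT t|lebesgue_on {0..1}. (sin (l * t))\<^sup>2)"
proof -
  let ?P = "\<lambda>t::real. t / 2 - sin (2 * (l * t)) / (4 * l)"
  have "((\<lambda>t. (sin (l * t))\<^sup>2) has_integral (?P 1 - ?P 0)) {0..1}"
  proof (rule fundamental_theorem_of_calculus)
    fix t :: real
    have "(?P has_real_derivative (1 / 2 - (cos (2 * (l * t)) * (2 * l)) / (4 * l))) (at t within {0..1})"
      by (auto intro!: derivative_eq_intros)
    moreover have "1 / 2 - (cos (2 * (l * t)) * (2 * l)) / (4 * l) = (sin (l * t))\<^sup>2"
    proof -
      have "(cos (2 * (l * t)) * (2 * l)) / (4 * l) = cos (2 * (l * t)) / 2" using assms by simp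
      then show ?thesis by (simp only: cos_double_sin[of "l * t"]) (simp add: field_simps)
    qed
    ultimately show "(?P has_vector_derivative (sin (l * t))\<^sup>2) (at t within {0..1})"
      by (simp add: has_real_derivative_iff_has_vector_derivative)
  qed simp
  then have i: "integral {0..1} (\<lambda>t. (sin (l * t))\<^sup>2) = 1 / 2 - sin (2 * l) / (4 * l)"
    by (simp add: integral_unique)
  have c: "continuous_on {0..1} (\<lambda>t. (sin (l * t))\<^sup>2)" by (intro continuous_intros)
  have "(LINT t|lebesgue_on {0..1}. (sin (l * t))\<^sup>2) = integral {0..1} (\<lambda>t. (sin (l * t))\<^sup>2)"
    by (rule lebesgue_integral_eq_integral[OF continuous_imp_integrable_real[OF c]]) simp
  also have "\<dots> \<ge> 1/4"
  proof -
    have "sin (2 * l) / (4 * l) \<le> 1 / (4 * l)" using assms by (intro divide_right_mono) auto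
    also have "\<dots> \<le> 1 / 4" using assms by simp
    finally show ?thesis unfolding i by simp
  qed
  finally show ?thesis .
qed

text \<open>Pointwise boundedness of \<open>\<Sum> p\<^sub>n sin\<^sup>2(l\<^sub>n t)\<close> is uniform on a set of times of measure close to
  1, and on such a set the average of each \<open>sin\<^sup>2(l\<^sub>n t)\<close> with \<open>l\<^sub>n \<ge> 1\<close> is bounded below.\<close>

lemma sum_bounded_of_sin_sq:
  fixes p l :: "nat \<Rightarrow> real"
  assumes p: "\<And>n. p n \<ge> 0" and G: "\<And>t. t \<in> {0..1} \<Longrightarrow> \<exists>G. \<forall>N. (\<Sum>n<N. p n * (sin (l n * t))\<^sup>2) \<le> G"
    and low: "\<And>N. (\<Sum>n | n < N \<and> l n < 1. p n) \<le> G0"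
  obtains C where "\<And>N. (\<Sum>n<N. p n) \<le> C"
proof -
  let ?M = "lebesgue_on {0..1::real}"
  define S where "S N t = (\<Sum>n<N. p n * (sin (l n * t))\<^sup>2)" for N t
  define E where "E m = {t\<in>{0..1}. \<forall>N. S N t \<le> real m}" for m
  have Sc: "continuous_on A (S N)" for N A unfolding S_def by (intro continuous_intros)
  have Ecl: "closed (E m)" for m
  proof -
    have "E m = {0..1} \<inter> (\<Inter>N. {t. S N t \<le> real m})" by (auto simp: E_def)
    then show ?thesis by (auto intro!: closed_Int closed_INT closed_Collect_le Sc)
  qed
  have Esub: "E m \<subseteq> {0..1}" for m by (auto simp: E_def)
  have Em: "E m \<in> lmeasurable" for m
    using Ecl bounded_subset[OF bounded_closed_interval Esub]
    by (intro lmeasurable_compact) (simp add: compact_eq_bounded_closed)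
  have inc: "incseq E"
  proof (rule incseq_SucI, rule subsetI)
    fix m t assume "t \<in> E m"
    then have t: "t \<in> {0..1}" "\<And>N. S N t \<le> real m" by (auto simp: E_def)
    have "S N t \<le> real (Suc m)" for N using t(2)[of N] by simp
    then show "t \<in> E (Suc m)" using t(1) by (simp add: E_def)
  qed
  have UE: "(\<Union>m. E m) = {0..1}"
  proof
    show "{0..1} \<subseteq> (\<Union>m. E m)"
    proof
      fix t :: real assume t: "t \<in> {0..1}"
      then obtain g where g: "\<forall>N. S N t \<le> g" using G[OF t] by (auto simp: S_def)
      obtain m where "g \<le> real m" using real_arch_simple by blast
      then have "S N t \<le> real m" for N using spec[OF g, of N] by linarith
      then have "t \<in> E m" using t by (simp add: E_def)
      then show "t \<in> (\<Union>m. E m)" by blast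
    qed
  qed (use Esub in blast)
  have "(\<lambda>m. measure lebesgue (E m)) \<longlonglongrightarrow> measure lebesgue (\<Union>m. E m)"
  proof (rule Lim_measure_incseq[OF _ inc])
    show "range E \<subseteq> sets lebesgue" using Em fmeasurableD by blast
    show "emeasure lebesgue (\<Union>m. E m) \<noteq> \<infinity>" unfolding UE by simp
  qed
  then have "(\<lambda>m. measure lebesgue (E m)) \<longlonglongrightarrow> 1" unfolding UE by simp
  then have "\<forall>\<^sub>F m in sequentially. 7/8 < measure lebesgue (E m)" by (rule order_tendstoD) simp
  then obtain m where m: "7/8 < measure lebesgue (E m)"
    using eventually_happens'[OF sequentially_bot] by blast
  have EM: "E m \<in> sets ?M" using Em Esub by (auto simp: sets_restrict_space_iff fmeasurableD)
  have iI: "(LINT t|?M. indicator (E m) t :: real) = measure lebesgue (E m)"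
    using EM Esub[of m] by (simp add: measure_restrict_space Int_absorb2)
  have one: "integrable ?M (\<lambda>t. 1 :: real)" by (rule continuous_imp_integrable_real) simp
  have ind: "integrable ?M (indicator (E m) :: real \<Rightarrow> real)"
    using integrable_mult_indicator[OF EM one] by simp
  have ic: "integrable ?M (\<lambda>t. indicator (E m) t * k t)" if "continuous_on {0..1} k" for k :: "real \<Rightarrow> real"
    using integrable_mult_indicator[OF EM continuous_imp_integrable_real[OF that]] by simp
  have low8: "1/8 \<le> (LINT t|?M. indicator (E m) t * (sin (l n * t))\<^sup>2)" if n: "l n \<ge> 1" for n
  proof -
    have cs: "continuous_on {0..1} (\<lambda>t. (sin (l n * t))\<^sup>2)" by (intro continuous_intros)
    have si: "integrable ?M (\<lambda>t. (sin (l n * t))\<^sup>2)" by (rule continuous_imp_integrable_real[OF cs])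
    have "1/4 - (1 - measure lebesgue (E m)) \<le> (LINT t|?M. (sin (l n * t))\<^sup>2) - (LINT t|?M. 1 - indicator (E m) t)"
    proof -
      have "(LINT t|?M. (1::real)) = 1" by (simp add: measure_restrict_space)
      then have "(LINT t|?M. 1 - indicator (E m) t) = 1 - measure lebesgue (E m)"
        unfolding Bochner_Integration.integral_diff[OF one ind] iI by simp
      then show ?thesis using integral_sin_sq_lower[OF n] by linarith
    qed
    also have "\<dots> = (LINT t|?M. (sin (l n * t))\<^sup>2 - (1 - indicator (E m) t))"
      using si one ind by simp
    also have "\<dots> \<le> (LINT t|?M. indicator (E m) t * (sin (l n * t))\<^sup>2)"
    proof (rule integral_mono)
      show "integrable ?M (\<lambda>t. (sin (l n * t))\<^sup>2 - (1 - indicator (E m) t))" using si one ind by simp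
      show "integrable ?M (\<lambda>t. indicator (E m) t * (sin (l n * t))\<^sup>2)" by (rule ic[OF cs])
      fix t
      have "(sin (l n * t))\<^sup>2 \<le> 1" by (simp add: abs_square_le_1)
      then show "(sin (l n * t))\<^sup>2 - (1 - indicator (E m) t) \<le> indicator (E m) t * (sin (l n * t))\<^sup>2"
        by (simp add: indicator_def)
    qed
    finally show ?thesis using m by simp
  qed
  have high: "(\<Sum>n | n < N \<and> \<not> l n < 1. p n) \<le> 8 * real m" for N
  proof -
    have si: "integrable ?M (\<lambda>t. indicator (E m) t * (sin (l n * t))\<^sup>2)" for n
      by (rule ic) (intro continuous_intros)
    have "(\<Sum>n | n < N \<and> \<not> l n < 1. p n) / 8 = (\<Sum>n | n < N \<and> \<not> l n < 1. p n * (1/8))"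
      by (simp add: sum_divide_distrib)
    also have "\<dots> \<le> (\<Sum>n | n < N \<and> \<not> l n < 1. p n * (LINT t|?M. indicator (E m) t * (sin (l n * t))\<^sup>2))"
      by (intro sum_mono mult_left_mono low8 p) auto
    also have "\<dots> \<le> (\<Sum>n<N. p n * (LINT t|?M. indicator (E m) t * (sin (l n * t))\<^sup>2))"
      by (intro sum_mono2) (auto intro!: mult_nonneg_nonneg p)
    also have "\<dots> = (LINT t|?M. (\<Sum>n<N. p n * (indicator (E m) t * (sin (l n * t))\<^sup>2)))"
      using si by (subst Bochner_Integration.integral_sum) auto
    also have "\<dots> \<le> (LINT t|?M. real m)"
    proof (rule integral_mono)
      show "integrable ?M (\<lambda>t. \<Sum>n<N. p n * (indicator (E m) t * (sin (l n * t))\<^sup>2))"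
        using si by (intro Bochner_Integration.integrable_sum integrable_mult_right)
      show "integrable ?M (\<lambda>t. real m)" by (rule continuous_imp_integrable_real) simp
      fix t
      have "(\<Sum>n<N. p n * (indicator (E m) t * (sin (l n * t))\<^sup>2)) = indicator (E m) t * S N t"
        by (simp add: S_def sum_distrib_left mult.left_commute)
      also have "\<dots> \<le> real m" by (cases "t \<in> E m") (auto simp: E_def)
      finally show "(\<Sum>n<N. p n * (indicator (E m) t * (sin (l n * t))\<^sup>2)) \<le> real m" .
    qed
    also have "\<dots> = real m" by (simp add: measure_restrict_space)
    finally show ?thesis by simp
  qed
  have "(\<Sum>n<N. p n) \<le> G0 + 8 * real m" for N
  proof -
    have "(\<Sum>n<N. p n) = (\<Sum>n | n < N \<and> l n < 1. p n) + (\<Sum>n | n < N \<and> \<not> l n < 1. p n)"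
      by (subst sum.union_disjoint[symmetric]) (auto intro!: sum.cong)
    then show ?thesis using low[of N] high[of N] by linarith
  qed
  then show ?thesis by (rule that)
qed

text \<open>Pairing with a fixed basis function is continuous on \<open>L\<^sup>2\<close>, hence commutes with differentiation
  in time.\<close>

lemma time_derivative_coefficient:
  assumes N: "neumann_basis c \<phi> lam"
    and u: "\<And>t. t \<ge> 0 \<Longrightarrow> L2_sums unit_disk (\<lambda>n x. a n * \<phi> n x * of_real (cos (lam n * t))) (u t)"
    and ut: "L2_time_derivative u ut" and t: "t \<ge> 0"
  shows "inner_c c (u t) (\<phi> n) = a n * of_real (cos (lam n * t))"
    and "inner_c c (ut t) (\<phi> n) = - (a n * of_real (lam n * sin (lam n * t)))"
proof -
  have B: "orthonormal_basis_c c \<phi>" using N by (simp add: neumann_basis_def)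
  have cf: "inner_c c (u s) (\<phi> n) = a n * of_real (cos (lam n * s))" if "s \<ge> 0" for s
  proof -
    have "L2_sums unit_disk (\<lambda>n x. (a n * of_real (cos (lam n * s))) * \<phi> n x) (u s)"
      using u[OF that] by (simp add: mult_ac)
    then show ?thesis by (rule L2_sums_coefficient[OF B])
  qed
  show "inner_c c (u t) (\<phi> n) = a n * of_real (cos (lam n * t))" by (rule cf[OF t])
  have uL: "u s \<in> L2_on unit_disk" if "s \<ge> 0" for s using u[OF that] by (simp add: L2_sums_def)
  have utL: "ut t \<in> L2_on unit_disk"
    and lim: "((\<lambda>s. L2_norm unit_disk (\<lambda>x. (u s x - u t x) / of_real (s - t) - ut t x)) \<longlongrightarrow> 0) (at t within {0..})"
    using ut t by (auto simp: L2_time_derivative_def)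
  \<comment> \<open>The difference quotient is set to 0 at negative times, where \<open>u\<close> is arbitrary.\<close>
  define q where "q s x = (if s \<ge> 0 then inverse (of_real (s - t)) * (u s x - u t x) else 0)" for s and x :: "real^2"
  have qL: "q s \<in> L2_on unit_disk" for s
  proof (cases "s \<ge> 0")
    case True
    have "(\<lambda>x. inverse (of_real (s - t)) * (u s x - u t x)) \<in> L2_on unit_disk"
      by (intro L2_on_scale L2_on_diff uL t True)
    then show ?thesis using True by (simp add: q_def[abs_def])
  qed (simp add: q_def[abs_def] L2_on_zero)
  have ev: "\<forall>\<^sub>F s in at t within {0..}. s \<ge> 0 \<and> s \<noteq> t" by (auto simp: eventually_at_filter)
  have "((\<lambda>s. L2_norm unit_disk (\<lambda>x. q s x - ut t x)) \<longlongrightarrow> 0) (at t within {0..})"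
    by (rule Lim_transform_eventually[OF lim], rule eventually_mono[OF ev])
      (simp add: q_def divide_inverse mult.commute)
  from inner_c_tendsto[OF qL utL this orthonormal_basisD(1)[OF B]]
  have 1: "((\<lambda>s. inner_c c (q s) (\<phi> n)) \<longlongrightarrow> inner_c c (ut t) (\<phi> n)) (at t within {0..})" .
  have "((\<lambda>s. cos (lam n * s)) has_real_derivative - sin (lam n * t) * lam n) (at t within {0..})"
    by (auto intro!: derivative_eq_intros)
  then have "((\<lambda>s. (cos (lam n * s) - cos (lam n * t)) / (s - t)) \<longlongrightarrow> - sin (lam n * t) * lam n) (at t within {0..})"
    by (simp add: has_field_derivative_iff)
  then have "((\<lambda>s. a n * of_real ((cos (lam n * s) - cos (lam n * t)) / (s - t))) \<longlongrightarrow> a n * of_real (- sin (lam n * t) * lam n))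
      (at t within {0..})"
    by (intro tendsto_intros)
  moreover have "\<forall>\<^sub>F s in at t within {0..}. a n * of_real ((cos (lam n * s) - cos (lam n * t)) / (s - t)) = inner_c c (q s) (\<phi> n)"
  proof (rule eventually_mono[OF ev])
    fix s assume s: "s \<ge> 0 \<and> s \<noteq> t"
    then have "inner_c c (q s) (\<phi> n) = inverse (of_real (s - t)) * (inner_c c (u s) (\<phi> n) - inner_c c (u t) (\<phi> n))"
      using t by (simp add: q_def[abs_def] inner_c_scale_left inner_c_diff_left[OF uL uL orthonormal_basisD(1)[OF B]])
    then show "a n * of_real ((cos (lam n * s) - cos (lam n * t)) / (s - t)) = inner_c c (q s) (\<phi> n)"
      using s t by (simp add: cf divide_inverse algebra_simps)
  qed
  ultimately have 2: "((\<lambda>s. inner_c c (q s) (\<phi> n)) \<longlongrightarrow> a n * of_real (- sin (lam n * t) * lam n)) (at t within {0..})"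
    by (rule Lim_transform_eventually)
  have "at t within {0..} \<noteq> bot"
  proof -
    have "at_right t \<le> at t within {0..}" using t by (intro at_le) auto
    then show ?thesis using trivial_limit_at_right_real[of t] by (metis bot.extremum_uniqueI)
  qed
  from tendsto_unique[OF this 1 2] show "inner_c c (ut t) (\<phi> n) = - (a n * of_real (lam n * sin (lam n * t)))"
    by (simp add: mult.commute)
qed

text \<open>The time derivative exists at every time, so \<open>\<Sum> lam\<^sub>n\<^sup>2 |a\<^sub>n|\<^sup>2 sin\<^sup>2(lam\<^sub>n t)\<close> is finite for each
  \<open>t\<close>; this already forces finite energy.\<close>

lemma forward_energy_summable:
  assumes nb: "neumann_basis c \<phi> lam" and c: "c > 0" and f: "f \<in> L2_on unit_disk"
    and u: "\<And>t. t \<ge> 0 \<Longrightarrow> L2_sums unit_disk (\<lambda>n x. inner_c c f (\<phi> n) * \<phi> n x * of_real (cos (lam n * t))) (u t)"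
    and ut: "L2_time_derivative u ut"
  shows "summable (\<lambda>n. (1 + (lam n)\<^sup>2) * (norm (inner_c c f (\<phi> n)))\<^sup>2)"
proof -
  have B: "orthonormal_basis_c c \<phi>" using nb by (simp add: neumann_basis_def)
  have lam0: "lam n \<ge> 0" for n using nb by (simp add: neumann_basis_def)
  let ?a = "\<lambda>n. inner_c c f (\<phi> n)"
  let ?p = "\<lambda>n. (lam n)\<^sup>2 * (norm (?a n))\<^sup>2"
  have s0: "(\<Sum>n<N. (norm (?a n))\<^sup>2) \<le> (L2_norm unit_disk f)\<^sup>2 / c\<^sup>2" for N by (rule Bessel[OF B c f])
  have "\<exists>C. \<forall>N. (\<Sum>n<N. ?p n) \<le> C"
  proof (rule sum_bounded_of_sin_sq[of ?p lam "(L2_norm unit_disk f)\<^sup>2 / c\<^sup>2"])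
    show "\<exists>G. \<forall>N. (\<Sum>n<N. ?p n * (sin (lam n * t))\<^sup>2) \<le> G" if t: "t \<in> {0..1}" for t
    proof (intro exI allI)
      fix N
      have t0: "t \<ge> 0" using t by simp
      have "ut t \<in> L2_on unit_disk" using ut t0 by (simp add: L2_time_derivative_def)
      note bes = Bessel[OF B c this, of N]
      have "inner_c c (ut t) (\<phi> n) = - (?a n * of_real (lam n * sin (lam n * t)))" for n
        by (rule time_derivative_coefficient(2)[OF nb u ut t0])
      then have "(norm (inner_c c (ut t) (\<phi> n)))\<^sup>2 = ?p n * (sin (lam n * t))\<^sup>2" for n
        by (simp add: norm_mult power_mult_distrib)
      then show "(\<Sum>n<N. ?p n * (sin (lam n * t))\<^sup>2) \<le> (L2_norm unit_disk (ut t))\<^sup>2 / c\<^sup>2"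
        using bes by simp
    qed
    show "(\<Sum>n | n < N \<and> lam n < 1. ?p n) \<le> (L2_norm unit_disk f)\<^sup>2 / c\<^sup>2" for N
    proof -
      have "(\<Sum>n | n < N \<and> lam n < 1. ?p n) \<le> (\<Sum>n | n < N \<and> lam n < 1. 1 * (norm (?a n))\<^sup>2)"
        using lam0 by (intro sum_mono mult_right_mono) (auto simp: power_le_one)
      also have "\<dots> \<le> (\<Sum>n<N. 1 * (norm (?a n))\<^sup>2)" by (intro sum_mono2) auto
      finally show ?thesis using s0[of N] by simp
    qed
  qed auto
  then obtain C where C: "\<And>N. (\<Sum>n<N. ?p n) \<le> C" by blast
  have "(\<Sum>n<N. (1 + (lam n)\<^sup>2) * (norm (?a n))\<^sup>2) \<le> (L2_norm unit_disk f)\<^sup>2 / c\<^sup>2 + C" for N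
    using s0[of N] C[of N] by (simp add: distrib_right sum.distrib)
  then show ?thesis by (intro summableI_nonneg_bounded) auto
qed

section \<open>Oscillatory integrals of the source\<close>

lemma cutoff_data:
  assumes "cutoff \<alpha>"
  obtains A1 A2 where "A1 \<ge> 0" "A2 \<ge> 0" "\<alpha> 0 = 1" "deriv01 \<alpha> 1 = 0"
    "\<And>t. t \<in> {0..1} \<Longrightarrow> (deriv01 \<alpha> has_real_derivative deriv01 (deriv01 \<alpha>) t) (at t within {0..1})"
    "continuous_on {0..1} (deriv01 (deriv01 \<alpha>))"
    "\<And>t. t \<in> {0..1} \<Longrightarrow> \<bar>deriv01 \<alpha> t\<bar> \<le> A1" "\<And>t. t \<in> {0..1} \<Longrightarrow> \<bar>deriv01 (deriv01 \<alpha>) t\<bar> \<le> A2"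
proof -
  have diff: "(deriv01 ^^ k) \<alpha> differentiable (at t within {0..1})" if "t \<in> {0..1}" for k t
    using assms that by (simp add: cutoff_def)
  have d1: "(deriv01 \<alpha> has_real_derivative deriv01 (deriv01 \<alpha>) t) (at t within {0..1})" if t: "t \<in> {0..1}" for t
  proof -
    have "deriv01 \<alpha> differentiable (at t within {0..1})" using diff[OF t, of 1] by simp
    then have "(deriv01 \<alpha> has_vector_derivative vector_derivative (deriv01 \<alpha>) (at t within {0..1})) (at t within {0..1})"
      by (rule vector_derivative_works[THEN iffD1])
    then show ?thesis
      unfolding has_real_derivative_iff_has_vector_derivative by (simp add: deriv01_def[of "deriv01 \<alpha>"])
  qed
  have c1: "continuous_on {0..1} (deriv01 \<alpha>)" by (rule DERIV_continuous_on[OF d1])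
  have "deriv01 (deriv01 \<alpha>) differentiable (at t within {0..1})" if "t \<in> {0..1}" for t
    using diff[OF that, of 2] by (simp add: numeral_2_eq_2)
  then have c2: "continuous_on {0..1} (deriv01 (deriv01 \<alpha>))"
    unfolding continuous_on_eq_continuous_within by (blast intro: differentiable_imp_continuous_within)
  have bd: "\<exists>A\<ge>0. \<forall>t\<in>{0..1}. \<bar>g t\<bar> \<le> A" if "continuous_on {0..1} g" for g :: "real \<Rightarrow> real"
  proof -
    have "bounded (g ` {0..1})" by (intro compact_imp_bounded compact_continuous_image that compact_Icc)
    then obtain A where "\<forall>y\<in>g ` {0..1}. norm y \<le> A" unfolding bounded_iff by blast
    then show ?thesis by (intro exI[of _ "max A 0"]) (auto simp: max_def)
  qed
  obtain A1 where A1: "A1 \<ge> 0" "\<forall>t\<in>{0..1}. \<bar>deriv01 \<alpha> t\<bar> \<le> A1" using bd[OF c1] by blast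
  obtain A2 where A2: "A2 \<ge> 0" "\<forall>t\<in>{0..1}. \<bar>deriv01 (deriv01 \<alpha>) t\<bar> \<le> A2" using bd[OF c2] by blast
  have "\<forall>k. (deriv01 ^^ k) \<alpha> 1 = 0" using assms by (simp add: cutoff_def)
  from spec[OF this, of 1] have e1: "deriv01 \<alpha> 1 = 0" by simp
  obtain d where "d > 0" "\<forall>t\<in>{0..1}. t < d \<longrightarrow> \<alpha> t = 1" using assms by (auto simp: cutoff_def)
  then have e0: "\<alpha> 0 = 1" by simp
  show ?thesis
    by (rule that[OF A1(1) A2(1) e0 e1 d1 c2]) (use A1(2) A2(2) in auto)
qed

text \<open>Integration by parts gains a factor \<open>\<epsilon>\<close> over the length \<open>1/\<epsilon>\<close> of the interval; both boundary terms vanish, at \<open>t = 1/\<epsilon>\<close> because the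
  amplitude does and at \<open>t = 0\<close> because the sine does.\<close>

lemma slow_amplitude_cos_integral:
  fixes g g' :: "real \<Rightarrow> real"
  assumes e: "\<epsilon> > 0" and mu: "\<mu> \<noteq> 0"
    and g: "\<And>t. t \<in> {0..1} \<Longrightarrow> (g has_real_derivative g' t) (at t within {0..1})" "g 1 = 0"
    and g': "continuous_on {0..1} g'" "\<And>t. t \<in> {0..1} \<Longrightarrow> \<bar>g' t\<bar> \<le> A" "A \<ge> 0"
  obtains J where "((\<lambda>t. g (\<epsilon> * t) * cos (\<mu> * t)) has_integral J) {0..1/\<epsilon>}" "\<bar>J\<bar> \<le> A / \<bar>\<mu>\<bar>"
proof -
  have in01: "\<epsilon> * t \<in> {0..1}" if "t \<in> {0..1/\<epsilon>}" for t
    using that e by (auto simp: le_divide_eq mult.commute)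
  define q where "q t = \<epsilon> * g' (\<epsilon> * t) * sin (\<mu> * t) / \<mu>" for t
  have chain: "((\<lambda>t. g (\<epsilon> * t)) has_real_derivative g' (\<epsilon> * t) * \<epsilon>) (at t within {0..1/\<epsilon>})" if t: "t \<in> {0..1/\<epsilon>}" for t
  proof -
    have "(g has_real_derivative g' (\<epsilon> * t)) (at (\<epsilon> * t) within (\<lambda>t. \<epsilon> * t) ` {0..1/\<epsilon>})"
      by (rule DERIV_subset[OF g(1)[OF in01[OF t]]]) (use in01 in blast)
    moreover have "((\<lambda>t. \<epsilon> * t) has_real_derivative \<epsilon>) (at t within {0..1/\<epsilon>})"
      by (auto intro!: derivative_eq_intros)
    ultimately show ?thesis using DERIV_image_chain[of g _ "\<lambda>t. \<epsilon> * t"] by (simp add: o_def)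
  qed
  have "((\<lambda>t. q t + g (\<epsilon> * t) * cos (\<mu> * t)) has_integral
      (g (\<epsilon> * (1/\<epsilon>)) * (sin (\<mu> * (1/\<epsilon>)) / \<mu>) - g (\<epsilon> * 0) * (sin (\<mu> * 0) / \<mu>))) {0..1/\<epsilon>}"
  proof (rule fundamental_theorem_of_calculus)
    fix t assume t: "t \<in> {0..1/\<epsilon>}"
    have "((\<lambda>t. sin (\<mu> * t) / \<mu>) has_real_derivative cos (\<mu> * t)) (at t within {0..1/\<epsilon>})"
      using mu by (auto intro!: derivative_eq_intros)
    from DERIV_mult[OF chain[OF t] this]
    show "((\<lambda>t. g (\<epsilon> * t) * (sin (\<mu> * t) / \<mu>)) has_vector_derivative q t + g (\<epsilon> * t) * cos (\<mu> * t)) (at t within {0..1/\<epsilon>})"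
      unfolding has_real_derivative_iff_has_vector_derivative[symmetric]
      by (rule DERIV_cong) (simp add: q_def)
  qed (use e in simp)
  then have tot: "((\<lambda>t. q t + g (\<epsilon> * t) * cos (\<mu> * t)) has_integral 0) {0..1/\<epsilon>}" using e g(2) by simp
  have "continuous_on {0..1/\<epsilon>} (\<lambda>t. g' (\<epsilon> * t))"
    by (rule continuous_on_compose2[OF g'(1)]) (use in01 in \<open>auto intro!: continuous_intros\<close>)
  then have "continuous_on {0..1/\<epsilon>} q" unfolding q_def by (intro continuous_intros) (use mu in auto)
  then obtain Q where Q: "(q has_integral Q) {0..1/\<epsilon>}" using integrable_continuous_real by blast
  have "norm Q \<le> \<epsilon> * A / \<bar>\<mu>\<bar> * measure lborel {0..1/\<epsilon>}"
  proof (rule has_integral_bound_real[OF _ finite.emptyI Q])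
    show "0 \<le> \<epsilon> * A / \<bar>\<mu>\<bar>" using e g'(3) by simp
    fix t assume t: "t \<in> {0..1/\<epsilon>} - {}"
    have "\<epsilon> * (\<bar>g' (\<epsilon> * t)\<bar> * \<bar>sin (\<mu> * t)\<bar>) / \<bar>\<mu>\<bar> \<le> \<epsilon> * (A * 1) / \<bar>\<mu>\<bar>"
      using t e g'(3) by (intro divide_right_mono mult_left_mono mult_mono g'(2) in01) auto
    then show "norm (q t) \<le> \<epsilon> * A / \<bar>\<mu>\<bar>" using e by (simp add: q_def abs_mult mult.assoc)
  qed
  then have "\<bar>- Q\<bar> \<le> A / \<bar>\<mu>\<bar>" using e by simp
  moreover have "((\<lambda>t. g (\<epsilon> * t) * cos (\<mu> * t)) has_integral - Q) {0..1/\<epsilon>}"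
    using has_integral_diff[OF tot Q] by simp
  ultimately show ?thesis using that by blast
qed

text \<open>For a single pair of modes the coupling relation cancels the resonant denominator
  \<open>l - m\<close>, so that the response is of order \<open>\<epsilon>\<close> uniformly in \<open>m\<close>.\<close>

lemma single_mode_response:
  fixes g g' :: "real \<Rightarrow> real"
  assumes e: "\<epsilon> > 0" and lm: "l \<ge> 0" "m > 0"
    and g: "\<And>t. t \<in> {0..1} \<Longrightarrow> (g has_real_derivative g' t) (at t within {0..1})" "g 1 = 0"
    and g': "continuous_on {0..1} g'" "\<And>t. t \<in> {0..1} \<Longrightarrow> \<bar>g' t\<bar> \<le> A" "A \<ge> 0"
    and MD: "of_real (2 * l\<^sup>2) * M = of_real (m\<^sup>2 - l\<^sup>2) * (D :: complex)"
  obtains J where "((\<lambda>t. (2 * \<epsilon> * l * g (\<epsilon> * t) * sin (l * t) - \<epsilon>\<^sup>2 * g' (\<epsilon> * t) * cos (l * t)) * sin (m * t)) has_integral J) {0..1/\<epsilon>}"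
    "norm (M * of_real J) \<le> \<epsilon> * A * (3 * norm M + 2 * norm D)"
proof -
  have in01: "\<epsilon> * t \<in> {0..1}" if "t \<in> {0..1/\<epsilon>}" for t
    using that e by (auto simp: le_divide_eq mult.commute)
  have cg: "continuous_on {0..1/\<epsilon>} (\<lambda>t. g (\<epsilon> * t))"
    by (rule continuous_on_compose2[OF DERIV_continuous_on[OF g(1)]]) (use in01 in \<open>auto intro!: continuous_intros\<close>)
  have cg': "continuous_on {0..1/\<epsilon>} (\<lambda>t. g' (\<epsilon> * t))"
    by (rule continuous_on_compose2[OF g'(1)]) (use in01 in \<open>auto intro!: continuous_intros\<close>)
  let ?k = "\<lambda>t. (2 * \<epsilon> * l * g (\<epsilon> * t) * sin (l * t) - \<epsilon>\<^sup>2 * g' (\<epsilon> * t) * cos (l * t)) * sin (m * t)"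
  have "continuous_on {0..1/\<epsilon>} ?k" by (intro continuous_intros cg cg')
  then obtain J where J: "(?k has_integral J) {0..1/\<epsilon>}" using integrable_continuous_real by blast
  have "norm (M * of_real J) \<le> \<epsilon> * A * (3 * norm M + 2 * norm D)"
  proof (cases "l = m")
    case True
    then have "M = 0" using MD lm by simp
    then show ?thesis using e g'(3) by simp
  next
    case False
    have "continuous_on {0..1/\<epsilon>} (\<lambda>t. g' (\<epsilon> * t) * cos (l * t) * sin (m * t))" by (intro continuous_intros cg')
    then obtain J3 where J3: "((\<lambda>t. g' (\<epsilon> * t) * cos (l * t) * sin (m * t)) has_integral J3) {0..1/\<epsilon>}"
      using integrable_continuous_real by blast
    have "norm J3 \<le> A * measure lborel {0..1/\<epsilon>}"
    proof (rule has_integral_bound_real[OF g'(3) finite.emptyI J3])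
      fix t assume t: "t \<in> {0..1/\<epsilon>} - {}"
      have "\<bar>g' (\<epsilon> * t)\<bar> * \<bar>cos (l * t)\<bar> * \<bar>sin (m * t)\<bar> \<le> A * 1 * 1"
        using t g'(3) by (intro mult_mono g'(2) in01) auto
      then show "norm (g' (\<epsilon> * t) * cos (l * t) * sin (m * t)) \<le> A" by (simp add: abs_mult)
    qed
    then have b3: "\<epsilon>\<^sup>2 * \<bar>J3\<bar> \<le> \<epsilon> * A" using e by (simp add: power2_eq_square field_simps)
    obtain J1 where J1: "((\<lambda>t. g (\<epsilon> * t) * cos ((l - m) * t)) has_integral J1) {0..1/\<epsilon>}" "\<bar>J1\<bar> \<le> A / \<bar>l - m\<bar>"
      by (rule slow_amplitude_cos_integral[OF e _ g g', of "l - m"]) (use False in auto)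
    obtain J2 where J2: "((\<lambda>t. g (\<epsilon> * t) * cos ((l + m) * t)) has_integral J2) {0..1/\<epsilon>}" "\<bar>J2\<bar> \<le> A / \<bar>l + m\<bar>"
      by (rule slow_amplitude_cos_integral[OF e _ g g', of "l + m"]) (use lm in auto)
    have "((\<lambda>t. (\<epsilon> * l) * (g (\<epsilon> * t) * cos ((l - m) * t) - g (\<epsilon> * t) * cos ((l + m) * t))
        - \<epsilon>\<^sup>2 * (g' (\<epsilon> * t) * cos (l * t) * sin (m * t))) has_integral ((\<epsilon> * l) * (J1 - J2) - \<epsilon>\<^sup>2 * J3)) {0..1/\<epsilon>}"
      by (intro has_integral_diff has_integral_mult_right J1 J2 J3)
    moreover have "(\<epsilon> * l) * (g (\<epsilon> * t) * cos ((l - m) * t) - g (\<epsilon> * t) * cos ((l + m) * t))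
        - \<epsilon>\<^sup>2 * (g' (\<epsilon> * t) * cos (l * t) * sin (m * t)) = ?k t" for t
      by (simp add: left_diff_distrib distrib_right cos_add cos_diff algebra_simps)
    ultimately have "(?k has_integral ((\<epsilon> * l) * (J1 - J2) - \<epsilon>\<^sup>2 * J3)) {0..1/\<epsilon>}" by simp
    then have Jeq: "J = (\<epsilon> * l) * (J1 - J2) - \<epsilon>\<^sup>2 * J3" using J has_integral_unique by blast
    have Jb: "\<bar>J\<bar> \<le> \<epsilon> * l * \<bar>J1\<bar> + \<epsilon> * l * \<bar>J2\<bar> + \<epsilon>\<^sup>2 * \<bar>J3\<bar>"
    proof -
      have "\<bar>J\<bar> \<le> \<bar>(\<epsilon> * l) * (J1 - J2)\<bar> + \<bar>\<epsilon>\<^sup>2 * J3\<bar>" unfolding Jeq by (rule abs_triangle_ineq4)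
      also have "\<bar>(\<epsilon> * l) * (J1 - J2)\<bar> \<le> (\<epsilon> * l) * (\<bar>J1\<bar> + \<bar>J2\<bar>)"
        unfolding abs_mult[of "\<epsilon> * l"] using e lm by (intro mult_mono abs_triangle_ineq4) auto
      finally show ?thesis by (simp add: abs_mult distrib_left)
    qed
    have b2: "l * \<bar>J2\<bar> \<le> A"
    proof -
      have "l * \<bar>J2\<bar> \<le> l * (A / \<bar>l + m\<bar>)" using lm J2(2) by (intro mult_left_mono) auto
      also have "\<dots> = (l / (l + m)) * A" using lm by simp
      also have "\<dots> \<le> 1 * A" using lm g'(3) by (intro mult_right_mono) auto
      finally show ?thesis by simp
    qed
    have b1: "norm M * (l * \<bar>J1\<bar>) \<le> A * (norm M + 2 * norm D)"
    proof (cases "m \<le> 2 * l")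
      case True
      then have l0: "l > 0" using lm by linarith
      have "norm M * (2 * l\<^sup>2) = norm (of_real (m\<^sup>2 - l\<^sup>2) * D)"
        unfolding MD[symmetric] by (simp add: norm_mult norm_power)
      also have "\<dots> = \<bar>l - m\<bar> * (l + m) * norm D"
      proof -
        have "m\<^sup>2 - l\<^sup>2 = (m - l) * (m + l)" by (simp add: power2_eq_square algebra_simps)
        then have "\<bar>m\<^sup>2 - l\<^sup>2\<bar> = \<bar>l - m\<bar> * (l + m)"
          using lm by (simp add: abs_mult abs_minus_commute add.commute)
        then show ?thesis unfolding norm_mult norm_of_real by simp
      qed
      finally have Md: "norm M * (2 * l\<^sup>2) = \<bar>l - m\<bar> * (l + m) * norm D" .
      have "norm M * (2 * l\<^sup>2) * \<bar>J1\<bar> \<le> (\<bar>l - m\<bar> * (l + m) * norm D) * (A / \<bar>l - m\<bar>)"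
        unfolding Md using lm J1(2) by (intro mult_left_mono) auto
      also have "\<dots> = A * (l + m) * norm D" using False by simp
      also have "\<dots> \<le> A * (4 * l) * norm D" using True g'(3) l0 by (intro mult_right_mono mult_left_mono) auto
      finally have "(2 * l) * (norm M * (l * \<bar>J1\<bar>)) \<le> (2 * l) * (A * (2 * norm D))"
        by (simp add: power2_eq_square mult_ac)
      then have "norm M * (l * \<bar>J1\<bar>) \<le> A * (2 * norm D)"
        by (rule mult_left_le_imp_le) (use l0 in simp)
      also have "\<dots> \<le> A * (norm M + 2 * norm D)" using g'(3) by (intro mult_left_mono) auto
      finally show ?thesis .
    next
      case False
      have "l * \<bar>J1\<bar> \<le> l * (A / \<bar>l - m\<bar>)" using lm J1(2) by (intro mult_left_mono) auto
      also have "\<dots> = (l / \<bar>l - m\<bar>) * A" by simp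
      also have "\<dots> \<le> 1 * A" using False lm g'(3) by (intro mult_right_mono) auto
      finally have "norm M * (l * \<bar>J1\<bar>) \<le> norm M * A" by (intro mult_left_mono) auto
      also have "\<dots> \<le> A * (norm M + 2 * norm D)" using g'(3) by (simp add: algebra_simps)
      finally show ?thesis .
    qed
    have "norm (M * of_real J) = norm M * \<bar>J\<bar>" by (simp add: norm_mult)
    also have "\<dots> \<le> norm M * (\<epsilon> * l * \<bar>J1\<bar> + \<epsilon> * l * \<bar>J2\<bar> + \<epsilon>\<^sup>2 * \<bar>J3\<bar>)"
      using Jb by (intro mult_left_mono) auto
    also have "\<dots> = \<epsilon> * (norm M * (l * \<bar>J1\<bar>)) + \<epsilon> * (norm M * (l * \<bar>J2\<bar>)) + norm M * (\<epsilon>\<^sup>2 * \<bar>J3\<bar>)"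
      by (simp add: algebra_simps)
    also have "\<dots> \<le> \<epsilon> * (A * (norm M + 2 * norm D)) + \<epsilon> * (norm M * A) + norm M * (\<epsilon> * A)"
      using e b1 b2 b3 by (intro add_mono mult_left_mono) auto
    also have "\<dots> = \<epsilon> * A * (3 * norm M + 2 * norm D)" by (simp add: algebra_simps)
    finally show ?thesis .
  qed
  with J show ?thesis by (rule that)
qed

text \<open>Duhamel's formula for the backward problem, read off from the derivative of
  \<open>a' sin(m t) - m a cos(m t)\<close>.\<close>

lemma backward_coefficient:
  fixes a a' F :: "real \<Rightarrow> complex"
  assumes T: "T \<ge> 0" and fin: "a T = 0" "a' T = 0"
    and a: "\<And>t. t \<in> {0..T} \<Longrightarrow> (a has_vector_derivative a' t) (at t within {0..T})"
    and a': "\<And>t. t \<in> {0..T} \<Longrightarrow> (a' has_vector_derivative (F t - of_real (m\<^sup>2) * a t)) (at t within {0..T})"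
  shows "((\<lambda>t. F t * of_real (sin (m * t))) has_integral (of_real m * a 0)) {0..T}"
proof -
  let ?B = "\<lambda>t. a' t * of_real (sin (m * t)) - of_real m * (a t * of_real (cos (m * t)))"
  have "((\<lambda>t. F t * of_real (sin (m * t))) has_integral (?B T - ?B 0)) {0..T}"
  proof (rule fundamental_theorem_of_calculus[OF T])
    fix t assume t: "t \<in> {0..T}"
    have s: "((\<lambda>t. complex_of_real (sin (m * t))) has_vector_derivative of_real (cos (m * t) * m)) (at t within {0..T})"
      and c: "((\<lambda>t. complex_of_real (cos (m * t))) has_vector_derivative of_real (- sin (m * t) * m)) (at t within {0..T})"
      by (intro has_vector_derivative_of_real; auto intro!: derivative_eq_intros)+
    have "(?B has_vector_derivative
        (a' t * of_real (cos (m * t) * m) + (F t - of_real (m\<^sup>2) * a t) * of_real (sin (m * t)))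
        - of_real m * (a t * of_real (- sin (m * t) * m) + a' t * of_real (cos (m * t)))) (at t within {0..T})"
      by (intro has_vector_derivative_diff has_vector_derivative_mult has_vector_derivative_mult_right a a' s c t)
    moreover have "(a' t * of_real (cos (m * t) * m) + (F t - of_real (m\<^sup>2) * a t) * of_real (sin (m * t)))
        - of_real m * (a t * of_real (- sin (m * t) * m) + a' t * of_real (cos (m * t))) = F t * of_real (sin (m * t))"
      by (simp add: power2_eq_square algebra_simps)
    ultimately show "(?B has_vector_derivative F t * of_real (sin (m * t))) (at t within {0..T})" by simp
  qed
  then show ?thesis using fin by simp
qed

section \<open>The energy of the error\<close>

text \<open>Bounds a Neumann coefficient of the source by its share of the forward energy: \<open>x\<close> and \<open>y\<close> stand
  for the derivatives of the cut-off, \<open>s\<close> and \<open>k\<close> for the sine and cosine.\<close>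

lemma weighted_amplitude_bound:
  fixes l :: real
  assumes "\<epsilon> > 0" "l \<ge> 0" "A1 \<ge> 0" "A2 \<ge> 0" "\<bar>x\<bar> \<le> A1" "\<bar>y\<bar> \<le> A2" "\<bar>s\<bar> \<le> 1" "\<bar>k\<bar> \<le> 1"
  shows "(2 * \<epsilon> * l * x * s - \<epsilon>\<^sup>2 * y * k)\<^sup>2 \<le> (\<epsilon> * (2 * A1 + \<epsilon> * A2))\<^sup>2 * (1 + l\<^sup>2)"
proof -
  define r where "r = sqrt (1 + l\<^sup>2)"
  have r: "1 \<le> r" "l \<le> r" "r\<^sup>2 = 1 + l\<^sup>2" by (auto simp: r_def real_le_rsqrt)
  have "\<bar>2 * \<epsilon> * l * x * s - \<epsilon>\<^sup>2 * y * k\<bar> \<le> 2 * \<epsilon> * l * (\<bar>x\<bar> * \<bar>s\<bar>) + \<epsilon>\<^sup>2 * (\<bar>y\<bar> * \<bar>k\<bar>)"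
    using assms by (intro order_trans[OF abs_triangle_ineq4]) (simp add: abs_mult)
  also have "\<dots> \<le> 2 * \<epsilon> * r * (A1 * 1) + \<epsilon>\<^sup>2 * (A2 * 1)"
    using assms r by (intro add_mono mult_mono) auto
  also have "\<dots> \<le> 2 * \<epsilon> * r * A1 + \<epsilon>\<^sup>2 * A2 * r"
    using assms r mult_left_mono[of 1 r "\<epsilon>\<^sup>2 * A2"] by simp
  also have "\<dots> = \<epsilon> * (2 * A1 + \<epsilon> * A2) * r" by (simp add: power2_eq_square algebra_simps)
  finally have "\<bar>2 * \<epsilon> * l * x * s - \<epsilon>\<^sup>2 * y * k\<bar>\<^sup>2 \<le> (\<epsilon> * (2 * A1 + \<epsilon> * A2) * r)\<^sup>2"
    by (rule power_mono) simp
  then show ?thesis by (simp add: power_mult_distrib r(3))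
qed

text \<open>The response of the Dirichlet system to a forcing of norm at most \<open>d\<close>: testing against the
  coefficients themselves turns Bessel's inequality into an \<open>l\<^sup>2\<close> bound.\<close>

lemma forced_coefficients_bound:
  fixes b :: "nat \<Rightarrow> complex" and r :: "nat \<Rightarrow> real \<Rightarrow> complex"
  assumes T: "T \<ge> 0" and d: "d \<ge> 0"
    and b: "\<And>k. (r k has_integral b k) {0..T}"
    and r: "\<And>t. t \<in> {0..T} \<Longrightarrow> (\<Sum>k<K. (norm (r k t))\<^sup>2) \<le> d\<^sup>2"
  shows "(\<Sum>k<K. (norm (b k))\<^sup>2) \<le> (T * d)\<^sup>2"
proof -
  define S where "S = (\<Sum>k<K. (norm (b k))\<^sup>2)"
  have S0: "S \<ge> 0" by (simp add: S_def sum_nonneg)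
  have "((\<lambda>t. \<Sum>k<K. cnj (b k) * r k t) has_integral (\<Sum>k<K. cnj (b k) * b k)) {0..T}"
    by (intro has_integral_sum has_integral_mult_right b) auto
  moreover have "(\<Sum>k<K. cnj (b k) * b k) = of_real S"
    unfolding S_def of_real_sum complex_norm_square by (simp add: mult.commute)
  ultimately have i: "((\<lambda>t. \<Sum>k<K. cnj (b k) * r k t) has_integral of_real S) {0..T}" by simp
  have "norm (complex_of_real S) \<le> (sqrt S * d) * measure lborel {0..T}"
  proof (rule has_integral_bound_real[OF _ finite.emptyI i])
    show "0 \<le> sqrt S * d" using d S0 by simp
    fix t assume t: "t \<in> {0..T} - {}"
    have "norm (\<Sum>k<K. cnj (b k) * r k t) \<le> (\<Sum>k<K. \<bar>norm (b k)\<bar> * \<bar>norm (r k t)\<bar>)"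
      by (rule order_trans[OF norm_sum]) (simp add: norm_mult)
    also have "\<dots> \<le> L2_set (\<lambda>k. norm (b k)) {..<K} * L2_set (\<lambda>k. norm (r k t)) {..<K}"
      by (rule L2_set_mult_ineq)
    also have "\<dots> \<le> sqrt S * d"
      unfolding L2_set_def S_def[symmetric] using r[of t] t d S0
      by (intro mult_left_mono real_le_lsqrt) (auto simp: sum_nonneg)
    finally show "norm (\<Sum>k<K. cnj (b k) * r k t) \<le> sqrt S * d" .
  qed
  then have le: "S \<le> sqrt S * (T * d)" using T S0 by (simp add: mult_ac)
  have "sqrt S \<le> T * d"
  proof (cases "S = 0")
    case False
    then have "sqrt S > 0" using S0 by simp
    moreover have "sqrt S * sqrt S \<le> sqrt S * (T * d)" using le S0 by simp
    ultimately show ?thesis by (simp only: mult_le_cancel_left_pos)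
  qed (use T d in simp)
  then have "(sqrt S)\<^sup>2 \<le> (T * d)\<^sup>2" using S0 by (intro power_mono) auto
  then show ?thesis using S0 by (simp add: S_def)
qed

lemma has_integral_of_real_complex:
  "(g has_integral J) S \<Longrightarrow> ((\<lambda>t. complex_of_real (g t)) has_integral complex_of_real J) S"
  using has_integral_linear[OF _ bounded_linear_of_real, of g J S] by (simp add: o_def)

text \<open>The forward modes below \<open>N\<close> respond non-resonantly, with energy of order \<open>\<epsilon>\<^sup>2\<close>; the modes above
  \<open>N\<close> are bounded by the crude energy inequality, in which the source \<open>O(\<epsilon>)\<close> acts during the time
  \<open>1/\<epsilon>\<close>. The constant \<open>C\<close> may depend on \<open>N\<close>, but not on the Dirichlet basis.\<close>

lemma error_energy_bound:
  assumes nb: "neumann_basis c \<phi> lam" and c: "c > 0"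
    and u: "\<And>t. t \<ge> 0 \<Longrightarrow> L2_sums unit_disk (\<lambda>n x. inner_c c f (\<phi> n) * \<phi> n x * of_real (cos (lam n * t))) (u t)"
    and A: "A1 \<ge> 0" "A2 \<ge> 0" and a1: "deriv01 \<alpha> 1 = 0"
    and d1: "\<And>t. t \<in> {0..1} \<Longrightarrow> (deriv01 \<alpha> has_real_derivative deriv01 (deriv01 \<alpha>) t) (at t within {0..1})"
    and c2: "continuous_on {0..1} (deriv01 (deriv01 \<alpha>))"
    and b1: "\<And>t. t \<in> {0..1} \<Longrightarrow> \<bar>deriv01 \<alpha> t\<bar> \<le> A1" and b2: "\<And>t. t \<in> {0..1} \<Longrightarrow> \<bar>deriv01 (deriv01 \<alpha>) t\<bar> \<le> A2"
    and tail: "\<And>K. (\<Sum>n\<in>{N..<K}. (1 + (lam n)\<^sup>2) * (norm (inner_c c f (\<phi> n)))\<^sup>2) \<le> \<delta>\<^sup>2" and delta: "\<delta> \<ge> 0"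
  obtains C where "C \<ge> 0"
    "\<And>\<epsilon> ut \<psi> nu a a' K. \<epsilon> > 0 \<Longrightarrow> L2_time_derivative u ut \<Longrightarrow> dirichlet_basis c \<psi> nu \<Longrightarrow>
      (\<And>k t. t \<in> {0..1/\<epsilon>} \<Longrightarrow> (a k has_vector_derivative a' k t) (at t within {0..1/\<epsilon>})) \<Longrightarrow>
      (\<And>k t. t \<in> {0..1/\<epsilon>} \<Longrightarrow> (a' k has_vector_derivative
          (inner_c c (source_term \<alpha> \<epsilon> u ut t) (\<psi> k) - of_real ((nu k)\<^sup>2) * a k t)) (at t within {0..1/\<epsilon>})) \<Longrightarrow>
      (\<And>k. a k (1/\<epsilon>) = 0 \<and> a' k (1/\<epsilon>) = 0) \<Longrightarrow>
      (\<Sum>k<K. (nu k)\<^sup>2 * (norm (a k 0))\<^sup>2) \<le> C * \<epsilon>\<^sup>2 + 2 * ((2 * A1 + \<epsilon> * A2) * \<delta>)\<^sup>2"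
proof -
  have B: "orthonormal_basis_c c \<phi>" using nb by (simp add: neumann_basis_def)
  have lam0: "lam n \<ge> 0" and neu: "neumann_eigenfunction c (lam n) (\<phi> n)" for n
    using nb by (auto simp: neumann_basis_def)
  note phiL = orthonormal_basisD(1)[OF B]
  let ?U = "\<lambda>n. inner_c c f (\<phi> n)"
  have "\<exists>R. R \<in> L2_on unit_disk \<and> (\<forall>\<psi> m. dirichlet_eigenfunction c m \<psi> \<longrightarrow> m > 0 \<longrightarrow>
      of_real (2 * (lam n)\<^sup>2) * inner_c c (\<phi> n) \<psi> = of_real (m\<^sup>2 - (lam n)\<^sup>2) * inner_c c R \<psi>)" for n
    by (rule neumann_dirichlet_coupling[OF neu[of n] c lam0]) blast
  then obtain R where RL: "\<And>n. R n \<in> L2_on unit_disk"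
    and R: "\<And>n \<psi> m. dirichlet_eigenfunction c m \<psi> \<Longrightarrow> m > 0 \<Longrightarrow>
      of_real (2 * (lam n)\<^sup>2) * inner_c c (\<phi> n) \<psi> = of_real (m\<^sup>2 - (lam n)\<^sup>2) * inner_c c (R n) \<psi>"
    by metis
  define nM where "nM n = (L2_norm unit_disk (\<phi> n))\<^sup>2 / c\<^sup>2" for n
  define nD where "nD n = (L2_norm unit_disk (R n))\<^sup>2 / c\<^sup>2" for n
  define C where "C = 2 * (real N * (\<Sum>n<N. (norm (?U n) * A2)\<^sup>2 * (18 * nM n + 8 * nD n)))"
  have C0: "C \<ge> 0" unfolding C_def nM_def nD_def by (intro mult_nonneg_nonneg sum_nonneg add_nonneg_nonneg) auto
  show ?thesis
  proof (rule that[OF C0])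
    fix \<epsilon> :: real and ut \<psi> nu and a a' :: "nat \<Rightarrow> real \<Rightarrow> complex" and K :: nat
    assume e: "\<epsilon> > 0" and ut: "L2_time_derivative u ut" and db: "dirichlet_basis c \<psi> nu"
      and ode1: "\<And>k t. t \<in> {0..1/\<epsilon>} \<Longrightarrow> (a k has_vector_derivative a' k t) (at t within {0..1/\<epsilon>})"
      and ode2: "\<And>k t. t \<in> {0..1/\<epsilon>} \<Longrightarrow> (a' k has_vector_derivative
          (inner_c c (source_term \<alpha> \<epsilon> u ut t) (\<psi> k) - of_real ((nu k)\<^sup>2) * a k t)) (at t within {0..1/\<epsilon>})"
      and fin: "\<And>k. a k (1/\<epsilon>) = 0 \<and> a' k (1/\<epsilon>) = 0"
    note DB = dirichlet_basisD[OF db]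
    have in01: "\<epsilon> * t \<in> {0..1}" if "t \<in> {0..1/\<epsilon>}" for t
      using that e by (auto simp: le_divide_eq mult.commute)
    define M where "M n k = inner_c c (\<phi> n) (\<psi> k)" for n k
    define D where "D n k = inner_c c (R n) (\<psi> k)" for n k
    define g where "g n t = 2 * \<epsilon> * lam n * deriv01 \<alpha> (\<epsilon> * t) * sin (lam n * t)
        - \<epsilon>\<^sup>2 * deriv01 (deriv01 \<alpha>) (\<epsilon> * t) * cos (lam n * t)" for n t
    have "\<exists>J. ((\<lambda>t. g n t * sin (nu k * t)) has_integral J) {0..1/\<epsilon>} \<and>
        norm (M n k * of_real J) \<le> \<epsilon> * A2 * (3 * norm (M n k) + 2 * norm (D n k))" for n k
    proof -
      have MD: "of_real (2 * (lam n)\<^sup>2) * M n k = of_real ((nu k)\<^sup>2 - (lam n)\<^sup>2) * D n k"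
        unfolding M_def D_def by (rule R[OF DB(1,2)])
      obtain J where "((\<lambda>t. (2 * \<epsilon> * lam n * deriv01 \<alpha> (\<epsilon> * t) * sin (lam n * t)
          - \<epsilon>\<^sup>2 * deriv01 (deriv01 \<alpha>) (\<epsilon> * t) * cos (lam n * t)) * sin (nu k * t)) has_integral J) {0..1/\<epsilon>}"
        "norm (M n k * of_real J) \<le> \<epsilon> * A2 * (3 * norm (M n k) + 2 * norm (D n k))"
        by (rule single_mode_response[OF e lam0 DB(2) d1 a1 c2 b2 A(2) MD])
      then show ?thesis unfolding g_def by blast
    qed
    then obtain J where J: "\<And>n k. ((\<lambda>t. g n t * sin (nu k * t)) has_integral J n k) {0..1/\<epsilon>}"
      and MJ: "\<And>n k. norm (M n k * of_real (J n k)) \<le> \<epsilon> * A2 * (3 * norm (M n k) + 2 * norm (D n k))"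
      by metis
    \<comment> \<open>\<open>X\<close> is the full response and \<open>Y\<close> the response to the first \<open>N\<close> Neumann modes.\<close>
    define X where "X k = of_real (nu k) * a k 0" for k
    define Y where "Y k = (\<Sum>n<N. ?U n * (M n k * of_real (J n k)))" for k
    have hX: "((\<lambda>t. inner_c c (source_term \<alpha> \<epsilon> u ut t) (\<psi> k) * of_real (sin (nu k * t))) has_integral X k) {0..1/\<epsilon>}" for k
      unfolding X_def using fin[of k] e by (intro backward_coefficient[OF _ _ _ ode1 ode2]) auto
    have hY: "((\<lambda>t. \<Sum>n<N. ?U n * (M n k * of_real (g n t * sin (nu k * t)))) has_integral Y k) {0..1/\<epsilon>}" for k
      unfolding Y_def by (intro has_integral_sum has_integral_mult_right has_integral_of_real_complex J) auto
    \<comment> \<open>The source with its first \<open>N\<close> Neumann modes removed.\<close>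
    define Rem where "Rem t x = source_term \<alpha> \<epsilon> u ut t x - (\<Sum>n<N. (of_real (g n t) * ?U n) * \<phi> n x)" for t x
    have FL: "source_term \<alpha> \<epsilon> u ut t \<in> L2_on unit_disk"
      and Fin: "h \<in> L2_on unit_disk \<Longrightarrow> inner_c c (source_term \<alpha> \<epsilon> u ut t) h
          = - of_real (2 * \<epsilon> * deriv01 \<alpha> (\<epsilon> * t)) * inner_c c (ut t) h
            - of_real (\<epsilon>\<^sup>2 * deriv01 (deriv01 \<alpha>) (\<epsilon> * t)) * inner_c c (u t) h" if t: "t \<ge> 0" for t h
    proof -
      let ?p = "- complex_of_real (2 * \<epsilon> * deriv01 \<alpha> (\<epsilon> * t))"
      let ?q = "- complex_of_real (\<epsilon>\<^sup>2 * deriv01 (deriv01 \<alpha>) (\<epsilon> * t))"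
      have eq: "source_term \<alpha> \<epsilon> u ut t = (\<lambda>x. ?p * ut t x + ?q * u t x)"
        by (auto simp: source_term_def power2_eq_square algebra_simps)
      have L: "ut t \<in> L2_on unit_disk" "u t \<in> L2_on unit_disk"
        using ut u[OF t] t by (auto simp: L2_time_derivative_def L2_sums_def)
      show "source_term \<alpha> \<epsilon> u ut t \<in> L2_on unit_disk" unfolding eq by (intro L2_on_add L2_on_scale L)
      show "inner_c c (source_term \<alpha> \<epsilon> u ut t) h
          = - of_real (2 * \<epsilon> * deriv01 \<alpha> (\<epsilon> * t)) * inner_c c (ut t) h
            - of_real (\<epsilon>\<^sup>2 * deriv01 (deriv01 \<alpha>) (\<epsilon> * t)) * inner_c c (u t) h" if h: "h \<in> L2_on unit_disk"
        unfolding eq inner_c_add_left[OF L2_on_scale[OF L(1)] L2_on_scale[OF L(2)] h] inner_c_scale_left by simp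
    qed
    have PL: "(\<lambda>x. \<Sum>n<N. (of_real (g n t) * ?U n) * \<phi> n x) \<in> L2_on unit_disk" for t
      by (intro L2_on_sum L2_on_scale phiL)
    have RemL: "Rem t \<in> L2_on unit_disk" if "t \<ge> 0" for t
      unfolding Rem_def by (intro L2_on_diff FL that PL)
    have Remin: "inner_c c (Rem t) h = inner_c c (source_term \<alpha> \<epsilon> u ut t) h - (\<Sum>n<N. (of_real (g n t) * ?U n) * inner_c c (\<phi> n) h)"
      if t: "t \<ge> 0" and h: "h \<in> L2_on unit_disk" for t h
      unfolding Rem_def inner_c_diff_left[OF FL[OF t] PL h] inner_c_sum_left[OF phiL h] ..
    have coef: "inner_c c (Rem t) (\<phi> m) = (if m < N then 0 else of_real (g m t) * ?U m)" if t: "t \<ge> 0" for t m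
    proof -
      have cu: "inner_c c (u t) (\<phi> m) = ?U m * of_real (cos (lam m * t))"
        by (rule time_derivative_coefficient(1)[OF nb u ut t])
      have cut_u: "inner_c c (ut t) (\<phi> m) = - (?U m * of_real (lam m * sin (lam m * t)))"
        by (rule time_derivative_coefficient(2)[OF nb u ut t])
      have "inner_c c (source_term \<alpha> \<epsilon> u ut t) (\<phi> m) = of_real (g m t) * ?U m"
        unfolding Fin[OF t phiL] cu cut_u g_def
        by (simp add: algebra_simps)
      then show ?thesis
        unfolding Remin[OF t phiL]
        by (simp add: orthonormal_basisD(2)[OF B] if_distrib[of "\<lambda>z. _ * z"] cong: if_cong)
    qed
    define d where "d = \<epsilon> * (2 * A1 + \<epsilon> * A2) * \<delta>"
    have d0: "d \<ge> 0" using e A delta by (simp add: d_def)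
    have Remn: "L2_norm unit_disk (Rem t) \<le> c * d" if t: "t \<in> {0..1/\<epsilon>}" for t
    proof (rule norm_le_of_coefficients[OF B c RemL _ d0])
      show t0: "t \<ge> 0" using t by simp
      fix K
      have gb: "(g n t)\<^sup>2 \<le> (\<epsilon> * (2 * A1 + \<epsilon> * A2))\<^sup>2 * (1 + (lam n)\<^sup>2)" for n
        unfolding g_def by (rule weighted_amplitude_bound[OF e lam0 A b1[OF in01[OF t]] b2[OF in01[OF t]]]) auto
      have "(\<Sum>n<K. (norm (inner_c c (Rem t) (\<phi> n)))\<^sup>2) = (\<Sum>n\<in>{N..<K}. (g n t)\<^sup>2 * (norm (?U n))\<^sup>2)"
      proof -
        have "(\<Sum>n<K. (norm (inner_c c (Rem t) (\<phi> n)))\<^sup>2) = (\<Sum>n<K. if N \<le> n then (g n t)\<^sup>2 * (norm (?U n))\<^sup>2 else 0)"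
          by (intro sum.cong refl) (simp add: coef[OF t0] norm_mult power_mult_distrib)
        also have "\<dots> = (\<Sum>n\<in>{n\<in>{..<K}. N \<le> n}. (g n t)\<^sup>2 * (norm (?U n))\<^sup>2)"
          by (rule sum.inter_filter[symmetric]) simp
        also have "{n\<in>{..<K}. N \<le> n} = {N..<K}" by auto
        finally show ?thesis .
      qed
      also have "\<dots> \<le> (\<Sum>n\<in>{N..<K}. (\<epsilon> * (2 * A1 + \<epsilon> * A2))\<^sup>2 * (1 + (lam n)\<^sup>2) * (norm (?U n))\<^sup>2)"
        by (intro sum_mono mult_right_mono gb) auto
      also have "\<dots> = (\<epsilon> * (2 * A1 + \<epsilon> * A2))\<^sup>2 * (\<Sum>n\<in>{N..<K}. (1 + (lam n)\<^sup>2) * (norm (?U n))\<^sup>2)"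
        by (simp add: sum_distrib_left mult.assoc)
      also have "\<dots> \<le> (\<epsilon> * (2 * A1 + \<epsilon> * A2))\<^sup>2 * \<delta>\<^sup>2" by (intro mult_left_mono tail) auto
      finally show "(\<Sum>n<K. (norm (inner_c c (Rem t) (\<phi> n)))\<^sup>2) \<le> d\<^sup>2" by (simp add: d_def power_mult_distrib)
    qed
    have "(\<Sum>k<K. (norm (X k - Y k))\<^sup>2) \<le> (1/\<epsilon> * d)\<^sup>2"
    proof (rule forced_coefficients_bound[OF _ d0 has_integral_diff[OF hX hY]])
      fix t assume t: "t \<in> {0..1/\<epsilon>}"
      then have t0: "t \<ge> 0" by simp
      have "norm (inner_c c (source_term \<alpha> \<epsilon> u ut t) (\<psi> k) * of_real (sin (nu k * t))
          - (\<Sum>n<N. ?U n * (M n k * of_real (g n t * sin (nu k * t))))) \<le> norm (inner_c c (Rem t) (\<psi> k))" for k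
      proof -
        have "inner_c c (source_term \<alpha> \<epsilon> u ut t) (\<psi> k) * of_real (sin (nu k * t))
          - (\<Sum>n<N. ?U n * (M n k * of_real (g n t * sin (nu k * t)))) = inner_c c (Rem t) (\<psi> k) * of_real (sin (nu k * t))"
          unfolding Remin[OF t0 DB(4)] M_def
          by (simp add: left_diff_distrib right_diff_distrib sum_distrib_left sum_distrib_right mult_ac)
        then show ?thesis by (simp add: norm_mult mult_left_le)
      qed
      then have "(\<Sum>k<K. (norm (inner_c c (source_term \<alpha> \<epsilon> u ut t) (\<psi> k) * of_real (sin (nu k * t))
          - (\<Sum>n<N. ?U n * (M n k * of_real (g n t * sin (nu k * t))))))\<^sup>2) \<le> (\<Sum>k<K. (norm (inner_c c (Rem t) (\<psi> k)))\<^sup>2)"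
        by (intro sum_mono power_mono) auto
      also have "\<dots> \<le> (L2_norm unit_disk (Rem t))\<^sup>2 / c\<^sup>2" by (rule Bessel[OF DB(3) c RemL[OF t0]])
      also have "\<dots> \<le> (c * d)\<^sup>2 / c\<^sup>2" by (intro divide_right_mono power_mono Remn t) auto
      also have "\<dots> = d\<^sup>2" using c by (simp add: power_mult_distrib)
      finally show "(\<Sum>k<K. (norm (inner_c c (source_term \<alpha> \<epsilon> u ut t) (\<psi> k) * of_real (sin (nu k * t))
          - (\<Sum>n<N. ?U n * (M n k * of_real (g n t * sin (nu k * t))))))\<^sup>2) \<le> d\<^sup>2" .
    qed (use e in simp)
    also have "1/\<epsilon> * d = (2 * A1 + \<epsilon> * A2) * \<delta>" using e by (simp add: d_def)
    finally have XY: "(\<Sum>k<K. (norm (X k - Y k))\<^sup>2) \<le> ((2 * A1 + \<epsilon> * A2) * \<delta>)\<^sup>2" .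
    have Yk: "(norm (Y k))\<^sup>2 \<le> real N * (\<Sum>n<N. \<epsilon>\<^sup>2 * ((norm (?U n) * A2)\<^sup>2 * (18 * (norm (M n k))\<^sup>2 + 8 * (norm (D n k))\<^sup>2)))" for k
    proof -
      let ?x = "\<lambda>n. norm (?U n) * (\<epsilon> * A2 * (3 * norm (M n k) + 2 * norm (D n k)))"
      have "norm (Y k) \<le> (\<Sum>n<N. ?x n)"
        unfolding Y_def
        by (rule order_trans[OF norm_sum], rule sum_mono, subst norm_mult, rule mult_left_mono[OF MJ]) simp
      then have "(norm (Y k))\<^sup>2 \<le> (\<Sum>n<N. 1 * ?x n)\<^sup>2" by (intro power_mono) auto
      also have "\<dots> \<le> (\<Sum>n<N. 1\<^sup>2) * (\<Sum>n<N. (?x n)\<^sup>2)" by (rule Cauchy_Schwarz_ineq_sum)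
      also have "\<dots> \<le> real N * (\<Sum>n<N. \<epsilon>\<^sup>2 * ((norm (?U n) * A2)\<^sup>2 * (18 * (norm (M n k))\<^sup>2 + 8 * (norm (D n k))\<^sup>2)))"
      proof -
        have "(?x n)\<^sup>2 \<le> \<epsilon>\<^sup>2 * ((norm (?U n) * A2)\<^sup>2 * (18 * (norm (M n k))\<^sup>2 + 8 * (norm (D n k))\<^sup>2))" for n
        proof -
          have "(3 * norm (M n k) + 2 * norm (D n k))\<^sup>2 \<le> 18 * (norm (M n k))\<^sup>2 + 8 * (norm (D n k))\<^sup>2"
            using sum_squares_bound[of "3 * norm (M n k)" "2 * norm (D n k)"] by (simp add: power2_sum power_mult_distrib)
          then have "(\<epsilon> * (norm (?U n) * A2))\<^sup>2 * (3 * norm (M n k) + 2 * norm (D n k))\<^sup>2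
              \<le> (\<epsilon> * (norm (?U n) * A2))\<^sup>2 * (18 * (norm (M n k))\<^sup>2 + 8 * (norm (D n k))\<^sup>2)"
            by (intro mult_left_mono) auto
          then show ?thesis by (simp add: power_mult_distrib mult_ac)
        qed
        then show ?thesis by (simp add: mult_left_mono sum_mono)
      qed
      finally show ?thesis .
    qed
    have "(\<Sum>k<K. (norm (Y k))\<^sup>2) \<le> (\<Sum>k<K. real N * (\<Sum>n<N. \<epsilon>\<^sup>2 * ((norm (?U n) * A2)\<^sup>2 * (18 * (norm (M n k))\<^sup>2 + 8 * (norm (D n k))\<^sup>2))))"
      by (intro sum_mono Yk)
    also have "\<dots> = real N * (\<Sum>n<N. \<epsilon>\<^sup>2 * ((norm (?U n) * A2)\<^sup>2 * (18 * (\<Sum>k<K. (norm (M n k))\<^sup>2) + 8 * (\<Sum>k<K. (norm (D n k))\<^sup>2))))"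
      unfolding sum_distrib_left[symmetric]
      by (subst sum.swap) (simp add: sum_distrib_left sum.distrib distrib_left mult_ac)
    also have "\<dots> \<le> real N * (\<Sum>n<N. \<epsilon>\<^sup>2 * ((norm (?U n) * A2)\<^sup>2 * (18 * nM n + 8 * nD n)))"
      unfolding M_def D_def nM_def nD_def
      by (intro mult_left_mono sum_mono add_mono Bessel[OF DB(3) c] phiL RL) auto
    also have "\<dots> = C / 2 * \<epsilon>\<^sup>2" by (simp add: C_def sum_distrib_left[symmetric] mult_ac)
    finally have YY: "(\<Sum>k<K. (norm (Y k))\<^sup>2) \<le> C / 2 * \<epsilon>\<^sup>2" .
    have "(norm (X k))\<^sup>2 \<le> 2 * (norm (Y k))\<^sup>2 + 2 * (norm (X k - Y k))\<^sup>2" for k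
    proof -
      have "(norm (X k))\<^sup>2 \<le> (norm (Y k) + norm (X k - Y k))\<^sup>2"
        using norm_triangle_ineq[of "Y k" "X k - Y k"] by (intro power_mono) auto
      also have "\<dots> \<le> 2 * (norm (Y k))\<^sup>2 + 2 * (norm (X k - Y k))\<^sup>2"
        using sum_squares_bound[of "norm (Y k)" "norm (X k - Y k)"] by (simp add: power2_sum)
      finally show ?thesis .
    qed
    then have "(\<Sum>k<K. (norm (X k))\<^sup>2) \<le> (\<Sum>k<K. 2 * (norm (Y k))\<^sup>2 + 2 * (norm (X k - Y k))\<^sup>2)"
      by (intro sum_mono)
    also have "\<dots> = 2 * (\<Sum>k<K. (norm (Y k))\<^sup>2) + 2 * (\<Sum>k<K. (norm (X k - Y k))\<^sup>2)"
      by (simp add: sum.distrib sum_distrib_left)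
    finally have "(\<Sum>k<K. (norm (X k))\<^sup>2) \<le> C * \<epsilon>\<^sup>2 + 2 * ((2 * A1 + \<epsilon> * A2) * \<delta>)\<^sup>2"
      using XY YY by linarith
    moreover have "(norm (X k))\<^sup>2 = (nu k)\<^sup>2 * (norm (a k 0))\<^sup>2" for k
      by (simp add: X_def norm_mult power_mult_distrib)
    ultimately show "(\<Sum>k<K. (nu k)\<^sup>2 * (norm (a k 0))\<^sup>2) \<le> C * \<epsilon>\<^sup>2 + 2 * ((2 * A1 + \<epsilon> * A2) * \<delta>)\<^sup>2" by simp
  qed
qed

section \<open>Convergence of gradual time reversal\<close>

lemma is_weak_partial_add_AE:
  assumes o: "open \<Omega>" and g: "g1 \<in> L2_on \<Omega>" "g2 \<in> L2_on \<Omega>" and h: "h1 \<in> L2_on \<Omega>" "h2 \<in> L2_on \<Omega>"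
    and b: "b \<in> Basis" and w: "is_weak_partial \<Omega> b g1 h1" "is_weak_partial \<Omega> b g2 h2"
    and ae: "AE x in lebesgue_on \<Omega>. g x = g1 x + g2 x" and gL: "g \<in> L2_on \<Omega>"
  shows "is_weak_partial \<Omega> b g (\<lambda>x. h1 x + h2 x)"
  unfolding is_weak_partial_def
proof
  fix \<eta> assume t: "\<eta> \<in> test_functions \<Omega>"
  have i: "integrable (lebesgue_on \<Omega>) (\<lambda>x. \<eta> x *\<^sub>R k x)" "integrable (lebesgue_on \<Omega>) (\<lambda>x. pd b \<eta> x *\<^sub>R k x)"
    if "k \<in> L2_on \<Omega>" for k
    using L2_on_mult_integrable[OF that test_function_L2(1)[OF t o]]
      L2_on_mult_integrable[OF that test_function_L2(2)[OF t o b]]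
    by (simp_all add: scaleR_conv_of_real mult.commute)
  have "(LINT x|lebesgue_on \<Omega>. pd b \<eta> x *\<^sub>R g x) = (LINT x|lebesgue_on \<Omega>. pd b \<eta> x *\<^sub>R g1 x + pd b \<eta> x *\<^sub>R g2 x)"
  proof (rule integral_cong_AE)
    show "AE x in lebesgue_on \<Omega>. pd b \<eta> x *\<^sub>R g x = pd b \<eta> x *\<^sub>R g1 x + pd b \<eta> x *\<^sub>R g2 x"
      using ae by eventually_elim (simp add: scaleR_right_distrib)
  qed (use i(2)[OF gL] i(2)[OF g(1)] i(2)[OF g(2)] in \<open>auto dest: borel_measurable_integrable\<close>)
  also have "\<dots> = - (LINT x|lebesgue_on \<Omega>. \<eta> x *\<^sub>R h1 x) - (LINT x|lebesgue_on \<Omega>. \<eta> x *\<^sub>R h2 x)"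
    using w t i(2) g by (simp add: is_weak_partial_def)
  also have "\<dots> = - (LINT x|lebesgue_on \<Omega>. \<eta> x *\<^sub>R (h1 x + h2 x))"
    using i(1)[OF h(1)] i(1)[OF h(2)] by (simp add: scaleR_right_distrib)
  finally show "(LINT x|lebesgue_on \<Omega>. pd b \<eta> x *\<^sub>R g x) = - (LINT x|lebesgue_on \<Omega>. \<eta> x *\<^sub>R (h1 x + h2 x))" .
qed

text \<open>At time 0 the cut-off equals 1, so the reconstruction error is the value of the Dirichlet part
  there.\<close>

lemma reversal_error_H1:
  fixes \<epsilon> :: real and \<alpha> :: "real \<Rightarrow> real"
  assumes c: "c > 0" and e: "\<epsilon> > 0" and \<alpha>0: "\<alpha> 0 = 1"
    and f: "f \<in> H1_on unit_disk" and u0: "u 0 \<in> L2_on unit_disk" "AE x in lebesgue_on unit_disk. u 0 x = f x"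
    and v: "\<forall>t\<in>{0..1 / \<epsilon>}. \<forall>x\<in>unit_disk. v t x = u t x * of_real (\<alpha> (\<epsilon> * t)) + w t x"
    and db: "dirichlet_basis c \<psi> nu" and w: "L2_sums unit_disk (\<lambda>k x. a k * \<psi> k x) (w 0)"
    and E: "\<And>K. (\<Sum>k<K. (nu k)\<^sup>2 * (norm (a k))\<^sup>2) \<le> E"
  shows "v 0 \<in> H1_on unit_disk" "H1_norm unit_disk (\<lambda>x. v 0 x - f x) \<le> sqrt (2 * E)"
proof -
  let ?M = "lebesgue_on unit_disk"
  have fL: "f \<in> L2_on unit_disk" using f by (simp add: H1_on_def)
  have wL: "w 0 \<in> L2_on unit_disk" using w by (simp add: L2_sums_def)
  obtain W where W: "\<And>b. b \<in> Basis \<Longrightarrow> W b \<in> L2_on unit_disk"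
    "\<And>b. b \<in> Basis \<Longrightarrow> is_weak_partial unit_disk b (w 0) (W b)"
    and WE: "(L2_norm unit_disk (w 0))\<^sup>2 + (\<Sum>b\<in>Basis. (L2_norm unit_disk (W b))\<^sup>2) \<le> 2 * E"
    by (rule dirichlet_series_H1[OF db c w E]) blast
  have v0: "v 0 x = u 0 x + w 0 x" if "x \<in> unit_disk" for x
  proof -
    have "0 \<in> {0..1 / \<epsilon>}" using e by simp
    from bspec[OF bspec[OF v this] that] show ?thesis by (simp add: \<alpha>0)
  qed
  have vae: "AE x in ?M. v 0 x = f x + w 0 x"
  proof -
    have "AE x in ?M. x \<in> unit_disk" by (rule AE_I2) simp
    with u0(2) show ?thesis by eventually_elim (simp add: v0)
  qed
  have vm: "v 0 \<in> borel_measurable ?M"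
  proof -
    have "(\<lambda>x. u 0 x + w 0 x) \<in> borel_measurable ?M" by (rule L2_on_measurable[OF L2_on_add[OF u0(1) wL]])
    then show ?thesis by (rule measurable_cong[THEN iffD1, rotated]) (simp add: v0)
  qed
  have vL: "v 0 \<in> L2_on unit_disk"
    by (rule L2_on_cong_AE[OF L2_on_add[OF fL wL] _ vm]) (use vae in \<open>auto elim: eventually_mono\<close>)
  have "\<exists>h\<in>L2_on unit_disk. is_weak_partial unit_disk b (v 0) h" if b: "b \<in> Basis" for b
  proof -
    obtain h where h: "h \<in> L2_on unit_disk" "is_weak_partial unit_disk b f h"
      using f b by (auto simp: H1_on_def)
    show ?thesis
      using is_weak_partial_add_AE[OF open_ball fL wL h(1) W(1)[OF b] b h(2) W(2)[OF b] vae vL]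
        L2_on_add[OF h(1) W(1)[OF b]] by blast
  qed
  then show "v 0 \<in> H1_on unit_disk" using vL by (simp add: H1_on_def)
  have dL: "(\<lambda>x. v 0 x - f x) \<in> L2_on unit_disk" by (rule L2_on_diff[OF vL fL])
  have dae: "AE x in ?M. v 0 x - f x = w 0 x" using vae by eventually_elim simp
  have dw: "is_weak_partial unit_disk b (\<lambda>x. v 0 x - f x) (W b)" if b: "b \<in> Basis" for b
  proof -
    have z: "is_weak_partial unit_disk b (\<lambda>x. 0) (\<lambda>x. 0)" by (simp add: is_weak_partial_def)
    have "is_weak_partial unit_disk b (\<lambda>x. v 0 x - f x) (\<lambda>x. W b x + 0)"
      by (rule is_weak_partial_add_AE[OF open_ball wL L2_on_zero W(1)[OF b] L2_on_zero b W(2)[OF b] z _ dL])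
        (use dae in simp)
    then show ?thesis by simp
  qed
  have "L2_norm unit_disk (\<lambda>x. v 0 x - f x) = L2_norm unit_disk (w 0)"
    by (rule L2_norm_cong_AE[OF dae L2_on_measurable[OF dL] L2_on_measurable[OF wL]])
  moreover have "H1_norm unit_disk (\<lambda>x. v 0 x - f x)
      = sqrt ((L2_norm unit_disk (\<lambda>x. v 0 x - f x))\<^sup>2 + (\<Sum>b\<in>Basis. (L2_norm unit_disk (W b))\<^sup>2))"
    by (rule H1_norm_eq[OF W(1) dw])
  ultimately show "H1_norm unit_disk (\<lambda>x. v 0 x - f x) \<le> sqrt (2 * E)" using WE by simp
qed

theorem theorem2:
  fixes c :: real
    and \<alpha> :: "real \<Rightarrow> real"
    and f :: "real^2 \<Rightarrow> complex"
    and u :: "real \<Rightarrow> real^2 \<Rightarrow> complex"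
    and v :: "real \<Rightarrow> real \<Rightarrow> real^2 \<Rightarrow> complex"
  assumes "c > 0"
    and "cutoff \<alpha>"
    and "f \<in> H1_on unit_disk"
    and "\<exists>K. compact K \<and> K \<subseteq> unit_disk \<and> (AE x in lebesgue_on unit_disk. x \<notin> K \<longrightarrow> f x = 0)"
    and "forward_solution c f u"
    and "\<And>\<epsilon>. \<epsilon> > 0 \<Longrightarrow> gradual_time_reversal c \<alpha> \<epsilon> u (v \<epsilon>)"
  shows "(\<forall>\<epsilon>>0. v \<epsilon> 0 \<in> H1_on unit_disk) \<and>
         ((\<lambda>\<epsilon>. H1_norm unit_disk (\<lambda>x. v \<epsilon> 0 x - f x)) \<longlongrightarrow> 0) (at_right 0)"
proof -
  note c = assms(1) and reversal = assms(6)
  have fL: "f \<in> L2_on unit_disk" using assms(3) by (simp add: H1_on_def)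
  obtain \<phi> lam where nb: "neumann_basis c \<phi> lam"
    and u: "\<And>t. t \<ge> 0 \<Longrightarrow> L2_sums unit_disk (\<lambda>n x. inner_c c f (\<phi> n) * \<phi> n x * of_real (cos (lam n * t))) (u t)"
    using assms(5) unfolding forward_solution_def by blast
  have B: "orthonormal_basis_c c \<phi>" using nb by (simp add: neumann_basis_def)
  obtain A1 A2 where A: "A1 \<ge> 0" "A2 \<ge> 0" and \<alpha>0: "\<alpha> 0 = 1" and a1: "deriv01 \<alpha> 1 = 0"
    and d1: "\<And>t. t \<in> {0..1} \<Longrightarrow> (deriv01 \<alpha> has_real_derivative deriv01 (deriv01 \<alpha>) t) (at t within {0..1})"
    and c2: "continuous_on {0..1} (deriv01 (deriv01 \<alpha>))"
    and b1: "\<And>t. t \<in> {0..1} \<Longrightarrow> \<bar>deriv01 \<alpha> t\<bar> \<le> A1" and b2: "\<And>t. t \<in> {0..1} \<Longrightarrow> \<bar>deriv01 (deriv01 \<alpha>) t\<bar> \<le> A2"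
    by (rule cutoff_data[OF assms(2)]) blast
  have u0L: "u 0 \<in> L2_on unit_disk" using u[of 0] by (simp add: L2_sums_def)
  have u0: "AE x in lebesgue_on unit_disk. u 0 x = f x"
  proof (rule L2_norm_diff_zero_AE[OF u0L fL])
    let ?S = "\<lambda>N x. \<Sum>n<N. inner_c c f (\<phi> n) * \<phi> n x"
    have SL: "?S N \<in> L2_on unit_disk" for N by (intro L2_on_sum L2_on_scale orthonormal_basisD(1)[OF B])
    have 1: "(\<lambda>N. L2_norm unit_disk (\<lambda>x. ?S N x - u 0 x)) \<longlonglongrightarrow> 0" using u[of 0] by (simp add: L2_sums_def)
    have 2: "(\<lambda>N. L2_norm unit_disk (\<lambda>x. ?S N x - f x)) \<longlonglongrightarrow> 0"
      using orthonormal_basisD(3)[OF B fL] by (simp add: L2_sums_def)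
    have "L2_norm unit_disk (\<lambda>x. u 0 x - f x) \<le> 0 + 0"
    proof (rule LIMSEQ_le_const[OF tendsto_add[OF 1 2]], intro exI allI impI)
      fix N
      show "L2_norm unit_disk (\<lambda>x. u 0 x - f x)
          \<le> L2_norm unit_disk (\<lambda>x. ?S N x - u 0 x) + L2_norm unit_disk (\<lambda>x. ?S N x - f x)"
        using L2_norm_diff_triangle[OF u0L SL fL, of N] L2_norm_minus_commute[of unit_disk "u 0" "?S N"] by simp
    qed
    then show "L2_norm unit_disk (\<lambda>x. u 0 x - f x) = 0" by (simp add: antisym)
  qed
  let ?p = "\<lambda>n. (1 + (lam n)\<^sup>2) * (norm (inner_c c f (\<phi> n)))\<^sup>2"
  have summ: "summable ?p"
  proof -
    obtain ut where ut: "L2_time_derivative u ut"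
      using reversal[of 1] unfolding gradual_time_reversal_def by auto
    show ?thesis by (rule forward_energy_summable[OF nb c fL _ ut]) (rule u)
  qed
  have bound: "\<exists>C\<ge>0. \<forall>\<epsilon>>0. v \<epsilon> 0 \<in> H1_on unit_disk \<and>
      H1_norm unit_disk (\<lambda>x. v \<epsilon> 0 x - f x) \<le> sqrt (2 * (C * \<epsilon>\<^sup>2 + 2 * ((2 * A1 + \<epsilon> * A2) * \<delta>)\<^sup>2))"
    if \<delta>: "\<delta> > 0" for \<delta>
  proof -
    obtain N where N: "\<And>m n. m \<ge> N \<Longrightarrow> norm (sum ?p {m..<n}) < \<delta>\<^sup>2"
      using summ[unfolded summable_Cauchy] zero_less_power[OF \<delta>, of 2] by blast
    have tail: "(\<Sum>n\<in>{N..<K}. ?p n) \<le> \<delta>\<^sup>2" for K using N[of N K] by simp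
    show ?thesis
    proof (rule error_energy_bound[OF nb c u A a1 d1 c2 b1 b2 tail less_imp_le[OF \<delta>]])
      fix C :: real assume C: "C \<ge> 0"
        and CE: "\<And>\<epsilon> ut \<psi> nu a a' K. \<epsilon> > 0 \<Longrightarrow> L2_time_derivative u ut \<Longrightarrow> dirichlet_basis c \<psi> nu \<Longrightarrow>
        (\<And>k t. t \<in> {0..1/\<epsilon>} \<Longrightarrow> (a k has_vector_derivative a' k t) (at t within {0..1/\<epsilon>})) \<Longrightarrow>
        (\<And>k t. t \<in> {0..1/\<epsilon>} \<Longrightarrow> (a' k has_vector_derivative
            (inner_c c (source_term \<alpha> \<epsilon> u ut t) (\<psi> k) - of_real ((nu k)\<^sup>2) * a k t)) (at t within {0..1/\<epsilon>})) \<Longrightarrow>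
        (\<And>k. a k (1/\<epsilon>) = 0 \<and> a' k (1/\<epsilon>) = 0) \<Longrightarrow>
        (\<Sum>k<K. (nu k)\<^sup>2 * (norm (a k 0))\<^sup>2) \<le> C * \<epsilon>\<^sup>2 + 2 * ((2 * A1 + \<epsilon> * A2) * \<delta>)\<^sup>2"
      have "v \<epsilon> 0 \<in> H1_on unit_disk \<and>
          H1_norm unit_disk (\<lambda>x. v \<epsilon> 0 x - f x) \<le> sqrt (2 * (C * \<epsilon>\<^sup>2 + 2 * ((2 * A1 + \<epsilon> * A2) * \<delta>)\<^sup>2))"
        if e: "\<epsilon> > 0" for \<epsilon>
      proof -
        obtain ut w where ut: "L2_time_derivative u ut"
          and bw: "backward_dirichlet_solution c (1 / \<epsilon>) (source_term \<alpha> \<epsilon> u ut) w"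
          and v: "\<forall>t\<in>{0..1 / \<epsilon>}. \<forall>x\<in>unit_disk. v \<epsilon> t x = u t x * of_real (\<alpha> (\<epsilon> * t)) + w t x"
          using reversal[OF e] unfolding gradual_time_reversal_def by blast
        obtain \<psi> nu a a' where db: "dirichlet_basis c \<psi> nu"
          and ode: "\<forall>k. \<forall>t\<in>{0..1/\<epsilon>}. (a k has_vector_derivative a' k t) (at t within {0..1/\<epsilon>}) \<and>
            (a' k has_vector_derivative (inner_c c (source_term \<alpha> \<epsilon> u ut t) (\<psi> k) - of_real ((nu k)\<^sup>2) * a k t))
              (at t within {0..1/\<epsilon>})"
          and fin: "\<forall>k. a k (1/\<epsilon>) = 0 \<and> a' k (1/\<epsilon>) = 0"
          and w: "\<forall>t\<in>{0..1/\<epsilon>}. L2_sums unit_disk (\<lambda>k x. a k t * \<psi> k x) (w t)"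
          using bw unfolding backward_dirichlet_solution_def by blast
        have w0: "L2_sums unit_disk (\<lambda>k x. a k 0 * \<psi> k x) (w 0)" using w e by simp
        have E: "(\<Sum>k<K. (nu k)\<^sup>2 * (norm (a k 0))\<^sup>2) \<le> C * \<epsilon>\<^sup>2 + 2 * ((2 * A1 + \<epsilon> * A2) * \<delta>)\<^sup>2" for K
          by (rule CE[OF e ut db]) (use ode fin in blast)+
        show ?thesis
          using reversal_error_H1[OF c e \<alpha>0 assms(3) u0L u0 v db w0 E] by blast
      qed
      then show ?thesis using C by blast
    qed
  qed
  have "((\<lambda>\<epsilon>. H1_norm unit_disk (\<lambda>x. v \<epsilon> 0 x - f x)) \<longlongrightarrow> 0) (at_right 0)"
  proof (rule tendstoI)
    fix r :: real assume r: "r > 0"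
    \<comment> \<open>This \<open>\<delta>\<close> makes the limit of the bound as \<open>\<epsilon>\<close> tends to 0, which is \<open>4 A1 \<delta>\<close>, at most \<open>r/2\<close>.\<close>
    define \<delta> where "\<delta> = r / (4 * (2 * A1 + 1))"
    have \<delta>: "\<delta> > 0" using r A by (simp add: \<delta>_def)
    obtain C where C: "C \<ge> 0" and H: "\<And>\<epsilon>. \<epsilon> > 0 \<Longrightarrow>
      H1_norm unit_disk (\<lambda>x. v \<epsilon> 0 x - f x) \<le> sqrt (2 * (C * \<epsilon>\<^sup>2 + 2 * ((2 * A1 + \<epsilon> * A2) * \<delta>)\<^sup>2))"
      using bound[OF \<delta>] by blast
    let ?b = "\<lambda>\<epsilon>. sqrt (2 * (C * \<epsilon>\<^sup>2 + 2 * ((2 * A1 + \<epsilon> * A2) * \<delta>)\<^sup>2))"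
    have "(?b \<longlongrightarrow> sqrt (2 * (C * 0\<^sup>2 + 2 * ((2 * A1 + 0 * A2) * \<delta>)\<^sup>2))) (at_right 0)"
      by (intro tendsto_intros)
    moreover have "sqrt (2 * (C * 0\<^sup>2 + 2 * ((2 * A1 + 0 * A2) * \<delta>)\<^sup>2)) < r"
    proof -
      have "sqrt (2 * (C * 0\<^sup>2 + 2 * ((2 * A1 + 0 * A2) * \<delta>)\<^sup>2)) = sqrt ((2 * (2 * A1 * \<delta>))\<^sup>2)"
        by (simp add: power_mult_distrib)
      also have "\<dots> = 2 * (2 * A1 * \<delta>)" using A \<delta> by (simp only: real_sqrt_abs) simp
      also have "\<dots> \<le> 2 * ((2 * A1 + 1) * \<delta>)" using \<delta> by (simp add: algebra_simps)
      also have "\<dots> = r / 2"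
      proof -
        have "2 * (q * (r / (4 * q))) = r / 2" if "q > 0" for q :: real using that by simp
        from this[of "2 * A1 + 1"] show ?thesis using A by (simp only: \<delta>_def)
      qed
      finally show ?thesis using r by linarith
    qed
    ultimately have "\<forall>\<^sub>F \<epsilon> in at_right 0. ?b \<epsilon> < r" by (rule order_tendstoD)
    moreover have "\<forall>\<^sub>F \<epsilon> in at_right 0. \<epsilon> > (0::real)" by (rule eventually_at_right_less)
    ultimately show "\<forall>\<^sub>F \<epsilon> in at_right 0. dist (H1_norm unit_disk (\<lambda>x. v \<epsilon> 0 x - f x)) 0 < r"
    proof eventually_elim
      case (elim \<epsilon>)
      have "0 \<le> H1_norm unit_disk (\<lambda>x. v \<epsilon> 0 x - f x)"
        unfolding H1_norm_def by (intro real_sqrt_ge_zero add_nonneg_nonneg sum_nonneg) auto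
      then show ?case using H[OF elim(2)] elim(1) by (simp add: dist_real_def)
    qed
  qed
  moreover have "\<forall>\<epsilon>>0. v \<epsilon> 0 \<in> H1_on unit_disk" using bound[of 1] by auto
  ultimately show ?thesis by blast
qed

end
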